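(* There are isomorphisms (of $\mathcal{A}_f$-bimodules) $$\Omega_d^n(\mathcal{A}_f)\cong\begin{cases}\mathcal{A}_f\oplus\mathcal{I}_\beta & \text{if } n=1,\\ \{0\} & \text{if } n\geq 2,\end{cases}$$ where $\mathcal{I}_\beta$ is the two-sided ideal of $\mathcal{A}_f$ generated by $\beta$ and $\beta^*$.
   Context: Let $0<q<1$. Let $\mathcal{A}$ be the universal $C^*$-algebra (continuous functions on the quantum $SU(2)$ group) generated by $\alpha,\beta$ with relations $\alpha^*\alpha+\beta^*\beta=I$, $\alpha\alpha^*+q^2\beta\beta^*=I$, $\alpha\beta=q\beta\alpha$, $\alpha\beta^*=q\beta^*\alpha$, $\beta^*\beta=\beta\beta^*$. Let $\mathcal{H}=L_2(\mathbb{N})\otimes L_2(\mathbb{Z})$ with $\mathbb{N}=\{0,1,2,\ldots\}$, canonical orthonormal basis $e_{ij}=e_i\otimes e_j$ ($i\in\mathbb{N}$, $j\in\mathbb{Z}$). On $L_2(\mathbb{N})$ or $L_2(\mathbb{Z})$, $N$ denotes the operator $e_k\mapsto ke_k$ and $\ell$ the operator $e_k\mapsto e_{k-1}$ (with $\ell e_0=0$ on $L_2(\mathbb{N})$). The faithful representation $\pi$ of $\mathcal{A}$ on $\mathcal{H}$ is $\pi(\alpha)=\ell\sqrt{I-q^{2N}}\otimes I$, $\pi(\beta)=q^N\otimes\ell$. $\mathcal{A}_f$ is the $*$-subalgebra of $\mathcal{A}$ generated by $\alpha$ and $\beta$. Let $S$ be the operator on $L_2(\mathbb{Z})$ with $Se_j=e_j$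 for $j\ge 0$ and $Se_j=-e_j$ for $j<0$, and let $D=N\otimes S+I\otimes N$ on $\mathcal{H}$, i.e. $De_{ij}=(i+j)e_{ij}$ for $j\ge0$ and $De_{ij}=(-i+j)e_{ij}$ for $j<0$. For $a\in\mathcal{A}_f$ the commutator $[D,\pi(a)]$ extends to a bounded operator. Let $\Omega^\bullet(\mathcal{A}_f)=\bigoplus_n\Omega^n(\mathcal{A}_f)$ be the universal graded differential algebra over $\mathcal{A}_f$ with differential $\delta$: $\Omega^0(\mathcal{A}_f)=\mathcal{A}_f$, $\Omega^n(\mathcal{A}_f)=\mathrm{span}\{a_0(\delta a_1)\cdots(\delta a_n):a_i\in\mathcal{A}_f\}$, $\delta(ab)=a(\delta b)+(\delta a)b$ for $a,b\in\mathcal{A}_f$. Let $\theta$ be the quotient map from the bounded operators $\mathcal{L}(\mathcal{H})$ onto the Calkin algebra $\mathcal{Q}(\mathcal{H})=\mathcal{L}(\mathcal{H})/\mathcal{K}(\mathcal{H})$. Define $\psi_n:\Omega^n(\mathcal{A}_f)\to\mathcal{Q}(\mathcal{H})$ by $\psi_n(a_0(\delta a_1)\cdots(\delta a_n))=\theta\big(\pi(a_0)[D,\pi(a_1)]\cdots[D,\pi(a_n)]\big)$, $J_n=\ker\psi_n$, and for $n\ge 1$ $$\Omega_d^n(\mathcal{A}_f)=\Omega^n(\mathcal{A}_f)/(J_n+\delta J_{n-1}).$$ *)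

theory Defs
  imports
    "HOL-Analysis.Analysis"
    "HOL-Algebra.Module"
    "HOL-Algebra.QuotRing"
    "HOL-Algebra.Generated_Groups"
    "HOL-Library.Poly_Mapping"
begin

section \<open>Complex normed spaces and unital C*-algebras\<close>

class scaleC =
  fixes scaleC :: "complex \<Rightarrow> 'a \<Rightarrow> 'a"  (infixr \<open>*\<^sub>C\<close> 75)

class complex_normed_vector = real_normed_vector + scaleC +
  assumes scaleC_add_right: "c *\<^sub>C (x + y) = c *\<^sub>C x + c *\<^sub>C y"
    and scaleC_add_left: "(c + d) *\<^sub>C x = c *\<^sub>C x + d *\<^sub>C x"
    and scaleC_scaleC: "c *\<^sub>C (d *\<^sub>C x) = (c * d) *\<^sub>C x"
    and scaleC_of_real: "complex_of_real r *\<^sub>C x = r *\<^sub>R x"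
    and norm_scaleC: "norm (c *\<^sub>C x) = cmod c * norm x"

class cstar_algebra = complex_normed_vector + real_normed_algebra_1 + complete_space +
  fixes star :: "'a \<Rightarrow> 'a"
  assumes scaleC_mult_left: "(c *\<^sub>C x) * y = c *\<^sub>C (x * y)"
    and scaleC_mult_right: "x * (c *\<^sub>C y) = c *\<^sub>C (x * y)"
    and star_star: "star (star x) = x"
    and star_add: "star (x + y) = star x + star y"
    and star_scaleC: "star (c *\<^sub>C x) = cnj c *\<^sub>C star x"
    and star_mult: "star (x * y) = star y * star x"
    and cstar_identity: "norm (star x * x) = (norm x)\<^sup>2"

inductive_set star_alg_gen :: "'a::cstar_algebra set \<Rightarrow> 'a set" for G where
  gen: "x \<in> G \<Longrightarrow> x \<in> star_alg_gen G"
| add: "x \<in> star_alg_gen G \<Longrightarrow> y \<in> star_alg_gen G \<Longrightarrow> x + y \<in> star_alg_gen G"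
| mult: "x \<in> star_alg_gen G \<Longrightarrow> y \<in> star_alg_gen G \<Longrightarrow> x * y \<in> star_alg_gen G"
| scaleC: "x \<in> star_alg_gen G \<Longrightarrow> c *\<^sub>C x \<in> star_alg_gen G"
| star: "x \<in> star_alg_gen G \<Longrightarrow> star x \<in> star_alg_gen G"

section \<open>The Hilbert space of square-summable families\<close>

typedef 'i ell2 = "{f :: 'i \<Rightarrow> complex. (\<lambda>i. (cmod (f i))\<^sup>2) summable_on UNIV}"
  morphisms coef Abs_ell2
  by (rule exI[of _ "\<lambda>_. 0"]) simp

lemma coef_summable: "(\<lambda>i. (cmod (coef f i))\<^sup>2) summable_on UNIV"
  using coef[of f] by simp

lemma ell2_eqI: "(\<And>i. coef f i = coef g i) \<Longrightarrow> f = g"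
  by (metis coef_inject ext)

lemma square_summable_add:
  fixes f g :: "'i \<Rightarrow> complex"
  assumes "(\<lambda>i. (cmod (f i))\<^sup>2) summable_on UNIV" "(\<lambda>i. (cmod (g i))\<^sup>2) summable_on UNIV"
  shows "(\<lambda>i. (cmod (f i + g i))\<^sup>2) summable_on UNIV"
proof (rule summable_on_comparison_test)
  show "(\<lambda>i. 2 * ((cmod (f i))\<^sup>2 + (cmod (g i))\<^sup>2)) summable_on UNIV"
    by (intro summable_on_cmult_right summable_on_add assms)
  fix i
  have "(cmod (f i + g i))\<^sup>2 \<le> (cmod (f i) + cmod (g i))\<^sup>2"
    by (intro power_mono norm_triangle_ineq) auto
  also have "\<dots> \<le> 2 * ((cmod (f i))\<^sup>2 + (cmod (g i))\<^sup>2)"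
    using sum_squares_bound[of "cmod (f i)" "cmod (g i)"] by (simp add: power2_sum)
  finally show "(cmod (f i + g i))\<^sup>2 \<le> 2 * ((cmod (f i))\<^sup>2 + (cmod (g i))\<^sup>2)" .
qed auto

lemma square_summable_mult:
  fixes f :: "'i \<Rightarrow> complex"
  assumes "(\<lambda>i. (cmod (f i))\<^sup>2) summable_on UNIV"
  shows "(\<lambda>i. (cmod (c * f i))\<^sup>2) summable_on UNIV"
  using summable_on_cmult_right[OF assms, of "(cmod c)\<^sup>2"]
  by (simp add: norm_mult power_mult_distrib)

instantiation ell2 :: (type) real_vector
begin

definition "zero_ell2 = (Abs_ell2 (\<lambda>_. 0) :: 'a ell2)"
definition "plus_ell2 f g = (Abs_ell2 (\<lambda>i. coef f i + coef g i) :: 'a ell2)"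
definition "uminus_ell2 f = (Abs_ell2 (\<lambda>i. - coef f i) :: 'a ell2)"
definition "minus_ell2 f g = (Abs_ell2 (\<lambda>i. coef f i - coef g i) :: 'a ell2)"
definition "scaleR_ell2 r f = (Abs_ell2 (\<lambda>i. complex_of_real r * coef f i) :: 'a ell2)"

lemma coef_zero [simp]: "coef 0 i = 0"
  by (simp add: zero_ell2_def Abs_ell2_inverse)

lemma coef_plus [simp]: "coef (f + g) i = coef f i + coef g i"
  by (simp add: plus_ell2_def Abs_ell2_inverse square_summable_add coef_summable)

lemma coef_uminus [simp]: "coef (- f) i = - coef f i"
  by (simp add: uminus_ell2_def Abs_ell2_inverse coef_summable)

lemma coef_minus [simp]: "coef (f - g) i = coef f i - coef g i"
  using square_summable_add[OF coef_summable[of f] coef_summable[of "- g"]]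
  by (simp add: minus_ell2_def Abs_ell2_inverse)

lemma coef_scaleR [simp]: "coef (r *\<^sub>R f) i = complex_of_real r * coef f i"
  using square_summable_mult[OF coef_summable[of f], of "complex_of_real r"]
  by (simp add: scaleR_ell2_def Abs_ell2_inverse)

instance
  by standard (auto intro!: ell2_eqI simp: algebra_simps)

end

lemma inner_coef_summable: "(\<lambda>i. coef f i \<bullet> coef g i) summable_on UNIV"
proof (rule Infinite_Sum.abs_summable_summable, rule Infinite_Sum.abs_summable_on_comparison_test)
  show "(\<lambda>i. norm ((cmod (coef f i))\<^sup>2 + (cmod (coef g i))\<^sup>2)) summable_on UNIV"
    using summable_on_add[OF coef_summable[of f] coef_summable[of g]] by simp
  fix i
  have "\<bar>coef f i \<bullet> coef g i\<bar> \<le> cmod (coef f i) * cmod (coef g i)"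
    by (rule Cauchy_Schwarz_ineq2)
  also have "\<dots> \<le> (cmod (coef f i))\<^sup>2 + (cmod (coef g i))\<^sup>2"
    using sum_squares_bound[of "cmod (coef f i)" "cmod (coef g i)"]
      mult_nonneg_nonneg[of "cmod (coef f i)" "cmod (coef g i)"]
    by (simp add: field_simps del: mult_nonneg_nonneg)
  finally show "norm (coef f i \<bullet> coef g i) \<le> norm ((cmod (coef f i))\<^sup>2 + (cmod (coef g i))\<^sup>2)"
    by simp
qed

instantiation ell2 :: (type) real_inner
begin

definition inner_ell2 :: "'a ell2 \<Rightarrow> 'a ell2 \<Rightarrow> real"
  where "inner_ell2 f g = (\<Sum>\<^sub>\<infinity>i. coef f i \<bullet> coef g i)"
definition norm_ell2 :: "'a ell2 \<Rightarrow> real"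
  where "norm_ell2 f = sqrt (\<Sum>\<^sub>\<infinity>i. (cmod (coef f i))\<^sup>2)"
definition sgn_ell2 :: "'a ell2 \<Rightarrow> 'a ell2"
  where "sgn_ell2 f = inverse (norm f) *\<^sub>R f"
definition dist_ell2 :: "'a ell2 \<Rightarrow> 'a ell2 \<Rightarrow> real"
  where "dist_ell2 f g = norm (f - g)"
definition uniformity_ell2 :: "('a ell2 \<times> 'a ell2) filter"
  where "uniformity_ell2 = (INF e\<in>{0<..}. principal {(x, y). dist x y < e})"
definition open_ell2 :: "'a ell2 set \<Rightarrow> bool"
  where "open_ell2 U = (\<forall>x\<in>U. eventually (\<lambda>(x', y). x' = x \<longrightarrow> y \<in> U) uniformity)"

instance
proof
  fix x y z :: "'a ell2" and r :: real
  show "x \<bullet> y = y \<bullet> x"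
    by (simp add: inner_ell2_def inner_commute)
  show "(x + y) \<bullet> z = x \<bullet> z + y \<bullet> z"
    by (simp add: inner_ell2_def inner_add_left infsum_add inner_coef_summable)
  have *: "coef (r *\<^sub>R x) i \<bullet> coef y i = r * (coef x i \<bullet> coef y i)" for i
    by (simp flip: scaleR_conv_of_real)
  show "(r *\<^sub>R x) \<bullet> y = r * (x \<bullet> y)"
    unfolding inner_ell2_def * by (rule infsum_cmult_right')
  show "0 \<le> x \<bullet> x"
    by (simp add: inner_ell2_def infsum_nonneg)
  show "(x \<bullet> x = 0) = (x = 0)"
  proof
    assume "x \<bullet> x = 0"
    then have "coef x i \<bullet> coef x i = 0" for i
      using nonneg_infsum_le_0D[OF _ inner_coef_summable[of x x], of i]
      by (simp add: inner_ell2_def)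
    then show "x = 0" by (auto intro: ell2_eqI)
  qed (simp add: inner_ell2_def)
  show "norm x = sqrt (x \<bullet> x)"
    by (simp add: norm_ell2_def inner_ell2_def power2_norm_eq_inner)
qed (simp_all add: sgn_ell2_def dist_ell2_def uniformity_ell2_def open_ell2_def)

end

instantiation ell2 :: (type) complex_normed_vector
begin

definition "scaleC_ell2 c f = (Abs_ell2 (\<lambda>i. c * coef f i) :: 'a ell2)"

lemma coef_scaleC [simp]: "coef (c *\<^sub>C f) i = c * coef f i"
  using square_summable_mult[OF coef_summable[of f], of c]
  by (simp add: scaleC_ell2_def Abs_ell2_inverse)

instance
proof
  fix c :: complex and x :: "'a ell2"
  have "(\<Sum>\<^sub>\<infinity>i. (cmod (coef (c *\<^sub>C x) i))\<^sup>2) = (cmod c)\<^sup>2 * (\<Sum>\<^sub>\<infinity>i. (cmod (coef x i))\<^sup>2)"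
    unfolding coef_scaleC norm_mult power_mult_distrib by (rule infsum_cmult_right')
  then show "norm (c *\<^sub>C x) = cmod c * norm x"
    by (simp add: norm_ell2_def real_sqrt_mult)
qed (auto intro!: ell2_eqI simp: algebra_simps)

end

definition cinner :: "'i ell2 \<Rightarrow> 'i ell2 \<Rightarrow> complex"
  where "cinner f g = (\<Sum>\<^sub>\<infinity>i. cnj (coef f i) * coef g i)"

definition ket :: "'i \<Rightarrow> 'i ell2"
  where "ket i = Abs_ell2 (\<lambda>k. if k = i then 1 else 0)"

section \<open>Bounded operators and the Calkin algebra\<close>

instantiation blinfun :: (real_normed_vector, complex_normed_vector) complex_normed_vector
begin

definition scaleC_blinfun :: "complex \<Rightarrow> ('a \<Rightarrow>\<^sub>L 'b) \<Rightarrow> ('a \<Rightarrow>\<^sub>L 'b)"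
  where "scaleC_blinfun c T = Blinfun (\<lambda>x. c *\<^sub>C blinfun_apply T x)"

lemma blinfun_apply_scaleC [simp]: "blinfun_apply (c *\<^sub>C T) x = c *\<^sub>C blinfun_apply T x"
proof -
  have comm: "c *\<^sub>C (r *\<^sub>R y) = r *\<^sub>R (c *\<^sub>C y)" for r and y :: 'b
    by (metis scaleC_of_real scaleC_scaleC mult.commute)
  have "bounded_linear (\<lambda>x. c *\<^sub>C blinfun_apply T x)"
  proof (rule bounded_linear_intro[where K = "cmod c * norm T"])
    show "norm (c *\<^sub>C blinfun_apply T x) \<le> norm x * (cmod c * norm T)" for x
      using mult_left_mono[OF norm_blinfun[of T x], of "cmod c"]
      by (simp add: norm_scaleC mult_ac)
  qed (simp_all add: blinfun.add_right blinfun.scaleR_right scaleC_add_right comm)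
  then show ?thesis
    by (simp add: scaleC_blinfun_def bounded_linear_Blinfun_apply)
qed

instance
proof
  fix c :: complex and T :: "'a \<Rightarrow>\<^sub>L 'b"
  have le: "norm (d *\<^sub>C S) \<le> cmod d * norm S" for d and S :: "'a \<Rightarrow>\<^sub>L 'b"
  proof (rule norm_blinfun_bound)
    show "norm (blinfun_apply (d *\<^sub>C S) x) \<le> cmod d * norm S * norm x" for x
      using mult_left_mono[OF norm_blinfun[of S x], of "cmod d"]
      by (simp add: norm_scaleC mult_ac)
  qed simp
  show "norm (c *\<^sub>C T) = cmod c * norm T"
  proof (cases "c = 0")
    case True
    then show ?thesis using le[of c T] by simp
  next
    case False
    have one: "1 *\<^sub>C x = x" for x :: 'b
      using scaleC_of_real[of 1 x] by simp
    have "inverse c *\<^sub>C (c *\<^sub>C T) = T"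
      by (rule blinfun_eqI) (simp add: scaleC_scaleC one False)
    then have "norm T \<le> inverse (cmod c) * norm (c *\<^sub>C T)"
      using le[of "inverse c" "c *\<^sub>C T"] by (simp add: norm_inverse)
    then have "cmod c * norm T \<le> norm (c *\<^sub>C T)"
      using False by (simp add: field_simps)
    with le[of c T] show ?thesis by simp
  qed
qed (auto intro!: blinfun_eqI
    simp: blinfun.add_left blinfun.scaleR_left scaleC_add_right scaleC_add_left
      scaleC_scaleC scaleC_of_real)

end

text \<open>Elements of \<open>_ \<Rightarrow>\<^sub>L _\<close> are only real-linear, so complex linearity is imposed separately.\<close>

definition complex_linear :: "('i ell2 \<Rightarrow>\<^sub>L 'i ell2) \<Rightarrow> bool"
  where "complex_linear T \<longleftrightarrow> (\<forall>c x. blinfun_apply T (c *\<^sub>C x) = c *\<^sub>C blinfun_apply T x)"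

definition adjoint_ops :: "('i ell2 \<Rightarrow>\<^sub>L 'i ell2) \<Rightarrow> ('i ell2 \<Rightarrow>\<^sub>L 'i ell2) \<Rightarrow> bool"
  where "adjoint_ops T T' \<longleftrightarrow>
    (\<forall>x y. cinner (blinfun_apply T x) y = cinner x (blinfun_apply T' y))"

definition bounded_ops :: "('i ell2 \<Rightarrow>\<^sub>L 'i ell2) ring"
  where "bounded_ops =
    \<lparr>carrier = {T. complex_linear T}, mult = (o\<^sub>L), one = id_blinfun, zero = 0, add = (+)\<rparr>"

definition compact_ops :: "('i ell2 \<Rightarrow>\<^sub>L 'i ell2) set"
  where "compact_ops =
    {T. complex_linear T \<and> compact (closure (blinfun_apply T ` cball 0 1))}"

definition calkin :: "('i ell2 \<Rightarrow>\<^sub>L 'i ell2) set ring"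
  where "calkin = bounded_ops Quot compact_ops"

definition calkin_map :: "('i ell2 \<Rightarrow>\<^sub>L 'i ell2) \<Rightarrow> ('i ell2 \<Rightarrow>\<^sub>L 'i ell2) set"
  where "calkin_map T = compact_ops +>\<^bsub>bounded_ops\<^esub> T"

section \<open>The quantum SU(2) algebra, its representation and the Dirac operator\<close>

text \<open>\<open>L\<^sub>2(\<nat>) \<otimes> L\<^sub>2(\<int>)\<close>, with \<open>e\<^sub>i\<^sub>j = e\<^sub>i \<otimes> e\<^sub>j\<close> written as \<open>ket (i, j)\<close>.\<close>

type_synonym hilb = "(nat \<times> int) ell2"

text \<open>The defining relations, for elements \<open>a, b\<close> with adjoints \<open>a', b'\<close>; stated for a
  multiplication \<open>m\<close> with unit \<open>e\<close> because they are used both in an abstract C*-algebra and for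
  operators.\<close>

definition suq2_relations ::
    "('x::real_vector \<Rightarrow> 'x \<Rightarrow> 'x) \<Rightarrow> 'x \<Rightarrow> real \<Rightarrow> 'x \<Rightarrow> 'x \<Rightarrow> 'x \<Rightarrow> 'x \<Rightarrow> bool"
  where "suq2_relations m e q a a' b b' \<longleftrightarrow>
    m a' a + m b' b = e \<and>
    m a a' + q\<^sup>2 *\<^sub>R m b b' = e \<and>
    m a b = q *\<^sub>R m b a \<and>
    m a b' = q *\<^sub>R m b' a \<and>
    m b' b = m b b'"

definition star_rep :: "('a::cstar_algebra \<Rightarrow> hilb \<Rightarrow>\<^sub>L hilb) \<Rightarrow> bool"
  where "star_rep \<rho> \<longleftrightarrow>
    (\<forall>x. complex_linear (\<rho> x)) \<and>
    \<rho> 1 = id_blinfun \<and>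
    (\<forall>x y. \<rho> (x + y) = \<rho> x + \<rho> y) \<and>
    (\<forall>x y. \<rho> (x * y) = \<rho> x o\<^sub>L \<rho> y) \<and>
    (\<forall>c x. \<rho> (c *\<^sub>C x) = c *\<^sub>C \<rho> x) \<and>
    (\<forall>x. adjoint_ops (\<rho> x) (\<rho> (star x)))"

text \<open>The universal property is tested on operators on the separable infinite-dimensional space
  \<^typ>\<open>hilb\<close>. Every unital C*-algebra generated by two elements is separable, hence isomorphic to
  a unital C*-algebra of operators on it, so this is the usual universal property. Uniqueness of
  \<open>\<rho>\<close> follows from the density clause.\<close>

definition universal_suq2 :: "real \<Rightarrow> 'a::cstar_algebra \<Rightarrow> 'a \<Rightarrow> bool"
  where "universal_suq2 q a b \<longleftrightarrow>
    suq2_relations (*) 1 q a (star a) b (star b) \<and>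
    closure (star_alg_gen {a, b}) = UNIV \<and>
    (\<forall>S S' T T'. complex_linear S \<and> complex_linear S' \<and> complex_linear T \<and> complex_linear T' \<and>
        adjoint_ops S S' \<and> adjoint_ops T T' \<and> suq2_relations (o\<^sub>L) id_blinfun q S S' T T' \<longrightarrow>
      (\<exists>\<rho> :: 'a \<Rightarrow> hilb \<Rightarrow>\<^sub>L hilb. star_rep \<rho> \<and> \<rho> a = S \<and> \<rho> b = T))"

text \<open>\<open>\<ell>\<surd>(I - q\<^bsup>2N\<^esup>) \<otimes> I\<close> and \<open>q\<^bsup>N\<^esup> \<otimes> \<ell>\<close> on the basis (for \<open>i = 0\<close> the coefficient of the first
  one is \<open>0\<close>).\<close>

definition suq2_rep :: "real \<Rightarrow> 'a::cstar_algebra \<Rightarrow> 'a \<Rightarrow> ('a \<Rightarrow> hilb \<Rightarrow>\<^sub>L hilb) \<Rightarrow> bool"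
  where "suq2_rep q a b \<rho> \<longleftrightarrow>
    star_rep \<rho> \<and>
    (\<forall>i j. blinfun_apply (\<rho> a) (ket (i, j)) = sqrt (1 - q ^ (2 * i)) *\<^sub>R ket (i - 1, j)) \<and>
    (\<forall>i j. blinfun_apply (\<rho> b) (ket (i, j)) = q ^ i *\<^sub>R ket (i, j - 1))"

fun dirac_ev :: "nat \<times> int \<Rightarrow> real"
  where "dirac_ev (i, j) = (if j \<ge> 0 then of_nat i + of_int j else - of_nat i + of_int j)"

text \<open>Meaningful when \<open>k \<mapsto> dirac_ev k * coef f k\<close> is square-summable, in particular on
  \<open>dirac_core\<close>, the linear span of the basis.\<close>

definition dirac :: "hilb \<Rightarrow> hilb"
  where "dirac f = Abs_ell2 (\<lambda>k. complex_of_real (dirac_ev k) * coef f k)"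

definition dirac_core :: "hilb set"
  where "dirac_core = {f. finite {k. coef f k \<noteq> 0}}"

text \<open>The bounded extension of \<open>[D, T]\<close>, which is unique because \<open>dirac_core\<close> is dense. It is only
  used for \<open>T = \<pi>(a)\<close> with \<open>a\<close> in the *-algebra generated by \<open>\<alpha>, \<beta>\<close>; such \<open>T\<close> preserve
  \<open>dirac_core\<close>.\<close>

definition dirac_commutator :: "hilb \<Rightarrow>\<^sub>L hilb \<Rightarrow> hilb \<Rightarrow>\<^sub>L hilb"
  where "dirac_commutator T = (THE C. complex_linear C \<and>
    (\<forall>f\<in>dirac_core. blinfun_apply C f = dirac (blinfun_apply T f) - blinfun_apply T (dirac f)))"

section \<open>The universal differential algebra\<close>

text \<open>For a unital subalgebra \<open>A\<close>, the algebra generated by symbols \<open>a\<close> and \<open>\<delta>a\<close>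
  (\<open>a \<in> A\<close>) subject to: \<open>a \<mapsto> a\<close> is a unital algebra homomorphism, \<open>\<delta>\<close> is linear, and
  \<open>\<delta>(ab) = a \<delta>b + \<delta>a b\<close>. The free algebra is the monoid algebra of words.\<close>

datatype 'a letter = Elt 'a | Dif 'a

datatype 'a word = Word (letters: "'a letter list")

instantiation word :: (type) monoid_add
begin
definition "0 = Word []"
definition "v + w = Word (letters v @ letters w)"
instance
  by standard (simp_all add: zero_word_def plus_word_def)
end

type_synonym 'a free_alg = "'a word \<Rightarrow>\<^sub>0 complex"

definition const :: "complex \<Rightarrow> 'a free_alg"
  where "const c = Poly_Mapping.single 0 c"

definition elt :: "'a \<Rightarrow> 'a free_alg"
  where "elt a = Poly_Mapping.single (Word [Elt a]) 1"

definition dif :: "'a \<Rightarrow> 'a free_alg"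
  where "dif a = Poly_Mapping.single (Word [Dif a]) 1"

definition free_alg :: "'a set \<Rightarrow> 'a free_alg ring"
  where "free_alg A =
    \<lparr>carrier = {p. \<forall>w\<in>Poly_Mapping.keys p. \<forall>l\<in>set (letters w). l \<in> Elt ` A \<union> Dif ` A},
     mult = (*), one = 1, zero = 0, add = (+)\<rparr>"

definition omega_relations :: "'a::cstar_algebra set \<Rightarrow> 'a free_alg set"
  where "omega_relations A =
    {elt 1 - 1} \<union>
    {elt (a + b) - (elt a + elt b) |a b. a \<in> A \<and> b \<in> A} \<union>
    {elt (c *\<^sub>C a) - const c * elt a |c a. a \<in> A} \<union>
    {elt (a * b) - elt a * elt b |a b. a \<in> A \<and> b \<in> A} \<union>
    {dif (a + b) - (dif a + dif b) |a b. a \<in> A \<and> b \<in> A} \<union>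
    {dif (c *\<^sub>C a) - const c * dif a |c a. a \<in> A} \<union>
    {dif (a * b) - (elt a * dif b + dif a * elt b) |a b. a \<in> A \<and> b \<in> A}"

definition omega_ideal :: "'a::cstar_algebra set \<Rightarrow> 'a free_alg set"
  where "omega_ideal A = Idl\<^bsub>free_alg A\<^esub> (omega_relations A)"

definition omega :: "'a::cstar_algebra set \<Rightarrow> 'a free_alg set ring"
  where "omega A = free_alg A Quot omega_ideal A"

definition omega_class :: "'a::cstar_algebra set \<Rightarrow> 'a free_alg \<Rightarrow> 'a free_alg set"
  where "omega_class A p = omega_ideal A +>\<^bsub>free_alg A\<^esub> p"

definition omega_incl :: "'a::cstar_algebra set \<Rightarrow> 'a \<Rightarrow> 'a free_alg set"
  where "omega_incl A a = omega_class A (elt a)"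

text \<open>The differential on the free algebra: the graded derivation with \<open>a \<mapsto> \<delta>a\<close> and
  \<open>\<delta>a \<mapsto> 0\<close>, so that \<open>\<delta>(a\<^sub>0 \<delta>a\<^sub>1 \<dots> \<delta>a\<^sub>n) = \<delta>a\<^sub>0 \<delta>a\<^sub>1 \<dots> \<delta>a\<^sub>n\<close>. It preserves
  \<open>omega_ideal A\<close>.\<close>

fun word_diff :: "'a letter list \<Rightarrow> 'a free_alg"
  where
    "word_diff [] = 0"
  | "word_diff (Elt a # w) = dif a * Poly_Mapping.single (Word w) 1 + elt a * word_diff w"
  | "word_diff (Dif a # w) = - (dif a * word_diff w)"

definition free_diff :: "'a free_alg \<Rightarrow> 'a free_alg"
  where "free_diff p =
    (\<Sum>w\<in>Poly_Mapping.keys p. const (Poly_Mapping.lookup p w) * word_diff (letters w))"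

definition omega_diff :: "'a::cstar_algebra set \<Rightarrow> 'a free_alg set \<Rightarrow> 'a free_alg set"
  where "omega_diff A X = the_elem ((\<lambda>p. omega_class A (free_diff p)) ` X)"

text \<open>\<open>a\<^sub>0 \<delta>a\<^sub>1 \<dots> \<delta>a\<^sub>n\<close>\<close>

definition omega_form :: "'a::cstar_algebra set \<Rightarrow> 'a \<Rightarrow> 'a list \<Rightarrow> 'a free_alg set"
  where "omega_form A a\<^sub>0 as = omega_incl A a\<^sub>0 \<otimes>\<^bsub>omega A\<^esub>
    foldr (\<lambda>a \<omega>. omega_diff A (omega_incl A a) \<otimes>\<^bsub>omega A\<^esub> \<omega>) as \<one>\<^bsub>omega A\<^esub>"

text \<open>The additive group generated by the forms is their complex span, as scalars can be absorbed
  into \<open>a\<^sub>0\<close>.\<close>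

definition omega_n :: "'a::cstar_algebra set \<Rightarrow> nat \<Rightarrow> 'a free_alg set set"
  where "omega_n A n = generate (add_monoid (omega A))
    {omega_form A a\<^sub>0 as |a\<^sub>0 as. a\<^sub>0 \<in> A \<and> set as \<subseteq> A \<and> length as = n}"

section \<open>Bimodules\<close>

record ('a, 'm) bimodule = "('a, 'm) module" +
  rsmult :: "'m \<Rightarrow> 'a \<Rightarrow> 'm"

definition bimodule_iso ::
    "('a, 'x) ring_scheme \<Rightarrow> ('a, 'm, 'y) bimodule_scheme \<Rightarrow> ('a, 'n, 'z) bimodule_scheme
      \<Rightarrow> ('m \<Rightarrow> 'n) \<Rightarrow> bool"
  where "bimodule_iso R M N \<phi> \<longleftrightarrow>
    bij_betw \<phi> (carrier M) (carrier N) \<and>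
    (\<forall>x\<in>carrier M. \<forall>y\<in>carrier M. \<phi> (x \<oplus>\<^bsub>M\<^esub> y) = \<phi> x \<oplus>\<^bsub>N\<^esub> \<phi> y) \<and>
    (\<forall>a\<in>carrier R. \<forall>x\<in>carrier M. \<phi> (a \<odot>\<^bsub>M\<^esub> x) = a \<odot>\<^bsub>N\<^esub> \<phi> x) \<and>
    (\<forall>a\<in>carrier R. \<forall>x\<in>carrier M. \<phi> (rsmult M x a) = rsmult N (\<phi> x) a)"

definition bimodule_isomorphic ::
    "('a, 'x) ring_scheme \<Rightarrow> ('a, 'm, 'y) bimodule_scheme \<Rightarrow> ('a, 'n, 'z) bimodule_scheme \<Rightarrow> bool"
  where "bimodule_isomorphic R M N \<longleftrightarrow> (\<exists>\<phi>. bimodule_iso R M N \<phi>)"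

definition ideal_bimodule :: "('a, 'x) ring_scheme \<Rightarrow> 'a set \<Rightarrow> ('a, 'a) bimodule"
  where "ideal_bimodule R I =
    \<lparr>carrier = I, mult = undefined, one = undefined, zero = \<zero>\<^bsub>R\<^esub>, add = add R,
     smult = mult R, rsmult = mult R\<rparr>"

definition direct_sum_bimodule ::
    "('a, 'm, 'y) bimodule_scheme \<Rightarrow> ('a, 'n, 'z) bimodule_scheme \<Rightarrow> ('a, 'm \<times> 'n) bimodule"
  where "direct_sum_bimodule M N =
    \<lparr>carrier = carrier M \<times> carrier N, mult = undefined, one = undefined,
     zero = (\<zero>\<^bsub>M\<^esub>, \<zero>\<^bsub>N\<^esub>),
     add = (\<lambda>(x, y) (x', y'). (x \<oplus>\<^bsub>M\<^esub> x', y \<oplus>\<^bsub>N\<^esub> y')),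
     smult = (\<lambda>a (x, y). (a \<odot>\<^bsub>M\<^esub> x, a \<odot>\<^bsub>N\<^esub> y)),
     rsmult = (\<lambda>(x, y) a. (rsmult M x a, rsmult N y a))\<rparr>"

definition quotient_bimodule ::
    "('a, 'm, 'y) bimodule_scheme \<Rightarrow> 'm set \<Rightarrow> ('a, 'm set) bimodule"
  where "quotient_bimodule M W =
    \<lparr>carrier = a_rcosets\<^bsub>M\<^esub> W, mult = undefined, one = undefined, zero = W, add = set_add M,
     smult = (\<lambda>a X. \<Union>x\<in>X. W +>\<^bsub>M\<^esub> (a \<odot>\<^bsub>M\<^esub> x)),
     rsmult = (\<lambda>X a. \<Union>x\<in>X. W +>\<^bsub>M\<^esub> (rsmult M x a))\<rparr>"

definition omega_bimodule :: "'a::cstar_algebra set \<Rightarrow> nat \<Rightarrow> ('a, 'a free_alg set) bimodule"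
  where "omega_bimodule A n =
    \<lparr>carrier = omega_n A n, mult = undefined, one = undefined,
     zero = \<zero>\<^bsub>omega A\<^esub>, add = add (omega A),
     smult = (\<lambda>a \<omega>. omega_incl A a \<otimes>\<^bsub>omega A\<^esub> \<omega>),
     rsmult = (\<lambda>\<omega> a. \<omega> \<otimes>\<^bsub>omega A\<^esub> omega_incl A a)\<rparr>"

section \<open>The differential forms of the spectral triple\<close>

text \<open>\<open>op_eval \<pi>\<close> is the algebra homomorphism \<open>a \<mapsto> \<pi>(a)\<close>, \<open>\<delta>a \<mapsto> [D, \<pi>(a)]\<close> on the free algebra.
  Composed with the Calkin map it factors through \<open>omega A\<close>, and on the degree-\<open>n\<close> part it sends
  \<open>a\<^sub>0 \<delta>a\<^sub>1 \<dots> \<delta>a\<^sub>n\<close> to the class of \<open>\<pi>(a\<^sub>0) [D, \<pi>(a\<^sub>1)] \<dots> [D, \<pi>(a\<^sub>n)]\<close>.\<close>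

fun letter_op :: "('a \<Rightarrow> hilb \<Rightarrow>\<^sub>L hilb) \<Rightarrow> 'a letter \<Rightarrow> hilb \<Rightarrow>\<^sub>L hilb"
  where
    "letter_op \<pi> (Elt a) = \<pi> a"
  | "letter_op \<pi> (Dif a) = dirac_commutator (\<pi> a)"

definition word_op :: "('a \<Rightarrow> hilb \<Rightarrow>\<^sub>L hilb) \<Rightarrow> 'a word \<Rightarrow> hilb \<Rightarrow>\<^sub>L hilb"
  where "word_op \<pi> w = foldr (\<lambda>l T. letter_op \<pi> l o\<^sub>L T) (letters w) id_blinfun"

definition op_eval :: "('a \<Rightarrow> hilb \<Rightarrow>\<^sub>L hilb) \<Rightarrow> 'a free_alg \<Rightarrow> hilb \<Rightarrow>\<^sub>L hilb"
  where "op_eval \<pi> p = (\<Sum>w\<in>Poly_Mapping.keys p. Poly_Mapping.lookup p w *\<^sub>C word_op \<pi> w)"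

definition psi :: "('a \<Rightarrow> hilb \<Rightarrow>\<^sub>L hilb) \<Rightarrow> 'a free_alg set \<Rightarrow> (hilb \<Rightarrow>\<^sub>L hilb) set"
  where "psi \<pi> X = the_elem ((\<lambda>p. calkin_map (op_eval \<pi> p)) ` X)"

definition junk :: "'a::cstar_algebra set \<Rightarrow> ('a \<Rightarrow> hilb \<Rightarrow>\<^sub>L hilb) \<Rightarrow> nat \<Rightarrow> 'a free_alg set set"
  where "junk A \<pi> n = {\<omega> \<in> omega_n A n. psi \<pi> \<omega> = \<zero>\<^bsub>calkin\<^esub>}"

text \<open>Only meaningful for \<open>n \<ge> 1\<close>.\<close>

definition omega_d ::
    "'a::cstar_algebra set \<Rightarrow> ('a \<Rightarrow> hilb \<Rightarrow>\<^sub>L hilb) \<Rightarrow> nat \<Rightarrow> ('a, 'a free_alg set set) bimodule"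
  where "omega_d A \<pi> n = quotient_bimodule (omega_bimodule A n)
    (junk A \<pi> n <+>\<^bsub>omega A\<^esub> omega_diff A ` junk A \<pi> (n - 1))"

section \<open>The polynomial algebra\<close>

definition suq2_poly :: "'a::cstar_algebra \<Rightarrow> 'a \<Rightarrow> 'a ring"
  where "suq2_poly a b =
    \<lparr>carrier = star_alg_gen {a, b}, mult = (*), one = 1, zero = 0, add = (+)\<rparr>"

definition beta_ideal :: "'a::cstar_algebra \<Rightarrow> 'a \<Rightarrow> 'a set"
  where "beta_ideal a b = Idl\<^bsub>suq2_poly a b\<^esub> {b, star b}"

end

theory Submission
  imports Defs
begin

text \<open>
  Write \<open>S\<close> for the sign operator, so that modulo compact operators \<open>S\<^sup>2 = 1\<close> and \<open>S\<close> commutes with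
  \<open>\<pi>(A)\<close>. On generators one computes \<open>[D, \<pi>(a)] = S \<pi>(\<partial>\<^sub>1 a) + \<pi>(\<partial>\<^sub>2 a)\<close> modulo compact operators, where
  \<open>\<partial>\<^sub>1, \<partial>\<^sub>2\<close> are the derivations counting \<open>\<alpha>\<close> and \<open>\<beta>\<close>. An operator \<open>S \<pi>(x) + \<pi>(y)\<close> is compact only if
  \<open>x = y = 0\<close>: its matrix coefficients become constant along translations of \<open>\<int>\<close> towards \<open>\<plusminus>\<infinity>\<close>. Thus
  \<open>\<psi>\<close> amounts to a symbol map into pairs \<open>(x, y)\<close>, and \<open>J\<^sub>0 = 0\<close>. In degree 1 the first components
  form the ideal generated by \<open>\<alpha>, \<alpha>\<^sup>*\<close>, which contains \<open>1\<close>, and the second ones that generated by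
  \<open>\<beta>, \<beta>\<^sup>*\<close>. In degree 2 every symbol is already attained on \<open>\<delta>J\<^sub>1\<close>: a commutation relation
  \<open>b c = c' b\<close> of homogeneous elements puts \<open>\<delta>b c - c' \<delta>b\<close> into \<open>J\<^sub>1\<close>, and the symbols of the
  differentials of these forms generate everything. Higher degrees follow since
  \<open>(\<delta>e) \<delta>a\<^sub>1 \<dots> \<delta>a\<^sub>n = \<delta>(e \<delta>a\<^sub>1 \<dots> \<delta>a\<^sub>n)\<close>.
\<close>

section \<open>Coordinates in square-summable families\<close>

text \<open>The eigenvalues of \<open>D\<close> have slope +1 or -1 in i, according to the sign of
  j, and slope 1 in j. So commuting with \<open>D\<close> multiplies the shift of i in \<alpha> by
  the sign and the shift of j in \<beta> by a constant, except where \<beta> crosses between j = 0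
  and j = -1: there the eigenvalue jumps by an extra 2i, and the weight q^i of \<beta> makes this
  defect compact. Symbols multiply as elements x s + y of A[s] with s central and s^2 = 1. Hence the
  first component of a degree-2 symbol is built from x y' + y x', which lies in the \<beta>-ideal
  because y and y' do, while the second is only known to lie in A. This fixes what the differentials
  of junk have to fill: the ideal in one component, all of A in the other. The unit comes from
  \<alpha> and its adjoint through the scalar q^2 \<open>star \<alpha> * \<alpha>\<close> -
  \<open>\<alpha> * star \<alpha>\<close> = q^2 - 1. A formal obstacle is that elements of
  \<open>omega A\<close> are cosets in a free algebra and elements of \<open>omega_d\<close> are
  cosets of cosets; computations are therefore done on representatives modulo
  \<open>omega_ideal\<close>.\<close>

lemma scaleC_one [simp]: "1 *\<^sub>C x = (x :: 'a::complex_normed_vector)"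
  using scaleC_of_real[of 1 x] by simp

lemma scaleC_zero_left [simp]: "0 *\<^sub>C x = (0 :: 'a::complex_normed_vector)"
  using scaleC_of_real[of 0 x] by simp

lemma scaleC_zero_right [simp]: "c *\<^sub>C 0 = (0 :: 'a::complex_normed_vector)"
  using scaleC_add_right[of c 0 0] by simp

lemma scaleC_minus_one: "(-1) *\<^sub>C x = - (x :: 'a::complex_normed_vector)"
  using scaleC_of_real[of "-1" x] by simp

lemma scaleC_minus_right: "c *\<^sub>C (- x) = - (c *\<^sub>C (x :: 'a::complex_normed_vector))"
  using scaleC_add_right[of c x "- x"] by (simp add: add_eq_0_iff)

lemma scaleC_diff_right: "c *\<^sub>C (x - y) = c *\<^sub>C x - c *\<^sub>C (y :: 'a::complex_normed_vector)"
  using scaleC_add_right[of c x "- y"] by (simp add: scaleC_minus_right)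

lemma coef_ket [simp]: "coef (ket i) k = (if k = i then 1 else 0)"
proof -
  have "(\<lambda>k. (cmod (if k = i then 1 else 0))\<^sup>2) summable_on UNIV
    \<longleftrightarrow> (\<lambda>k. 1 :: real) summable_on {i}"
    by (rule summable_on_cong_neutral) auto
  then show ?thesis
    by (simp add: ket_def Abs_ell2_inverse)
qed

lemma coef_sum [simp]: "coef (sum f F) k = (\<Sum>x\<in>F. coef (f x) k)"
  by (induction F rule: infinite_finite_induct) auto

lemma norm_ell2_sq: "(norm f)\<^sup>2 = (\<Sum>\<^sub>\<infinity>i. (cmod (coef f i))\<^sup>2)"
  by (simp add: norm_ell2_def infsum_nonneg)

lemma cmod_coef_le_norm: "cmod (coef f k) \<le> norm f"
proof -
  have "(cmod (coef f k))\<^sup>2 \<le> (norm f)\<^sup>2"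
    using finite_sum_le_infsum[OF coef_summable[of f], of "{k}"] by (simp add: norm_ell2_sq)
  then show ?thesis
    by (rule power2_le_imp_le) simp
qed

lemma norm_ket [simp]: "norm (ket i) = 1"
proof -
  have "(norm (ket i))\<^sup>2 = (\<Sum>\<^sub>\<infinity>k. (cmod (coef (ket i) k))\<^sup>2)"
    by (rule norm_ell2_sq)
  also have "\<dots> = (\<Sum>\<^sub>\<infinity>k\<in>{i}. 1)"
    by (rule infsum_cong_neutral) auto
  finally have "(norm (ket i))\<^sup>2 = 1"
    by simp
  then show ?thesis
    by (metis abs_norm_cancel power2_eq_1_iff abs_minus_cancel abs_1)
qed

lemma cinner_ket: "cinner (ket k) y = coef y k"
proof -
  have "cinner (ket k) y = (\<Sum>\<^sub>\<infinity>i\<in>{k}. coef y i)"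
    unfolding cinner_def by (rule infsum_cong_neutral) auto
  then show ?thesis
    by simp
qed

lemma cinner_scaleR_ket: "cinner (r *\<^sub>R ket k) y = complex_of_real r * coef y k"
proof -
  have "cinner (r *\<^sub>R ket k) y = (\<Sum>\<^sub>\<infinity>i\<in>{k}. complex_of_real r * coef y i)"
    unfolding cinner_def by (rule infsum_cong_neutral) auto
  then show ?thesis
    by simp
qed

section \<open>Finite truncations and norm-compact sets\<close>

definition trunc :: "'i set \<Rightarrow> 'i ell2 \<Rightarrow> 'i ell2"
  where "trunc F f = (\<Sum>k\<in>F. coef f k *\<^sub>C ket k)"

lemma coef_trunc: "finite F \<Longrightarrow> coef (trunc F f) k = (if k \<in> F then coef f k else 0)"
  by (simp add: trunc_def if_distrib[of "\<lambda>x. _ * x"] cong: if_cong)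

lemma norm_minus_trunc_le:
  assumes "w summable_on UNIV" "\<And>k. (cmod (coef f k))\<^sup>2 \<le> w k" "finite F"
  shows "(norm (f - trunc F f))\<^sup>2 \<le> infsum w UNIV - sum w F"
proof -
  have w: "w summable_on (- F)"
    using assms(1) by (rule summable_on_subset_banach) auto
  have "(norm (f - trunc F f))\<^sup>2 \<le> (\<Sum>\<^sub>\<infinity>k\<in>-F. w k)"
    unfolding norm_ell2_sq
  proof (rule infsum_mono_neutral[OF coef_summable w])
    show "0 \<le> w k" for k
      using assms(2)[of k] zero_le_power2 order_trans by blast
  qed (use assms in \<open>auto simp: coef_trunc\<close>)
  also have "infsum w UNIV = infsum w F + infsum w (- F)"
    using infsum_Un_disjoint[of w F "- F"] w assms(3) by simp
  then have "(\<Sum>\<^sub>\<infinity>k\<in>-F. w k) = infsum w UNIV - sum w F"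
    using assms(3) by simp
  finally show ?thesis .
qed

text \<open>The squared error is at most the tail of \<open>w\<close>, which does not depend on the
  vector. This uniformity lets coordinatewise convergence control the norm in
  \<open>compact_dominated_ell2\<close>.\<close>

lemma uniform_limit_trunc:
  assumes "w summable_on UNIV"
  shows "uniform_limit {f. \<forall>k. (cmod (coef f k))\<^sup>2 \<le> w k} trunc (\<lambda>f. f) (finite_subsets_at_top UNIV)"
proof (rule uniform_limitI)
  fix e :: real assume "e > 0"
  have "(sum w \<longlongrightarrow> infsum w UNIV) (finite_subsets_at_top UNIV)"
    using assms by (rule infsum_tendsto)
  then have "\<forall>\<^sub>F F in finite_subsets_at_top UNIV. infsum w UNIV - sum w F < e\<^sup>2"
    using \<open>e > 0\<close> by (auto dest!: order_tendstoD(1)[of _ _ _ "infsum w UNIV - e\<^sup>2"] elim: eventually_mono)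
  moreover have "\<forall>\<^sub>F F in finite_subsets_at_top (UNIV :: 'a set). finite F"
    by (rule eventually_finite_subsets_at_top_weakI)
  ultimately show "\<forall>\<^sub>F F in finite_subsets_at_top UNIV.
      \<forall>f\<in>{f. \<forall>k. (cmod (coef f k))\<^sup>2 \<le> w k}. dist (trunc F f) f < e"
  proof eventually_elim
    case (elim F)
    show ?case
    proof clarify
      fix f :: "'a ell2" assume "\<forall>k. (cmod (coef f k))\<^sup>2 \<le> w k"
      then have "(norm (f - trunc F f))\<^sup>2 < e\<^sup>2"
        using norm_minus_trunc_le[OF assms, of f F] elim by auto
      then show "dist (trunc F f) f < e"
        using \<open>e > 0\<close> by (metis dist_commute dist_norm less_imp_le power2_less_imp_less)
    qed
  qed
qed

lemma trunc_tendsto: "((\<lambda>F. trunc F f) \<longlongrightarrow> f) (finite_subsets_at_top UNIV)"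
  by (rule tendsto_uniform_limitI[OF uniform_limit_trunc[OF coef_summable[of f]]]) auto

text \<open>Truncations are finite complex combinations of \<open>ket\<close> vectors and converge
  in norm, so continuity finishes the argument. The uniqueness of \<open>dirac_commutator\<close>
  rests on it.\<close>

lemma bounded_linear_eqI_ket:
  fixes S T :: "'i ell2 \<Rightarrow>\<^sub>L 'i ell2"
  assumes "complex_linear S" "complex_linear T" "\<And>k. blinfun_apply S (ket k) = blinfun_apply T (ket k)"
  shows "S = T"
proof (rule blinfun_eqI)
  fix f
  have lim: "((\<lambda>F. blinfun_apply R (trunc F f)) \<longlongrightarrow> blinfun_apply R f) (finite_subsets_at_top UNIV)"
    for R :: "'i ell2 \<Rightarrow>\<^sub>L 'i ell2"
    by (intro tendsto_intros trunc_tendsto)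
  have "blinfun_apply S (trunc F f) = blinfun_apply T (trunc F f)" for F
    using assms by (simp add: trunc_def blinfun.sum_right complex_linear_def)
  then show "blinfun_apply S f = blinfun_apply T f"
    using lim[of S] lim[of T] tendsto_unique[OF finite_subsets_at_top_neq_bot] by fastforce
qed

text \<open>This is a Hilbert cube. The product of the discs is compact for coordinatewise
  convergence by Tychonoff, and \<open>Abs_ell2\<close> is continuous from it into the norm
  topology, being a uniform limit of truncations that depend on finitely many coordinates
  each.\<close>

lemma compact_dominated_ell2:
  assumes "w summable_on UNIV"
  shows "compact {f :: 'i ell2. \<forall>k. (cmod (coef f k))\<^sup>2 \<le> w k}"
proof -
  let ?C = "{f :: 'i ell2. \<forall>k. (cmod (coef f k))\<^sup>2 \<le> w k}"
  let ?P = "PiE UNIV (\<lambda>k. cball 0 (sqrt (w k)) :: complex set)"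
  have le: "cmod z \<le> sqrt r \<longleftrightarrow> (cmod z)\<^sup>2 \<le> r" for z r
    by (metis abs_norm_cancel real_sqrt_abs real_sqrt_le_iff)
  have P: "(cmod (g k))\<^sup>2 \<le> w k" if "g \<in> ?P" for g k
    using that by (auto simp: PiE_iff le)
  have inv: "coef (Abs_ell2 g) = g" if "g \<in> ?P" for g
    using summable_on_comparison_test[OF assms, of "\<lambda>k. (cmod (g k))\<^sup>2"] P[OF that]
    by (intro Abs_ell2_inverse) auto
  have "compactin (product_topology (\<lambda>_. euclidean) UNIV) ?P"
    by (simp add: compactin_PiE)
  then have "compact ?P"
    by (simp add: euclidean_product_topology)
  moreover have "continuous_on ?P Abs_ell2"
  proof (rule uniform_limit_theorem)
    show "uniform_limit ?P (\<lambda>F g. trunc F (Abs_ell2 g)) Abs_ell2 (finite_subsets_at_top UNIV)"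
      by (rule uniform_limit_compose'[OF uniform_limit_trunc[OF assms]]) (use inv P in auto)
    have cs: "continuous_on UNIV (\<lambda>c. c *\<^sub>C x)" for x :: "'i ell2"
    proof (rule linear_continuous_on[OF bounded_linear_intro[where K = "norm x"]])
      show "(r *\<^sub>R c) *\<^sub>C x = r *\<^sub>R (c *\<^sub>C x)" for r c
        by (simp add: scaleR_conv_of_real flip: scaleC_scaleC scaleC_of_real)
    qed (auto simp: scaleC_add_left norm_scaleC)
    have "continuous_on ?P (\<lambda>g. \<Sum>k\<in>F. g k *\<^sub>C ket k)" for F
      by (intro continuous_on_sum continuous_on_compose2[OF cs]
          continuous_on_subset[OF continuous_on_product_coordinates]) auto
    then have "continuous_on ?P (\<lambda>g. trunc F (Abs_ell2 g))" for F
      by (rule continuous_on_eq) (simp add: trunc_def inv)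
    then show "\<forall>\<^sub>F F in finite_subsets_at_top UNIV. continuous_on ?P (\<lambda>g. trunc F (Abs_ell2 g))"
      by simp
  qed simp
  ultimately have "compact (Abs_ell2 ` ?P)"
    using compact_continuous_image by blast
  moreover have "Abs_ell2 ` ?P = ?C"
  proof (intro equalityI subsetI)
    fix f assume "f \<in> ?C"
    then have "coef f \<in> ?P"
      by (auto simp: PiE_iff le)
    then show "f \<in> Abs_ell2 ` ?P"
      by (metis coef_inverse image_eqI)
  qed (use inv P in auto)
  ultimately show ?thesis
    by simp
qed

section \<open>Complex-linear and compact operators\<close>

lemma blinfun_compose_simps:
  "(A + B) o\<^sub>L C = (A o\<^sub>L C) + (B o\<^sub>L C)" "C o\<^sub>L (A + B) = (C o\<^sub>L A) + (C o\<^sub>L B)"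
  "(A - B) o\<^sub>L C = (A o\<^sub>L C) - (B o\<^sub>L C)" "C o\<^sub>L (A - B) = (C o\<^sub>L A) - (C o\<^sub>L B)"
  "(- A) o\<^sub>L C = - (A o\<^sub>L C)" "C o\<^sub>L (- A) = - (C o\<^sub>L A)"
  by (auto intro!: blinfun_eqI simp: blinfun.bilinear_simps)

lemma blinfun_compose_assoc: "(A o\<^sub>L B) o\<^sub>L C = A o\<^sub>L (B o\<^sub>L C)"
  by (auto intro!: blinfun_eqI)

lemma blinfun_compose_scaleC_left: "(c *\<^sub>C A) o\<^sub>L B = c *\<^sub>C (A o\<^sub>L B)"
  by (auto intro!: blinfun_eqI)

lemma blinfun_compose_scaleC_right:
  "complex_linear A \<Longrightarrow> A o\<^sub>L (c *\<^sub>C B) = c *\<^sub>C (A o\<^sub>L B)"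
  by (auto intro!: blinfun_eqI simp: complex_linear_def)

lemma blinfun_compose_id [simp]: "id_blinfun o\<^sub>L A = A" "A o\<^sub>L id_blinfun = A"
  by (auto intro!: blinfun_eqI)

lemma complex_linear_intros [simp]:
  "complex_linear 0" "complex_linear id_blinfun"
  "complex_linear A \<Longrightarrow> complex_linear B \<Longrightarrow> complex_linear (A + B)"
  "complex_linear A \<Longrightarrow> complex_linear B \<Longrightarrow> complex_linear (A - B)"
  "complex_linear A \<Longrightarrow> complex_linear (- A)"
  "complex_linear A \<Longrightarrow> complex_linear B \<Longrightarrow> complex_linear (A o\<^sub>L B)"
  "complex_linear A \<Longrightarrow> complex_linear (c *\<^sub>C A)"
  by (auto simp: complex_linear_def blinfun.bilinear_simps scaleC_add_right scaleC_diff_right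
      scaleC_minus_right scaleC_scaleC mult.commute)

lemma compact_opsI:
  assumes "complex_linear T" "compact C" "\<And>x. norm x \<le> 1 \<Longrightarrow> blinfun_apply T x \<in> C"
  shows "T \<in> compact_ops"
proof -
  have "closure (blinfun_apply T ` cball 0 1) \<subseteq> C"
    by (rule closure_minimal) (use assms compact_imp_closed in auto)
  then have "compact (closure (blinfun_apply T ` cball 0 1))"
    using assms(2) compact_Int_closed[of C "closure (blinfun_apply T ` cball 0 1)"]
    by (simp add: Int_absorb1)
  then show ?thesis
    using assms(1) by (simp add: compact_ops_def)
qed

lemma compact_opsE:
  assumes "T \<in> compact_ops"
  obtains C where "compact C" "\<And>x. norm x \<le> 1 \<Longrightarrow> blinfun_apply T x \<in> C"
proof
  show "compact (closure (blinfun_apply T ` cball 0 1))"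
    using assms by (simp add: compact_ops_def)
  show "blinfun_apply T x \<in> closure (blinfun_apply T ` cball 0 1)" if "norm x \<le> 1" for x
    by (rule subsetD[OF closure_subset]) (use that in simp)
qed

lemma compact_ops_complex_linear [simp]: "T \<in> compact_ops \<Longrightarrow> complex_linear T"
  by (simp add: compact_ops_def)

lemma compact_ops_dominated:
  fixes T :: "'i ell2 \<Rightarrow>\<^sub>L 'i ell2"
  assumes "complex_linear T" "w summable_on UNIV"
    "\<And>x k. norm x \<le> 1 \<Longrightarrow> (cmod (coef (blinfun_apply T x) k))\<^sup>2 \<le> w k"
  shows "T \<in> compact_ops"
  by (rule compact_opsI[OF assms(1) compact_dominated_ell2[OF assms(2)]]) (use assms(3) in auto)

lemma compact_ops_zero [simp]: "0 \<in> compact_ops"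
  by (rule compact_opsI[of _ "{0}"]) auto

lemma compact_ops_add:
  assumes "S \<in> compact_ops" "T \<in> compact_ops"
  shows "S + T \<in> compact_ops"
proof -
  obtain C where C: "compact C" "\<And>x. norm x \<le> 1 \<Longrightarrow> blinfun_apply S x \<in> C"
    using assms(1) by (auto elim: compact_opsE)
  obtain D where D: "compact D" "\<And>x. norm x \<le> 1 \<Longrightarrow> blinfun_apply T x \<in> D"
    using assms(2) by (auto elim: compact_opsE)
  show ?thesis
    by (rule compact_opsI[of _ "{x + y |x y. x \<in> C \<and> y \<in> D}"])
      (use assms C D in \<open>auto intro: compact_sums simp: blinfun.bilinear_simps\<close>)
qed

lemma compact_ops_compose_left:
  assumes "complex_linear A" "T \<in> compact_ops"
  shows "A o\<^sub>L T \<in> compact_ops"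
proof -
  obtain C where C: "compact C" "\<And>x. norm x \<le> 1 \<Longrightarrow> blinfun_apply T x \<in> C"
    using assms(2) by (auto elim: compact_opsE)
  have "compact (blinfun_apply A ` C)"
    by (rule compact_continuous_image) (use C in \<open>auto intro!: continuous_intros\<close>)
  then show ?thesis
    by (rule compact_opsI[rotated]) (use assms C in auto)
qed

lemma compact_ops_compose_right:
  assumes "complex_linear A" "T \<in> compact_ops"
  shows "T o\<^sub>L A \<in> compact_ops"
proof -
  obtain C where C: "compact C" "\<And>x. norm x \<le> 1 \<Longrightarrow> blinfun_apply T x \<in> C"
    using assms(2) by (auto elim: compact_opsE)
  \<comment> \<open>The summand 1 keeps \<open>r\<close> positive when \<open>A = 0\<close>, so that
    \<open>A x\<close> can be rescaled into the unit ball.\<close>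
  define r where "r = norm A + 1"
  have r: "r > 0"
    by (simp add: r_def add_nonneg_pos)
  show ?thesis
  proof (rule compact_opsI)
    show "compact ((*\<^sub>R) r ` C)"
      using C(1) by (rule compact_scaling)
    fix x :: "'a ell2" assume x: "norm x \<le> 1"
    have "norm (blinfun_apply A x) \<le> norm A * 1"
      by (rule order_trans[OF norm_blinfun]) (intro mult_left_mono x, simp)
    then have "norm (inverse r *\<^sub>R blinfun_apply A x) \<le> 1"
      using r by (simp add: r_def field_simps)
    from imageI[OF C(2)[OF this], of "(*\<^sub>R) r"] show "blinfun_apply (T o\<^sub>L A) x \<in> (*\<^sub>R) r ` C"
      using r by (simp add: blinfun.scaleR_right)
  qed (use assms in auto)
qed

lemma compact_ops_scaleC:
  assumes "T \<in> compact_ops" shows "c *\<^sub>C T \<in> compact_ops"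
  using compact_ops_compose_left[of "c *\<^sub>C id_blinfun" T] assms
  by (simp add: blinfun_compose_scaleC_left)

lemma compact_ops_uminus: "T \<in> compact_ops \<Longrightarrow> - T \<in> compact_ops"
  using compact_ops_scaleC[of T "-1"] by (simp add: scaleC_minus_one)

lemma compact_ops_diff: "S \<in> compact_ops \<Longrightarrow> T \<in> compact_ops \<Longrightarrow> S - T \<in> compact_ops"
  using compact_ops_add[OF _ compact_ops_uminus[of T], of S] by simp

section \<open>Equality and vanishing in the Calkin algebra\<close>

lemma calkin_map_eq: "calkin_map S = calkin_map T \<longleftrightarrow> S - T \<in> compact_ops"
proof
  assume "calkin_map S = calkin_map T"
  moreover have "0 + S \<in> calkin_map S"
    unfolding calkin_map_def a_r_coset_def' by (auto simp: bounded_ops_def intro!: exI[of _ 0])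
  ultimately show "S - T \<in> compact_ops"
    by (auto simp: calkin_map_def a_r_coset_def' bounded_ops_def)
next
  assume *: "S - T \<in> compact_ops"
  have "K + S \<in> calkin_map T" if "K \<in> compact_ops" for K
    using compact_ops_add[OF that *]
    by (auto simp: calkin_map_def a_r_coset_def' bounded_ops_def intro!: bexI[of _ "K + (S - T)"])
  moreover have "K + T \<in> calkin_map S" if "K \<in> compact_ops" for K
    using compact_ops_diff[OF that *]
    by (auto simp: calkin_map_def a_r_coset_def' bounded_ops_def intro!: bexI[of _ "K - (S - T)"])
  ultimately show "calkin_map S = calkin_map T"
    by (auto simp: calkin_map_def a_r_coset_def' bounded_ops_def)
qed

lemma calkin_map_eq_zero:
  fixes T :: "'i ell2 \<Rightarrow>\<^sub>L 'i ell2"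
  shows "calkin_map T = \<zero>\<^bsub>calkin\<^esub> \<longleftrightarrow> T \<in> compact_ops"
proof -
  have "calkin_map 0 = (compact_ops :: ('i ell2 \<Rightarrow>\<^sub>L 'i ell2) set)"
    by (auto simp: calkin_map_def a_r_coset_def' bounded_ops_def)
  note this[symmetric]
  then have "\<zero>\<^bsub>calkin\<^esub> = calkin_map (0 :: 'i ell2 \<Rightarrow>\<^sub>L 'i ell2)"
    unfolding calkin_def FactRing_def by simp
  then show ?thesis
    by (simp add: calkin_map_eq)
qed

text \<open>A compact operator sends a sequence of basis vectors, along a subsequence, to a convergent
  sequence, whose limit has vanishing coordinates at infinity.\<close>

lemma compact_ops_matrix_coefficient:
  fixes T :: "'i ell2 \<Rightarrow>\<^sub>L 'i ell2" and f g :: "nat \<Rightarrow> 'i"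
  assumes "T \<in> compact_ops" "inj g" "\<And>n. coef (blinfun_apply T (ket (f n))) (g n) = z"
  shows "z = 0"
proof (rule ccontr)
  assume "z \<noteq> 0"
  obtain C where C: "compact C" "\<And>x. norm x \<le> 1 \<Longrightarrow> blinfun_apply T x \<in> C"
    using assms(1) by (auto elim: compact_opsE)
  have "\<forall>n. blinfun_apply T (ket (f n)) \<in> C"
    using C(2) by simp
  then obtain h r where "strict_mono r" "((\<lambda>n. blinfun_apply T (ket (f n))) \<circ> r) \<longlonglongrightarrow> h"
    by (rule seq_compactE[OF compact_imp_seq_compact[OF C(1)]])
  then have r: "strict_mono r" "(\<lambda>n. blinfun_apply T (ket (f (r n)))) \<longlonglongrightarrow> h"
    by (auto simp: o_def)
  \<comment> \<open>With half of \<open>cmod z\<close> the limit \<open>h\<close> keeps coordinates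
    of modulus at least \<open>e\<close> at the distinct places \<open>g (r n)\<close> for large
    \<open>n\<close>; sufficiently many of them exceed the square of \<open>norm h\<close>.\<close>
  define e where "e = cmod z / 2"
  have e: "e > 0"
    using \<open>z \<noteq> 0\<close> by (simp add: e_def)
  obtain N where N: "\<And>n. n \<ge> N \<Longrightarrow> dist (blinfun_apply T (ket (f (r n)))) h < e"
    using r(2) e unfolding lim_sequentially by blast
  have big: "e\<^sup>2 \<le> (cmod (coef h (g (r n))))\<^sup>2" if "n \<ge> N" for n
  proof -
    have "cmod (z - coef h (g (r n))) < e"
      using N[OF that] cmod_coef_le_norm[of "blinfun_apply T (ket (f (r n))) - h" "g (r n)"]
      by (simp add: assms(3) dist_norm)
    then have "e \<le> cmod (coef h (g (r n)))"
      using norm_triangle_ineq2[of z "coef h (g (r n))"] by (simp add: e_def)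
    then show ?thesis
      using e by (simp add: power_mono)
  qed
  obtain m :: nat where m: "(norm h)\<^sup>2 < of_nat m * e\<^sup>2"
    using e ex_less_of_nat_mult[of "e\<^sup>2" "(norm h)\<^sup>2"] by auto
  let ?F = "(\<lambda>n. g (r n)) ` {N..<N + m}"
  have inj: "inj_on (\<lambda>n. g (r n)) {N..<N + m}"
    by (intro inj_onI) (metis injD[OF assms(2)] strict_mono_eq[OF r(1)])
  have "of_nat m * e\<^sup>2 = (\<Sum>n\<in>{N..<N + m}. e\<^sup>2)"
    by simp
  also have "\<dots> \<le> (\<Sum>n\<in>{N..<N + m}. (cmod (coef h (g (r n))))\<^sup>2)"
    by (intro sum_mono big) auto
  also have "\<dots> = (\<Sum>k\<in>?F. (cmod (coef h k))\<^sup>2)"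
    by (simp add: sum.reindex[OF inj])
  also have "\<dots> \<le> (norm h)\<^sup>2"
    unfolding norm_ell2_sq by (rule finite_sum_le_infsum[OF coef_summable]) auto
  finally show False
    using m by simp
qed

section \<open>The universal differential algebra of a subalgebra\<close>

text \<open>Monomials are tested only at words that occur in \<open>p\<close>, so that a restriction
  on the letters of \<open>p\<close> is still available there; \<open>F_induct\<close> depends on
  this.\<close>

lemma poly_mapping_induct_single:
  fixes p :: "'k \<Rightarrow>\<^sub>0 'c::comm_monoid_add"
  assumes "P 0" "\<And>p q. P p \<Longrightarrow> P q \<Longrightarrow> P (p + q)"
    "\<And>w c. w \<in> Poly_Mapping.keys p \<Longrightarrow> P (Poly_Mapping.single w c)"
  shows "P p"
proof -
  have "P (\<Sum>w\<in>K. Poly_Mapping.single w (Poly_Mapping.lookup p w))"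
    if "K \<subseteq> Poly_Mapping.keys p" for K
    using finite_subset[OF that finite_keys] that
    by (induction K rule: finite_induct) (auto intro: assms)
  moreover have "(\<Sum>w\<in>Poly_Mapping.keys p. Poly_Mapping.single w (Poly_Mapping.lookup p w)) = p"
    by (rule poly_mapping_eqI) (simp add: lookup_sum lookup_single when_def in_keys_iff)
  ultimately show ?thesis
    by force
qed

context
  fixes g :: "'k \<Rightarrow> 'c::monoid_add \<Rightarrow> 'm::ab_group_add"
  assumes g_zero: "\<And>k. g k 0 = 0" and g_add: "\<And>k c d. g k (c + d) = g k c + g k d"
begin

text \<open>Keys that cancel in \<open>p + q\<close> do no harm because \<open>g k 0 = 0\<close>.
  The additivity of \<open>grading\<close>, \<open>free_diff\<close> and \<open>op_eval\<close>, all
  given by sums over keys, comes from here.\<close>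

lemma keys_sum_add:
  "(\<Sum>k\<in>Poly_Mapping.keys (p + q). g k (Poly_Mapping.lookup (p + q) k)) =
    (\<Sum>k\<in>Poly_Mapping.keys p. g k (Poly_Mapping.lookup p k)) +
    (\<Sum>k\<in>Poly_Mapping.keys q. g k (Poly_Mapping.lookup q k))"
  by (rule setsum_keys_plus_distrib) (auto simp: g_zero g_add)

end

lemma letters_plus [simp]: "letters (v + w) = letters v @ letters w"
  by (simp add: plus_word_def)

lemma letters_zero [simp]: "letters 0 = []"
  by (simp add: zero_word_def)

lemma Word_plus: "Word v + Word w = Word (v @ w)"
  by (simp add: plus_word_def)

lemma Word_Nil: "Word [] = 0"
  by (simp add: zero_word_def)

lemma const_one [simp]: "const 1 = 1"
  by (simp add: const_def)

lemma const_mult_single: "const c * Poly_Mapping.single w d = Poly_Mapping.single w (c * d)"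
  by (simp add: const_def mult_single)

lemma const_commute: "const c * p = p * const c" for p :: "'a free_alg"
  by (rule poly_mapping_induct_single[of "\<lambda>p. const c * p = p * const c"])
    (auto simp: distrib_left distrib_right const_def mult_single mult.commute)

lemma const_left_commute: "p * (const c * q) = const c * (p * q)" for p :: "'a free_alg"
  by (metis const_commute mult.assoc)

lemma const_uminus_one: "const (- 1) = (- 1 :: 'a free_alg)"
  by (simp add: const_def single_uminus)

section \<open>Parity and the graded Leibniz rule on the free algebra\<close>

fun is_dif :: "'a letter \<Rightarrow> bool"
  where "is_dif (Dif a) = True" | "is_dif (Elt a) = False"

definition dif_sign :: "'a letter list \<Rightarrow> complex"
  where "dif_sign w = (-1) ^ length (filter is_dif w)"

text \<open>The parity automorphism, that is, the twist in the graded Leibniz rule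
  \<open>free_diff_mult\<close>.\<close>

definition grading :: "'a free_alg \<Rightarrow> 'a free_alg"
  where "grading p = (\<Sum>w\<in>Poly_Mapping.keys p.
    Poly_Mapping.single w (dif_sign (letters w) * Poly_Mapping.lookup p w))"

lemma grading_add: "grading (p + q) = grading p + grading q"
  unfolding grading_def by (rule keys_sum_add) (auto simp: distrib_left single_add)

lemma grading_single:
  "grading (Poly_Mapping.single w c) = Poly_Mapping.single w (dif_sign (letters w) * c)"
  by (simp add: grading_def)

lemma grading_zero [simp]: "grading 0 = 0"
  by (simp add: grading_def)

lemma grading_mult: "grading (p * q) = grading p * grading q" for p q :: "'a free_alg"
proof (rule poly_mapping_induct_single[of _ p])
  fix v c
  show "grading (Poly_Mapping.single v c * q) = grading (Poly_Mapping.single v c) * grading q"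
    by (rule poly_mapping_induct_single[of _ q])
      (auto simp: distrib_left distrib_right grading_add mult_single grading_single dif_sign_def
        power_add mult_ac)
qed (auto simp: distrib_left distrib_right grading_add)

lemma grading_uminus: "grading (- p) = - grading p"
  using grading_add[of p "- p"] by (simp add: add_eq_0_iff)

lemma grading_diff: "grading (p - q) = grading p - grading q"
  using grading_add[of p "- q"] by (simp add: grading_uminus)

lemma grading_simps [simp]:
  "grading (elt a) = elt a" "grading (dif a) = - dif a" "grading (const c) = const c" "grading 1 = 1"
  by (simp_all add: elt_def dif_def const_def grading_single dif_sign_def single_uminus
      flip: single_one)

lemma free_diff_add: "free_diff (p + q) = free_diff p + free_diff q"
  unfolding free_diff_def
  by (rule keys_sum_add) (auto simp: const_def single_add distrib_right)

lemma free_diff_single: "free_diff (Poly_Mapping.single w c) = const c * word_diff (letters w)"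
  by (simp add: free_diff_def const_def)

lemma free_diff_zero [simp]: "free_diff 0 = 0"
  by (simp add: free_diff_def)

lemma free_diff_uminus: "free_diff (- p) = - free_diff p"
  using free_diff_add[of p "- p"] by (simp add: add_eq_0_iff)

lemma free_diff_diff: "free_diff (p - q) = free_diff p - free_diff q"
  using free_diff_add[of p "- q"] by (simp add: free_diff_uminus)

text \<open>Each \<open>Dif\<close> letter of \<open>v\<close> that the differential passes
  contributes one sign, together \<open>dif_sign v\<close>.\<close>

lemma word_diff_append:
  "word_diff (v @ w) = word_diff v * Poly_Mapping.single (Word w) 1 +
    const (dif_sign v) * (Poly_Mapping.single (Word v) 1 * word_diff w)"
proof (induction v rule: word_diff.induct)
  case 1
  then show ?case
    by (simp add: dif_sign_def Word_Nil)
next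
  case (2 a v)
  have "Poly_Mapping.single (Word (Elt a # v)) 1 = elt a * Poly_Mapping.single (Word v) 1"
    "Poly_Mapping.single (Word (v @ w)) 1 = Poly_Mapping.single (Word v) 1 * Poly_Mapping.single (Word w) (1::complex)"
    by (simp_all add: elt_def mult_single Word_plus)
  with 2 show ?case
    by (simp add: algebra_simps const_left_commute dif_sign_def)
next
  case (3 a v)
  have *: "Poly_Mapping.single (Word (Dif a # v)) 1 = dif a * Poly_Mapping.single (Word v) 1"
    by (simp add: dif_def mult_single Word_plus)
  have "const (dif_sign (Dif a # v)) = (- const (dif_sign v) :: 'a free_alg)"
    by (simp add: dif_sign_def const_def single_uminus)
  with 3 * show ?case
    by (simp add: algebra_simps const_left_commute)
qed

text \<open>Both sides are additive in \<open>p\<close> and in \<open>q\<close>. For monomials it is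
  \<open>word_diff_append\<close> with the central scalars pulled out.\<close>

lemma free_diff_mult:
  "free_diff (p * q) = free_diff p * q + grading p * free_diff q" for p q :: "'a free_alg"
proof (rule poly_mapping_induct_single[of _ p])
  fix v c
  show "free_diff (Poly_Mapping.single v c * q) =
    free_diff (Poly_Mapping.single v c) * q + grading (Poly_Mapping.single v c) * free_diff q"
  proof (rule poly_mapping_induct_single[of _ q])
    fix w d
    have "Poly_Mapping.single w d = const d * Poly_Mapping.single w 1" for w :: "'a word" and d
      by (simp add: const_mult_single)
    note s = this[of v "dif_sign (letters v) * c"] this[of w d]
    have c: "const (x * y) = const x * (const y :: 'a free_alg)" for x y
      by (simp add: const_def mult_single)
    have "const x * (const y * p) = const y * (const x * p)" for x y and p :: "'a free_alg"
      by (rule const_left_commute)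
    note comm = this const_left_commute[of "word_diff (letters v)" d] const_left_commute[of "Poly_Mapping.single v 1" d]
    have "free_diff (Poly_Mapping.single v c * Poly_Mapping.single w d) =
      const c * (const d * (word_diff (letters v) * Poly_Mapping.single w 1)) +
      const c * (const d * (const (dif_sign (letters v)) * (Poly_Mapping.single v 1 * word_diff (letters w))))"
      by (simp add: mult_single free_diff_single word_diff_append c distrib_left mult.assoc)
    also have "\<dots> = (const c * word_diff (letters v)) * (const d * Poly_Mapping.single w 1) +
      (const (dif_sign (letters v)) * const c * Poly_Mapping.single v 1) * (const d * word_diff (letters w))"
      by (simp only: mult.assoc comm)
    finally show "free_diff (Poly_Mapping.single v c * Poly_Mapping.single w d) =
      free_diff (Poly_Mapping.single v c) * Poly_Mapping.single w d +
      grading (Poly_Mapping.single v c) * free_diff (Poly_Mapping.single w d)"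
      unfolding free_diff_single grading_single by (simp only: s c)
  qed (auto simp: distrib_left distrib_right free_diff_add)
qed (auto simp: distrib_left distrib_right free_diff_add grading_add)

lemma free_diff_simps [simp]:
  "free_diff (elt a) = dif a" "free_diff (dif a) = 0" "free_diff (const c) = 0" "free_diff 1 = 0"
  by (simp_all add: elt_def dif_def const_def free_diff_single Word_Nil mult_single)
    (simp add: free_diff_def)

locale unital_subalgebra =
  fixes A :: "'a::cstar_algebra set"
  assumes one_mem: "1 \<in> A"
    and add_mem: "a \<in> A \<Longrightarrow> b \<in> A \<Longrightarrow> a + b \<in> A"
    and mult_mem: "a \<in> A \<Longrightarrow> b \<in> A \<Longrightarrow> a * b \<in> A"
    and scaleC_mem: "a \<in> A \<Longrightarrow> c *\<^sub>C a \<in> A"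
begin

abbreviation F :: "'a free_alg set" where "F \<equiv> carrier (free_alg A)"
abbreviation I :: "'a free_alg set" where "I \<equiv> omega_ideal A"
abbreviation cl :: "'a free_alg \<Rightarrow> 'a free_alg set" where "cl \<equiv> omega_class A"

lemma mem_F: "p \<in> F \<longleftrightarrow> (\<forall>w\<in>Poly_Mapping.keys p. set (letters w) \<subseteq> Elt ` A \<union> Dif ` A)"
  by (auto simp: free_alg_def)

lemma F_single: "set (letters w) \<subseteq> Elt ` A \<union> Dif ` A \<Longrightarrow> Poly_Mapping.single w c \<in> F"
  by (auto simp: mem_F)

lemma F_single_Word: "set w \<subseteq> Elt ` A \<union> Dif ` A \<Longrightarrow> Poly_Mapping.single (Word w) c \<in> F"
  by (simp add: F_single)

lemma F_closed [simp, intro]: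
  "0 \<in> F" "1 \<in> F" "const c \<in> F" "a \<in> A \<Longrightarrow> elt a \<in> F" "a \<in> A \<Longrightarrow> dif a \<in> F"
  by (auto simp: mem_F elt_def dif_def const_def)

lemma F_add [simp, intro]: "p \<in> F \<Longrightarrow> q \<in> F \<Longrightarrow> p + q \<in> F"
  using keys_add[of p q] unfolding mem_F by blast

lemma F_mult [simp, intro]:
  assumes "p \<in> F" "q \<in> F"
  shows "p * q \<in> F"
  unfolding mem_F
proof
  fix w assume "w \<in> Poly_Mapping.keys (p * q)"
  then obtain u v where "w = u + v" "u \<in> Poly_Mapping.keys p" "v \<in> Poly_Mapping.keys q"
    using keys_mult[of p q] by blast
  with assms show "set (letters w) \<subseteq> Elt ` A \<union> Dif ` A"
    by (simp add: mem_F)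
qed

lemma F_uminus [simp, intro]: "p \<in> F \<Longrightarrow> - p \<in> F"
  by (simp add: mem_F)

lemma F_diff [simp, intro]: "p \<in> F \<Longrightarrow> q \<in> F \<Longrightarrow> p - q \<in> F"
  using F_add[of p "- q"] by simp

lemma F_induct [consumes 1, case_names zero add single]:
  assumes "p \<in> F" "P 0" "\<And>p q. P p \<Longrightarrow> P q \<Longrightarrow> P (p + q)"
    "\<And>w c. set w \<subseteq> Elt ` A \<union> Dif ` A \<Longrightarrow> P (Poly_Mapping.single (Word w) c)"
  shows "P p"
proof (rule poly_mapping_induct_single[of P])
  fix w c assume "w \<in> Poly_Mapping.keys p"
  then show "P (Poly_Mapping.single w c)"
    using assms(1) assms(4)[of "letters w" c] by (simp add: mem_F)
qed (use assms in blast)+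

lemma free_alg_simps [simp]:
  "p \<otimes>\<^bsub>free_alg A\<^esub> q = p * q" "p \<oplus>\<^bsub>free_alg A\<^esub> q = p + q"
  "\<one>\<^bsub>free_alg A\<^esub> = 1" "\<zero>\<^bsub>free_alg A\<^esub> = 0"
  by (simp_all add: free_alg_def)

lemma ring_free_alg: "ring (free_alg A)"
proof (rule ringI)
  show "abelian_group (free_alg A)"
  proof (rule abelian_groupI)
    fix p assume "p \<in> F"
    then show "\<exists>q\<in>F. q \<oplus>\<^bsub>free_alg A\<^esub> p = \<zero>\<^bsub>free_alg A\<^esub>"
      by (intro bexI[of _ "- p"]) auto
  qed (auto simp: algebra_simps)
  show "Group.monoid (free_alg A)"
    by (rule Group.monoidI) (auto simp: algebra_simps)
qed (auto simp: algebra_simps)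

sublocale FR: ring "free_alg A"
  by (rule ring_free_alg)

lemma relations_subset: "omega_relations A \<subseteq> F"
  by (auto simp: omega_relations_def one_mem add_mem mult_mem scaleC_mem)

sublocale OI: ideal I "free_alg A"
  unfolding omega_ideal_def by (rule FR.genideal_ideal[OF relations_subset])

lemma I_closed:
  "0 \<in> I" "p \<in> I \<Longrightarrow> q \<in> I \<Longrightarrow> p + q \<in> I"
  "p \<in> I \<Longrightarrow> r \<in> F \<Longrightarrow> r * p \<in> I" "p \<in> I \<Longrightarrow> r \<in> F \<Longrightarrow> p * r \<in> I" "p \<in> I \<Longrightarrow> p \<in> F"
  using OI.zero_closed OI.a_closed OI.I_l_closed OI.I_r_closed OI.a_subset by auto

lemma I_uminus: "p \<in> I \<Longrightarrow> - p \<in> I"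
  using I_closed(3)[of p "const (- 1)"] by (simp add: const_uminus_one)

lemma I_diff: "p \<in> I \<Longrightarrow> q \<in> I \<Longrightarrow> p - q \<in> I"
  using I_closed(2)[of p "- q"] I_uminus by simp

lemma I_relations: "omega_relations A \<subseteq> I"
  unfolding omega_ideal_def by (rule FR.genideal_self[OF relations_subset])

lemma I_relation:
  "elt 1 - 1 \<in> I"
  "a \<in> A \<Longrightarrow> b \<in> A \<Longrightarrow> elt (a + b) - (elt a + elt b) \<in> I"
  "a \<in> A \<Longrightarrow> elt (c *\<^sub>C a) - const c * elt a \<in> I"
  "a \<in> A \<Longrightarrow> b \<in> A \<Longrightarrow> elt (a * b) - elt a * elt b \<in> I"
  "a \<in> A \<Longrightarrow> b \<in> A \<Longrightarrow> dif (a + b) - (dif a + dif b) \<in> I"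
  "a \<in> A \<Longrightarrow> dif (c *\<^sub>C a) - const c * dif a \<in> I"
  "a \<in> A \<Longrightarrow> b \<in> A \<Longrightarrow> dif (a * b) - (elt a * dif b + dif a * elt b) \<in> I"
  by (rule subsetD[OF I_relations], unfold omega_relations_def, blast)+

text \<open>Negation is multiplication by \<open>const (- 1)\<close>, so the closure under inverses
  that \<open>subgroup\<close> demands is a case of closure under products.\<close>

lemma I_minimal:
  assumes "omega_relations A \<subseteq> J" "J \<subseteq> F" "0 \<in> J"
    "\<And>p q. p \<in> J \<Longrightarrow> q \<in> J \<Longrightarrow> p + q \<in> J"
    "\<And>p r. p \<in> J \<Longrightarrow> r \<in> F \<Longrightarrow> r * p \<in> J" "\<And>p r. p \<in> J \<Longrightarrow> r \<in> F \<Longrightarrow> p * r \<in> J"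
  shows "I \<subseteq> J"
proof -
  have inv: "\<ominus>\<^bsub>free_alg A\<^esub> p = - p" if "p \<in> F" for p
    by (rule FR.minus_equality) (use that in simp_all)
  have "subgroup J (add_monoid (free_alg A))"
  proof (rule group.subgroupI[OF FR.a_group])
    fix p assume p: "p \<in> J"
    then have "- p \<in> J"
      using assms(5)[of p "const (- 1)"] by (simp add: const_uminus_one)
    then show "inv\<^bsub>add_monoid (free_alg A)\<^esub> p \<in> J"
      using inv[of p] p assms(2) by (auto simp: a_inv_def)
  qed (use assms in auto)
  then have "ideal J (free_alg A)"
    by (intro idealI ring_free_alg) (use assms in auto)
  then show ?thesis
    unfolding omega_ideal_def by (rule FR.genideal_minimal) (rule assms)
qed

lemma F_word_diff: "set w \<subseteq> Elt ` A \<union> Dif ` A \<Longrightarrow> word_diff w \<in> F"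
  by (induction w rule: word_diff.induct) (auto intro!: F_add F_mult F_uminus F_single)

lemma F_free_diff [simp, intro]: "p \<in> F \<Longrightarrow> free_diff p \<in> F"
  by (induction p rule: F_induct) (auto simp: free_diff_add free_diff_single F_word_diff)

lemma F_grading [simp, intro]: "p \<in> F \<Longrightarrow> grading p \<in> F"
  by (induction p rule: F_induct) (auto simp: grading_add grading_single F_single_Word)

text \<open>Membership, differential and parity are carried together because the Leibniz rule for
  \<open>r * p\<close> and \<open>p * r\<close> involves all of \<open>p\<close>,
  \<open>free_diff p\<close> and \<open>grading p\<close>. This is what makes
  \<open>omega_diff\<close> well defined.\<close>

lemma I_free_diff_grading: "I \<subseteq> {p \<in> I. free_diff p \<in> I \<and> grading p \<in> I}"
proof (rule I_minimal)
  \<comment> \<open>The relation \<open>elt 1 - 1\<close> has differential \<open>dif 1\<close>.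
    That this lies in the ideal follows from the Leibniz relation for the product of 1 with itself
    and the unit relation.\<close>
  have "dif (1 * 1) - (elt 1 * dif 1 + dif 1 * elt 1) \<in> I" "(elt 1 - 1) * dif 1 \<in> I" "dif 1 * (elt 1 - 1) \<in> I"
    by (rule I_relation(7)[OF one_mem one_mem], rule I_closed(4)[OF I_relation(1) F_closed(5)[OF one_mem]],
        rule I_closed(3)[OF I_relation(1) F_closed(5)[OF one_mem]])
  then have "- ((dif (1 * 1) - (elt 1 * dif 1 + dif 1 * elt 1)) + (elt 1 - 1) * dif 1 + dif 1 * (elt 1 - 1)) \<in> I"
    by (intro I_uminus I_closed(2))
  then have dif_one: "dif 1 \<in> I"
    by (simp add: algebra_simps)
  have swap: "dif (a * b) - (dif a * elt b + elt a * dif b) \<in> I" if "a \<in> A" "b \<in> A" for a b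
    using I_relation(7)[OF that] by (simp add: add.commute)
  show "omega_relations A \<subseteq> {p \<in> I. free_diff p \<in> I \<and> grading p \<in> I}"
  proof
    fix r assume r: "r \<in> omega_relations A"
    then have rI: "r \<in> I"
      using I_relations by blast
    consider "r = elt 1 - 1"
      | a b where "a \<in> A" "b \<in> A" "r = elt (a + b) - (elt a + elt b)"
      | a c where "a \<in> A" "r = elt (c *\<^sub>C a) - const c * elt a"
      | a b where "a \<in> A" "b \<in> A" "r = elt (a * b) - elt a * elt b"
      | a b where "a \<in> A" "b \<in> A" "r = dif (a + b) - (dif a + dif b)"
      | a c where "a \<in> A" "r = dif (c *\<^sub>C a) - const c * dif a"
      | a b where "a \<in> A" "b \<in> A" "r = dif (a * b) - (elt a * dif b + dif a * elt b)"
      using r unfolding omega_relations_def by blast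
    \<comment> \<open>Every relation is homogeneous of degree 0 or 1, so parity at most changes its
      sign.\<close>
    then have "free_diff r \<in> I \<and> (grading r = r \<or> grading r = - r)"
      by cases (simp_all add: free_diff_add free_diff_diff free_diff_mult grading_add grading_diff
          grading_mult dif_one I_relation swap I_closed(1))
    then show "r \<in> {p \<in> I. free_diff p \<in> I \<and> grading p \<in> I}"
      using rI by (auto simp: I_uminus)
  qed
qed (auto simp: free_diff_add grading_add free_diff_mult grading_mult I_closed)

lemma I_free_diff: "p \<in> I \<Longrightarrow> free_diff p \<in> I"
  and I_grading: "p \<in> I \<Longrightarrow> grading p \<in> I"
  using I_free_diff_grading by auto

lemma cl_conv: "cl p = (\<lambda>i. i + p) ` I"
  by (auto simp: omega_class_def a_r_coset_def')

lemma cl_eq_iff: "cl p = cl q \<longleftrightarrow> p - q \<in> I"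
proof
  assume "cl p = cl q"
  moreover have "0 + p \<in> cl p"
    unfolding cl_conv using I_closed(1) by blast
  ultimately show "p - q \<in> I"
    by (auto simp: cl_conv)
next
  assume *: "p - q \<in> I"
  have "i + p \<in> cl q" if "i \<in> I" for i
    using I_closed(2)[OF that *] by (auto simp: cl_conv image_iff intro!: bexI[of _ "i + (p - q)"])
  moreover have "i + q \<in> cl p" if "i \<in> I" for i
    using I_diff[OF that *] by (auto simp: cl_conv image_iff intro!: bexI[of _ "i - (p - q)"])
  ultimately show "cl p = cl q"
    by (auto simp: cl_conv)
qed

lemma cl_self: "p \<in> cl p"
  using I_closed(1) by (force simp: cl_conv)

text \<open>Both \<open>omega_diff\<close> and \<open>psi\<close> take \<open>the_elem\<close> of
  the image of a coset; a map invariant under adding elements of \<open>I\<close> has a singleton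
  image there.\<close>

lemma the_elem_cl:
  assumes "\<And>i. i \<in> I \<Longrightarrow> f (i + p) = f p"
  shows "the_elem (f ` cl p) = f p"
proof -
  have "f ` cl p = {f p}"
    using assms cl_self[of p] by (auto simp: cl_conv image_iff)
  then show ?thesis
    by simp
qed

lemma omega_add: "p \<in> F \<Longrightarrow> q \<in> F \<Longrightarrow> cl p \<oplus>\<^bsub>omega A\<^esub> cl q = cl (p + q)"
  using OI.a_rcos_sum[of p q] by (simp add: omega_def FactRing_def omega_class_def)

lemma omega_mult: "p \<in> F \<Longrightarrow> q \<in> F \<Longrightarrow> cl p \<otimes>\<^bsub>omega A\<^esub> cl q = cl (p * q)"
  using OI.rcoset_mult_add[of p q] by (simp add: omega_def FactRing_def omega_class_def)

lemma cl_zero: "cl 0 = I"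
  by (simp add: cl_conv)

lemma omega_zero: "\<zero>\<^bsub>omega A\<^esub> = cl 0"
  unfolding cl_zero by (simp add: omega_def FactRing_def)

lemma omega_one: "\<one>\<^bsub>omega A\<^esub> = cl 1"
  by (simp add: omega_def FactRing_def omega_class_def)

lemma omega_carrier: "carrier (omega A) = cl ` F"
  by (auto simp: omega_def FactRing_def omega_class_def A_RCOSETS_def')

lemma omega_diff: "omega_diff A (cl p) = cl (free_diff p)"
  unfolding omega_diff_def
  by (rule the_elem_cl) (simp add: cl_eq_iff free_diff_add I_free_diff)

lemma ring_omega: "ring (omega A)"
  unfolding omega_def by (rule OI.quotient_is_ring)

sublocale OR: ring "omega A"
  by (rule ring_omega)

lemma omega_minus: "p \<in> F \<Longrightarrow> \<ominus>\<^bsub>omega A\<^esub> cl p = cl (- p)"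
  by (rule OR.minus_equality) (auto simp: omega_carrier omega_add omega_zero)

section \<open>Forms of degree n through their representatives\<close>

definition difs :: "'a list \<Rightarrow> 'a free_alg"
  where "difs as = foldr (\<lambda>a p. dif a * p) as 1"

lemma difs_simps [simp]: "difs [] = 1" "difs (a # as) = dif a * difs as"
  by (simp_all add: difs_def)

lemma F_difs [simp, intro]: "set as \<subseteq> A \<Longrightarrow> difs as \<in> F"
  by (induction as) auto

lemma omega_form: "a \<in> A \<Longrightarrow> set as \<subseteq> A \<Longrightarrow> omega_form A a as = cl (elt a * difs as)"
proof -
  have "foldr (\<lambda>a \<omega>. omega_diff A (omega_incl A a) \<otimes>\<^bsub>omega A\<^esub> \<omega>) as \<one>\<^bsub>omega A\<^esub> = cl (difs as)"
    if "set as \<subseteq> A" for as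
    using that by (induction as) (auto simp: omega_one omega_incl_def omega_diff omega_mult)
  then show "a \<in> A \<Longrightarrow> set as \<subseteq> A \<Longrightarrow> omega_form A a as = cl (elt a * difs as)"
    by (simp add: omega_form_def omega_incl_def omega_mult)
qed

text \<open>All representatives of forms of degree \<open>n\<close> in the free algebra. Arguments
  about degree can then use ordinary sums and products in place of operations on cosets.\<close>

definition H :: "nat \<Rightarrow> 'a free_alg set"
  where "H n = {p \<in> F. cl p \<in> omega_n A n}"

lemma forms_subset:
  "{omega_form A a\<^sub>0 as |a\<^sub>0 as. a\<^sub>0 \<in> A \<and> set as \<subseteq> A \<and> length as = n} \<subseteq> carrier (add_monoid (omega A))"
  by (auto simp: omega_form omega_carrier)

lemma omega_n_subset: "omega_n A n \<subseteq> carrier (omega A)"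
  unfolding omega_n_def using group.generate_incl[OF OR.a_group forms_subset] by simp

lemma omega_n_conv: "omega_n A n = cl ` H n"
  using omega_n_subset[of n] by (auto simp: H_def omega_carrier)

lemma H_F: "p \<in> H n \<Longrightarrow> p \<in> F"
  by (simp add: H_def)

lemma H_cong: "p \<in> H n \<Longrightarrow> q - p \<in> I \<Longrightarrow> q \<in> H n"
  using F_add[of "q - p" p] I_closed(5)[of "q - p"] cl_eq_iff[of q p] by (auto simp: H_def)

lemma H_form: "a \<in> A \<Longrightarrow> set as \<subseteq> A \<Longrightarrow> elt a * difs as \<in> H (length as)"
  unfolding H_def omega_n_def by (auto simp flip: omega_form intro!: generate.incl)

lemma H_zero: "0 \<in> H n"
  using generate.one[of "add_monoid (omega A)"] by (simp add: H_def omega_n_def omega_zero)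

lemma H_add: "p \<in> H n \<Longrightarrow> q \<in> H n \<Longrightarrow> p + q \<in> H n"
  using generate.eng[of "cl p" "add_monoid (omega A)" _ "cl q"]
  by (simp add: H_def omega_n_def omega_add)

text \<open>Induction over \<open>generate\<close> only yields some representative with the
  property; the case \<open>cong\<close> carries it to the given one, and \<open>uminus\<close>
  accounts for the inverses in \<open>generate\<close>.\<close>

lemma H_induct [consumes 1, case_names zero add uminus form cong]:
  assumes "p \<in> H n"
    and zero: "P 0" and add: "\<And>p q. p \<in> H n \<Longrightarrow> q \<in> H n \<Longrightarrow> P p \<Longrightarrow> P q \<Longrightarrow> P (p + q)"
    and uminus: "\<And>p. p \<in> F \<Longrightarrow> P p \<Longrightarrow> P (- p)"
    and form: "\<And>a as. a \<in> A \<Longrightarrow> set as \<subseteq> A \<Longrightarrow> length as = n \<Longrightarrow> P (elt a * difs as)"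
    and cong: "\<And>p q. p \<in> F \<Longrightarrow> q \<in> F \<Longrightarrow> P p \<Longrightarrow> q - p \<in> I \<Longrightarrow> P q"
  shows "P p"
proof -
  have "\<exists>p\<in>F. X = cl p \<and> P p" if "X \<in> omega_n A n" for X
    using that unfolding omega_n_def
  proof (induction X rule: generate.induct)
    case one
    then show ?case
      using zero by (auto simp: omega_zero)
  next
    case (incl X)
    then show ?case
      using form by (auto simp: omega_form)
  next
    case (inv X)
    then obtain a as where X: "X = cl (elt a * difs as)" "a \<in> A" "set as \<subseteq> A" "length as = n"
      by (auto simp: omega_form)
    have "inv\<^bsub>add_monoid (omega A)\<^esub> X = cl (- (elt a * difs as))"
      using X omega_minus[of "elt a * difs as"] by (simp add: a_inv_def)
    moreover have "P (- (elt a * difs as))"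
      using X by (intro uminus form) auto
    ultimately show ?case
      using X by (intro bexI[of _ "- (elt a * difs as)"]) auto
  next
    case (eng X Y)
    then obtain p q where pq: "p \<in> F" "q \<in> F" "X = cl p" "Y = cl q" "P p" "P q"
      by blast
    with eng have "p \<in> H n" "q \<in> H n"
      by (auto simp: H_def omega_n_def)
    with pq show ?case
      using add[of p q] by (auto simp: omega_add)
  qed
  then obtain q where "q \<in> F" "cl p = cl q" "P q"
    using assms(1) by (auto simp: H_def)
  then show ?thesis
    using cong[of q p] assms(1) by (auto simp: H_def cl_eq_iff)
qed

lemma H_uminus:
  assumes "p \<in> H n" shows "- p \<in> H n"
proof -
  have "inv\<^bsub>add_monoid (omega A)\<^esub> cl p \<in> omega_n A n"
    using assms group.generate_m_inv_closed[OF OR.a_group forms_subset]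
    unfolding H_def omega_n_def by simp
  then have "\<ominus>\<^bsub>omega A\<^esub> cl p \<in> omega_n A n"
    by (simp add: a_inv_def)
  then show ?thesis
    using assms by (simp add: H_def omega_minus)
qed

lemma H_diff: "p \<in> H n \<Longrightarrow> q \<in> H n \<Longrightarrow> p - q \<in> H n"
  using H_add[of p n "- q"] H_uminus[of q n] by simp

text \<open>An additive map preserving \<open>I\<close> acts on classes, so its values need checking
  only on generating forms. The closure of \<open>H\<close> under products and the differential is
  obtained this way.\<close>

lemma H_map:
  assumes "p \<in> H n" and add: "\<And>p q. f (p + q) = f p + f q" and I: "\<And>i. i \<in> I \<Longrightarrow> f i \<in> I"
    and form: "\<And>a as. a \<in> A \<Longrightarrow> set as \<subseteq> A \<Longrightarrow> length as = n \<Longrightarrow> f (elt a * difs as) \<in> H m"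
  shows "f p \<in> H m"
proof -
  have zero: "f 0 = 0"
    using add[of 0 0] by simp
  have uminus: "f (- p) = - f p" for p
    using add[of p "- p"] by (simp add: zero add_eq_0_iff)
  have diff: "f (p - q) = f p - f q" for p q
    using add[of p "- q"] by (simp add: uminus)
  show ?thesis
    using assms(1)
  proof (induction p rule: H_induct)
    case (cong p q)
    then show ?case
      using H_cong[of "f p" m "f q"] I[of "q - p"] by (simp add: diff)
  qed (simp_all add: zero add uminus H_zero H_add H_uminus form)
qed

lemma H_elt: "a \<in> A \<Longrightarrow> p \<in> H n \<Longrightarrow> elt a * p \<in> H n"
proof (rule H_map[of p n "\<lambda>p. elt a * p"])
  fix b as assume *: "a \<in> A" "b \<in> A" "set as \<subseteq> A" "length as = n"
  have "- (elt (a * b) - elt a * elt b) * difs as \<in> I"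
    using * by (intro I_closed(4) I_uminus I_relation F_difs)
  then show "elt a * (elt b * difs as) \<in> H n"
    using * by (intro H_cong[OF H_form[of "a * b" as, unfolded *(4)]]) (simp_all add: algebra_simps mult_mem)
qed (auto simp: distrib_left I_closed(3))

lemma H_one_difs: "set as \<subseteq> A \<Longrightarrow> difs as \<in> H (length as)"
proof -
  assume *: "set as \<subseteq> A"
  have "- (elt 1 - 1) * difs as \<in> I"
    using * by (intro I_closed(4) I_uminus I_relation F_difs)
  then show ?thesis
    using * by (intro H_cong[OF H_form[of 1 as]]) (simp_all add: algebra_simps one_mem)
qed

text \<open>The Leibniz rule (\<delta>a) b = \<delta>(a b) - a \<delta>b removes the inner
  coefficient \<open>b\<close>, and both resulting terms are again forms.\<close>

lemma H_dif: "a \<in> A \<Longrightarrow> p \<in> H n \<Longrightarrow> dif a * p \<in> H (Suc n)"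
proof (rule H_map[of p n "\<lambda>p. dif a * p"])
  fix b as assume *: "a \<in> A" "b \<in> A" "set as \<subseteq> A" "length as = n"
  have "- (dif (a * b) - (elt a * dif b + dif a * elt b)) * difs as \<in> I"
    using * by (intro I_closed(4) I_uminus I_relation F_difs)
  moreover have "difs ((a * b) # as) - elt a * difs (b # as) \<in> H (Suc n)"
    using * H_one_difs[of "a * b # as"] H_form[of a "b # as"] by (intro H_diff) (simp_all add: mult_mem)
  ultimately show "dif a * (elt b * difs as) \<in> H (Suc n)"
    by (elim H_cong) (simp add: algebra_simps)
qed (auto simp: distrib_left I_closed(3))

lemma H_mult: "p \<in> H m \<Longrightarrow> q \<in> H n \<Longrightarrow> p * q \<in> H (m + n)"
proof (rule H_map[of p m "\<lambda>p. p * q"])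
  fix a as assume *: "q \<in> H n" "a \<in> A" "set as \<subseteq> A" "length as = m"
  have "difs as * q \<in> H (length as + n)"
    using *(1,3) by (induction as) (auto simp: mult.assoc intro: H_dif)
  then show "elt a * difs as * q \<in> H (m + n)"
    using * by (simp add: mult.assoc H_elt)
qed (auto simp: distrib_right I_closed(4) H_F)

lemma H_free_diff: "p \<in> H n \<Longrightarrow> free_diff p \<in> H (Suc n)"
proof (rule H_map[of p n free_diff])
  fix a as assume *: "a \<in> A" "set as \<subseteq> A" "length as = n"
  have "free_diff (difs as) = 0" for as
    by (induction as) (simp_all add: free_diff_mult)
  then show "free_diff (elt a * difs as) \<in> H (Suc n)"
    using * by (simp add: free_diff_mult H_dif H_one_difs flip: *(3))
qed (auto simp: free_diff_add I_free_diff)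

lemma H_elt_0: "a \<in> A \<Longrightarrow> elt a \<in> H 0"
  using H_form[of a "[]"] by simp

lemma H_dif_1: "a \<in> A \<Longrightarrow> dif a \<in> H 1"
  using H_one_difs[of "[a]"] by simp

lemma H_0: "p \<in> H 0 \<Longrightarrow> \<exists>a\<in>A. p - elt a \<in> I"
proof (induction p rule: H_induct)
  case zero
  have "0 - elt 0 \<in> I"
    using I_uminus[OF I_relation(3)[OF one_mem, of 0]] by (simp add: const_def)
  moreover have "0 \<in> A"
    using scaleC_mem[OF one_mem, of 0] by simp
  ultimately show ?case
    by blast
next
  case (add p q)
  then obtain a b where ab: "a \<in> A" "b \<in> A" "p - elt a \<in> I" "q - elt b \<in> I"
    by blast
  then have "(p - elt a) + (q - elt b) - (elt (a + b) - (elt a + elt b)) \<in> I"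
    by (intro I_diff[OF I_closed(2)] I_relation)
  then have "p + q - elt (a + b) \<in> I"
    by (simp add: algebra_simps)
  then show ?case
    using ab add_mem by blast
next
  case (uminus p)
  then obtain a where a: "a \<in> A" "p - elt a \<in> I"
    by blast
  then have "- (p - elt a) - (elt ((- 1) *\<^sub>C a) - const (- 1) * elt a) \<in> I"
    by (intro I_diff[OF I_uminus] I_relation)
  then have "- p - elt ((- 1) *\<^sub>C a) \<in> I"
    by (simp add: algebra_simps const_uminus_one)
  then show ?case
    using a scaleC_mem by blast
next
  case (form a as)
  then show ?case
    using I_closed(1) by (auto intro!: bexI[of _ a])
next
  case (cong p q)
  then obtain a where "a \<in> A" "p - elt a \<in> I"
    by blast
  with I_closed(2)[of "q - p" "p - elt a"] cong show ?case
    by auto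
qed

text \<open>Meant for right multiplication: the rule for \<delta>(e a) contains
  \<open>grading e\<close>, which this lemma replaces by \<open>- e\<close>.\<close>

lemma H_1_grading: "p \<in> H 1 \<Longrightarrow> grading p + p \<in> I"
proof (induction p rule: H_induct)
  case (add p q)
  then show ?case
    using I_closed(2)[of "grading p + p" "grading q + q"] by (simp add: grading_add algebra_simps)
next
  case (uminus p)
  then show ?case
    using I_uminus[of "grading p + p"] by (simp add: grading_uminus)
next
  case (form a as)
  then show ?case
    using I_closed(1) by (auto simp: length_Suc_conv grading_mult)
next
  case (cong p q)
  have "(grading p + p) + (grading (q - p) + (q - p)) \<in> I"
    using cong I_closed(2)[OF _ I_closed(2)[OF I_grading[of "q - p"]]] by blast
  then show ?case
    by (simp add: grading_diff)
qed (simp add: I_closed(1))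

end

section \<open>Weighted composition operators\<close>

text \<open>One construction for the sign operator, the translations along \<int> and the compact
  corrections in the commutators. It is meaningful for bounded \<open>m\<close> and injective
  \<open>t\<close>; its norm is then at most the bound on \<open>m\<close>.\<close>

definition wcomp :: "('i \<Rightarrow> complex) \<Rightarrow> ('i \<Rightarrow> 'i) \<Rightarrow> 'i ell2 \<Rightarrow>\<^sub>L 'i ell2"
  where "wcomp m t = Blinfun (\<lambda>f. Abs_ell2 (\<lambda>k. m k * coef f (t k)))"

context
  fixes m :: "'i \<Rightarrow> complex" and t :: "'i \<Rightarrow> 'i" and M :: real
  assumes t: "inj t" and m: "\<And>k. cmod (m k) \<le> M"
begin

lemma wcomp_sq_le: "(cmod (m k * coef f (t k)))\<^sup>2 \<le> M\<^sup>2 * (cmod (coef f (t k)))\<^sup>2"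
  by (simp add: norm_mult power_mult_distrib mult_right_mono power_mono m)

lemma wcomp_bound_summable: "(\<lambda>k. M\<^sup>2 * (cmod (coef f (t k)))\<^sup>2) summable_on UNIV"
proof (rule summable_on_cmult_right)
  have "(\<lambda>k. (cmod (coef f k))\<^sup>2) summable_on range t"
    by (rule summable_on_subset_banach[OF coef_summable]) simp
  then show "(\<lambda>k. (cmod (coef f (t k)))\<^sup>2) summable_on UNIV"
    using summable_on_reindex[OF t, of "\<lambda>k. (cmod (coef f k))\<^sup>2"] by (simp add: o_def)
qed

lemma wcomp_summable: "(\<lambda>k. (cmod (m k * coef f (t k)))\<^sup>2) summable_on UNIV"
  by (rule summable_on_comparison_test[OF wcomp_bound_summable wcomp_sq_le]) simp

lemma coef_wcomp: "coef (blinfun_apply (wcomp m t) f) k = m k * coef f (t k)"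
proof -
  define G where "G f = Abs_ell2 (\<lambda>k. m k * coef f (t k))" for f
  have g: "coef (G f) k = m k * coef f (t k)" for f k
    by (simp add: G_def Abs_ell2_inverse wcomp_summable)
  have "bounded_linear G"
  proof (rule bounded_linear_intro[where K = M])
    fix f :: "'i ell2"
    have "(norm (G f))\<^sup>2 \<le> (\<Sum>\<^sub>\<infinity>k. M\<^sup>2 * (cmod (coef f (t k)))\<^sup>2)"
      unfolding norm_ell2_sq g by (rule infsum_mono[OF wcomp_summable wcomp_bound_summable wcomp_sq_le])
    also have "\<dots> = M\<^sup>2 * (\<Sum>\<^sub>\<infinity>k. (cmod (coef f (t k)))\<^sup>2)"
      by (rule infsum_cmult_right')
    also have "(\<Sum>\<^sub>\<infinity>k. (cmod (coef f (t k)))\<^sup>2) = (\<Sum>\<^sub>\<infinity>k\<in>range t. (cmod (coef f k))\<^sup>2)"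
      by (simp add: infsum_reindex[OF t] o_def)
    also have "M\<^sup>2 * \<dots> \<le> M\<^sup>2 * (norm f)\<^sup>2"
      unfolding norm_ell2_sq
      by (intro mult_left_mono infsum_mono_neutral summable_on_subset_banach[OF coef_summable]) auto
    finally have "(norm (G f))\<^sup>2 \<le> (norm f * M)\<^sup>2"
      by (simp add: power_mult_distrib mult.commute)
    moreover have "0 \<le> M"
      using m[of undefined] norm_ge_zero order_trans by blast
    ultimately show "norm (G f) \<le> norm f * M"
      using power2_le_imp_le[of "norm (G f)" "norm f * M"] by simp
  next
    show "G (f + h) = G f + G h" for f h
      by (rule ell2_eqI) (simp only: g coef_plus distrib_left)
    show "G (r *\<^sub>R f) = r *\<^sub>R G f" for r f
      by (rule ell2_eqI) (simp only: g coef_scaleR mult.left_commute)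
  qed
  then show ?thesis
    by (simp add: wcomp_def bounded_linear_Blinfun_apply g flip: G_def)
qed

lemma complex_linear_wcomp: "complex_linear (wcomp m t)"
  by (auto simp: complex_linear_def coef_wcomp intro!: ell2_eqI)

end

section \<open>The Dirac operator on finitely supported vectors\<close>

lemma ket_core [simp]: "ket k \<in> dirac_core"
  by (simp add: dirac_core_def)

lemma core_add [simp]:
  assumes "f \<in> dirac_core" "g \<in> dirac_core" shows "f + g \<in> dirac_core"
proof -
  have "{k. coef (f + g) k \<noteq> 0} \<subseteq> {k. coef f k \<noteq> 0} \<union> {k. coef g k \<noteq> 0}"
    by auto
  then show ?thesis
    using assms finite_subset by (fastforce simp: dirac_core_def)
qed

lemma core_scaleC [simp]:
  assumes "f \<in> dirac_core" shows "c *\<^sub>C f \<in> dirac_core"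
  using assms unfolding dirac_core_def
  by (auto intro: finite_subset[of "{k. c * coef f k \<noteq> 0}" "{k. coef f k \<noteq> 0}"])

lemma coef_dirac:
  assumes "f \<in> dirac_core"
  shows "coef (dirac f) k = complex_of_real (dirac_ev k) * coef f k"
proof -
  have "(\<lambda>k. (cmod (complex_of_real (dirac_ev k) * coef f k))\<^sup>2) summable_on UNIV \<longleftrightarrow>
    (\<lambda>k. (cmod (complex_of_real (dirac_ev k) * coef f k))\<^sup>2) summable_on {k. coef f k \<noteq> 0}"
    by (rule summable_on_cong_neutral) auto
  then show ?thesis
    using assms by (simp add: dirac_def Abs_ell2_inverse dirac_core_def)
qed

lemma dirac_add: "f \<in> dirac_core \<Longrightarrow> g \<in> dirac_core \<Longrightarrow> dirac (f + g) = dirac f + dirac g"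
  by (rule ell2_eqI) (simp add: coef_dirac distrib_left)

lemma dirac_scaleC: "f \<in> dirac_core \<Longrightarrow> dirac (c *\<^sub>C f) = c *\<^sub>C dirac f"
  by (rule ell2_eqI) (simp add: coef_dirac mult_ac)

text \<open>Invariance of \<open>dirac_core\<close> is built in because the product rule evaluates
  the commutator of the outer operator at \<open>T' f\<close>, which must again lie in the
  core.\<close>

definition has_commutator :: "hilb \<Rightarrow>\<^sub>L hilb \<Rightarrow> hilb \<Rightarrow>\<^sub>L hilb \<Rightarrow> bool"
  where "has_commutator T C \<longleftrightarrow> complex_linear T \<and> (\<forall>f\<in>dirac_core. blinfun_apply T f \<in> dirac_core) \<and>
    complex_linear C \<and>
    (\<forall>f\<in>dirac_core. blinfun_apply C f = dirac (blinfun_apply T f) - blinfun_apply T (dirac f))"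

lemma dirac_commutator_eq:
  assumes "has_commutator T C" shows "dirac_commutator T = C"
  unfolding dirac_commutator_def
proof (rule the_equality)
  fix C' assume "complex_linear C' \<and> (\<forall>f\<in>dirac_core. blinfun_apply C' f =
    dirac (blinfun_apply T f) - blinfun_apply T (dirac f))"
  with assms show "C' = C"
    by (intro bounded_linear_eqI_ket) (auto simp: has_commutator_def)
qed (use assms in \<open>simp add: has_commutator_def\<close>)

lemma has_commutator_add:
  "has_commutator T C \<Longrightarrow> has_commutator T' C' \<Longrightarrow> has_commutator (T + T') (C + C')"
  by (simp add: has_commutator_def blinfun.bilinear_simps dirac_add)

lemma has_commutator_scaleC:
  "has_commutator T C \<Longrightarrow> has_commutator (c *\<^sub>C T) (c *\<^sub>C C)"
  by (simp add: has_commutator_def dirac_scaleC scaleC_diff_right)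

lemma has_commutator_compose:
  "has_commutator T C \<Longrightarrow> has_commutator T' C' \<Longrightarrow>
    has_commutator (T o\<^sub>L T') ((T o\<^sub>L C') + (C o\<^sub>L T'))"
  by (simp add: has_commutator_def blinfun.bilinear_simps)

text \<open>Since \<open>D\<close> is diagonal, the commutator multiplies each matrix entry by a
  difference of eigenvalues. Injectivity is asked only where the weight is nonzero: for
  \<open>star \<alpha>\<close> the natural predecessor sends both 0 and 1 to 0, but the weight at 0
  vanishes.\<close>

lemma has_commutator_wshift:
  assumes "complex_linear T" "complex_linear C" "inj_on t {k. m k \<noteq> 0}"
    and T: "\<And>f k. coef (blinfun_apply T f) k = m k * coef f (t k)"
    and C: "\<And>f k. coef (blinfun_apply C f) k = of_real (dirac_ev k - dirac_ev (t k)) * (m k * coef f (t k))"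
  shows "has_commutator T C"
proof -
  have T_core: "blinfun_apply T f \<in> dirac_core" if "f \<in> dirac_core" for f
  proof -
    have "{k. coef (blinfun_apply T f) k \<noteq> 0} \<subseteq> t -` {k. coef f k \<noteq> 0} \<inter> {k. m k \<noteq> 0}"
      by (auto simp: T)
    moreover have "finite (t -` {k. coef f k \<noteq> 0} \<inter> {k. m k \<noteq> 0})"
      using that assms(3) by (intro finite_vimage_IntI) (auto simp: dirac_core_def)
    ultimately show ?thesis
      unfolding dirac_core_def using finite_subset by blast
  qed
  show ?thesis
    using assms T_core
    by (auto simp: has_commutator_def coef_dirac algebra_simps intro!: ell2_eqI)
qed

section \<open>The representation of quantum SU(2)\<close>

definition sgn_op :: "hilb \<Rightarrow>\<^sub>L hilb"
  where "sgn_op = wcomp (\<lambda>(i, j). if j \<ge> 0 then 1 else - 1) id"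

lemma coef_sgn_op: "coef (blinfun_apply sgn_op f) (i, j) = (if j \<ge> 0 then 1 else - 1) * coef f (i, j)"
  unfolding sgn_op_def by (subst coef_wcomp[where M = 1]) auto

lemma complex_linear_sgn_op [simp]: "complex_linear sgn_op"
  unfolding sgn_op_def by (rule complex_linear_wcomp[where M = 1]) auto

lemma sgn_op_square: "sgn_op o\<^sub>L (sgn_op o\<^sub>L T) = T"
  by (rule blinfun_eqI, rule ell2_eqI) (auto simp: coef_sgn_op split_paired_all)

locale suq2 =
  fixes q :: real and \<alpha> \<beta> :: "'a::cstar_algebra" and \<pi> :: "'a \<Rightarrow> hilb \<Rightarrow>\<^sub>L hilb"
  assumes q: "0 < q" "q < 1"
    and relations: "suq2_relations (*) 1 q \<alpha> (star \<alpha>) \<beta> (star \<beta>)"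
    and rep: "suq2_rep q \<alpha> \<beta> \<pi>" and inj: "inj \<pi>"
begin

lemma star_scaleR: "star (r *\<^sub>R x) = r *\<^sub>R star (x :: 'a)"
  by (metis complex_cnj_complex_of_real scaleC_of_real star_scaleC)

lemma rel:
  "star \<alpha> * \<alpha> + star \<beta> * \<beta> = 1"
  "\<alpha> * star \<alpha> + q\<^sup>2 *\<^sub>R (\<beta> * star \<beta>) = 1"
  "\<alpha> * \<beta> = q *\<^sub>R (\<beta> * \<alpha>)"
  "\<alpha> * star \<beta> = q *\<^sub>R (star \<beta> * \<alpha>)"
  "star \<beta> * \<beta> = \<beta> * star \<beta>"
  using relations unfolding suq2_relations_def by blast+

lemma rel_star:
  "star \<beta> * star \<alpha> = q *\<^sub>R (star \<alpha> * star \<beta>)"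
  "\<beta> * star \<alpha> = q *\<^sub>R (star \<alpha> * \<beta>)"
  using arg_cong[OF rel(3), of star] arg_cong[OF rel(4), of star]
  by (simp_all add: star_mult star_star star_scaleR)

definition A :: "'a set" where "A = star_alg_gen {\<alpha>, \<beta>}"

lemma A_gens [simp]: "\<alpha> \<in> A" "\<beta> \<in> A" "star \<alpha> \<in> A" "star \<beta> \<in> A"
  by (auto simp: A_def intro: star_alg_gen.intros)

lemma A_add [simp]: "x \<in> A \<Longrightarrow> y \<in> A \<Longrightarrow> x + y \<in> A"
  and A_mult [simp]: "x \<in> A \<Longrightarrow> y \<in> A \<Longrightarrow> x * y \<in> A"
  and A_scaleC [simp]: "x \<in> A \<Longrightarrow> c *\<^sub>C x \<in> A"
  by (auto simp: A_def intro: star_alg_gen.intros)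

lemma A_scaleR [simp]: "x \<in> A \<Longrightarrow> r *\<^sub>R x \<in> A"
  using A_scaleC[of x "of_real r"] by (simp add: scaleC_of_real)

lemma A_uminus [simp]: "x \<in> A \<Longrightarrow> - x \<in> A"
  using A_scaleC[of x "- 1"] by (simp add: scaleC_minus_one)

lemma A_diff [simp]: "x \<in> A \<Longrightarrow> y \<in> A \<Longrightarrow> x - y \<in> A"
  using A_add[of x "- y"] by simp

lemma A_one [simp]: "1 \<in> A"
  using rel(1) by (metis A_add A_gens A_mult)

lemma A_zero [simp]: "0 \<in> A"
  using A_diff[of 1 1] by simp

text \<open>Because \<open>star\<close> reverses products and preserves sums, proving
  \<open>P x\<close> and \<open>P (star x)\<close> together removes the involution from the
  induction, at the cost of two more generators.\<close>

lemma A_induct [consumes 1, case_names alpha star_alpha beta star_beta add mult scaleC]: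
  assumes "x \<in> A" "P \<alpha>" "P (star \<alpha>)" "P \<beta>" "P (star \<beta>)"
    "\<And>x y. x \<in> A \<Longrightarrow> y \<in> A \<Longrightarrow> P x \<Longrightarrow> P y \<Longrightarrow> P (x + y)"
    "\<And>x y. x \<in> A \<Longrightarrow> y \<in> A \<Longrightarrow> P x \<Longrightarrow> P y \<Longrightarrow> P (x * y)"
    "\<And>x c. x \<in> A \<Longrightarrow> P x \<Longrightarrow> P (c *\<^sub>C x)"
  shows "P x"
proof -
  have "P x \<and> P (star x) \<and> x \<in> A \<and> star x \<in> A"
    using assms(1) unfolding A_def
    by (induction x rule: star_alg_gen.induct)
      (auto simp: star_add star_mult star_scaleC star_star assms star_alg_gen.intros simp flip: A_def)
  then show ?thesis
    by simp
qed

lemma pi: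
  "complex_linear (\<pi> x)" "\<pi> 1 = id_blinfun" "\<pi> (x + y) = \<pi> x + \<pi> y" "\<pi> (x * y) = \<pi> x o\<^sub>L \<pi> y"
  "\<pi> (c *\<^sub>C x) = c *\<^sub>C \<pi> x" "adjoint_ops (\<pi> x) (\<pi> (star x))"
  using rep by (simp_all add: suq2_rep_def star_rep_def)

lemma pi_zero [simp]: "\<pi> 0 = 0"
  using pi(3)[of 0 0] by simp

lemma pi_uminus: "\<pi> (- x) = - \<pi> x"
  using pi(3)[of x "- x"] by (simp add: add_eq_0_iff)

lemma pi_diff: "\<pi> (x - y) = \<pi> x - \<pi> y"
  using pi(3)[of x "- y"] by (simp add: pi_uminus)

lemma pi_ket:
  "blinfun_apply (\<pi> \<alpha>) (ket (i, j)) = sqrt (1 - q ^ (2 * i)) *\<^sub>R ket (i - 1, j)"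
  "blinfun_apply (\<pi> \<beta>) (ket (i, j)) = q ^ i *\<^sub>R ket (i, j - 1)"
  using rep by (simp_all add: suq2_rep_def)

lemma coef_pi_star: "coef (blinfun_apply (\<pi> (star x)) f) k = cinner (blinfun_apply (\<pi> x) (ket k)) f"
  using pi(6)[of x] by (simp add: adjoint_ops_def cinner_ket)

lemma coef_pi: "coef (blinfun_apply (\<pi> x) f) k = cinner (blinfun_apply (\<pi> (star x)) (ket k)) f"
  using coef_pi_star[of "star x" f k] by (simp add: star_star)

lemma coef_star_alpha:
  "coef (blinfun_apply (\<pi> (star \<alpha>)) f) (i, j) = of_real (sqrt (1 - q ^ (2 * i))) * coef f (i - 1, j)"
  by (simp add: coef_pi_star pi_ket cinner_scaleR_ket)

lemma coef_star_beta:
  "coef (blinfun_apply (\<pi> (star \<beta>)) f) (i, j) = of_real (q ^ i) * coef f (i, j - 1)"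
  by (simp add: coef_pi_star pi_ket cinner_scaleR_ket)

text \<open>\<open>suq2_rep\<close> describes \<open>\<pi> \<alpha>\<close> on basis vectors only.
  Its values on arbitrary vectors are read off the adjoint, whose columns come from
  \<open>coef_star_alpha\<close>; at first index 0 the vanishing weight absorbs the truncated
  subtraction.\<close>

lemma coef_alpha:
  "coef (blinfun_apply (\<pi> \<alpha>) f) (i, j) = of_real (sqrt (1 - q ^ (2 * Suc i))) * coef f (Suc i, j)"
proof -
  have "blinfun_apply (\<pi> (star \<alpha>)) (ket (i, j)) = sqrt (1 - q ^ (2 * Suc i)) *\<^sub>R ket (Suc i, j)"
  proof (rule ell2_eqI)
    fix k :: "nat \<times> int"
    obtain i' j' where k: "k = (i', j')"
      by (cases k)
    show "coef (blinfun_apply (\<pi> (star \<alpha>)) (ket (i, j))) k =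
      coef (sqrt (1 - q ^ (2 * Suc i)) *\<^sub>R ket (Suc i, j)) k"
      unfolding k by (cases i') (auto simp: coef_star_alpha)
  qed
  then show ?thesis
    by (simp only: coef_pi cinner_scaleR_ket)
qed

lemma coef_beta:
  "coef (blinfun_apply (\<pi> \<beta>) f) (i, j) = of_real (q ^ i) * coef f (i, j + 1)"
proof -
  have "blinfun_apply (\<pi> (star \<beta>)) (ket (i, j)) = q ^ i *\<^sub>R ket (i, j + 1)"
    by (rule ell2_eqI) (auto simp: coef_star_beta split_paired_all)
  then show ?thesis
    by (simp only: coef_pi cinner_scaleR_ket)
qed

text \<open>The weights of the four generators do not depend on j, so translation in j commutes with
  them and hence with all of \<pi>(A).\<close>

lemma pi_translation:
  assumes "x \<in> A"
  shows "coef (blinfun_apply (\<pi> x) f) (i, j + n) = coef (blinfun_apply (\<pi> x) (blinfun_apply (wcomp (\<lambda>_. 1) (\<lambda>(i, j). (i, j + n))) f)) (i, j)"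
proof -
  let ?U = "wcomp (\<lambda>_. 1) (\<lambda>(i, j). (i, j + n)) :: hilb \<Rightarrow>\<^sub>L hilb"
  have U: "coef (blinfun_apply ?U f) (i, j) = coef f (i, j + n)" for f i j
    by (subst coef_wcomp[where M = 1]) (auto simp: inj_on_def)
  have *: "complex_linear ?U"
    by (rule complex_linear_wcomp[where M = 1]) (auto simp: inj_on_def)
  have "?U o\<^sub>L \<pi> x = \<pi> x o\<^sub>L ?U"
    using assms
  proof (induction x rule: A_induct)
    case (add x y)
    then show ?case
      by (simp add: pi blinfun_compose_simps)
  next
    case (mult x y)
    then have IH: "?U o\<^sub>L \<pi> x = \<pi> x o\<^sub>L ?U" "?U o\<^sub>L \<pi> y = \<pi> y o\<^sub>L ?U"
      by auto
    have "?U o\<^sub>L \<pi> (x * y) = (?U o\<^sub>L \<pi> x) o\<^sub>L \<pi> y"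
      by (simp only: pi(4) blinfun_compose_assoc)
    also have "\<dots> = \<pi> x o\<^sub>L (?U o\<^sub>L \<pi> y)"
      unfolding IH(1) by (rule blinfun_compose_assoc)
    also have "\<dots> = \<pi> (x * y) o\<^sub>L ?U"
      unfolding IH(2) by (simp only: pi(4) blinfun_compose_assoc)
    finally show ?case .
  next
    case (scaleC x c)
    then show ?case
      by (simp add: pi blinfun_compose_scaleC_left blinfun_compose_scaleC_right *)
  qed (auto intro!: blinfun_eqI ell2_eqI simp: U coef_alpha coef_beta coef_star_alpha coef_star_beta split_paired_all algebra_simps)
  from arg_cong[OF this, of "\<lambda>T. coef (blinfun_apply T f) (i, j)"] show ?thesis
    by (simp add: U)
qed

lemma pi_coefficient_translate:
  assumes "x \<in> A"
  shows "coef (blinfun_apply (\<pi> x) (ket (k, l + n))) (i, j + n) = coef (blinfun_apply (\<pi> x) (ket (k, l))) (i, j)"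
proof -
  have "blinfun_apply (wcomp (\<lambda>_. 1) (\<lambda>(i, j). (i, j + n))) (ket (k, l + n)) = ket (k, l)"
    by (rule ell2_eqI, subst coef_wcomp[where M = 1]) (auto simp: inj_on_def)
  then show ?thesis
    using pi_translation[OF assms, of "ket (k, l + n)"] by simp
qed

text \<open>The one place where faithfulness of \<open>\<pi>\<close> enters: it turns vanishing
  matrix entries into vanishing in the algebra.\<close>

lemma pi_eq_zero:
  assumes "\<And>k l. coef (blinfun_apply (\<pi> x) (ket k)) l = 0"
  shows "x = 0"
proof -
  have "\<pi> x = \<pi> 0"
    by (rule bounded_linear_eqI_ket) (auto simp: pi assms intro: ell2_eqI)
  then show ?thesis
    using inj by (simp only: inj_eq)
qed

section \<open>Operators S \<pi>(x) + \<pi>(y)\<close>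

definition symb :: "'a \<Rightarrow> 'a \<Rightarrow> hilb \<Rightarrow>\<^sub>L hilb"
  where "symb x y = (sgn_op o\<^sub>L \<pi> x) + \<pi> y"

lemma complex_linear_symb [simp]: "complex_linear (symb x y)"
  by (simp add: symb_def pi)

lemma symb_compact:
  assumes "x \<in> A" "y \<in> A" "symb x y \<in> compact_ops"
  shows "x = 0" "y = 0"
proof -
  have *: "coef (blinfun_apply (\<pi> y) (ket k)) l + s * coef (blinfun_apply (\<pi> x) (ket k)) l = 0"
    if s: "s = 1 \<or> s = - 1" for k l and s :: complex
  proof -
    obtain i j i' j' where k: "k = (i, j)" "l = (i', j')"
      by (cases k, cases l)
    \<comment> \<open>The offset abs j' + 1 puts the row \<open>j' + N n\<close> on the side where
      the sign operator equals \<open>s\<close>, already for \<open>n = 0\<close>; the term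
      \<open>int n\<close> makes the rows distinct.\<close>
    define e :: int where "e = (if s = 1 then 1 else - 1)"
    define N where "N n = e * (int n + \<bar>j'\<bar> + 1)" for n
    have sg: "(if j' + N n \<ge> 0 then 1 else - 1) = s" for n
      using s by (auto simp: N_def e_def abs_if)
    have "inj (\<lambda>n. (i', j' + N n))"
      by (auto simp: inj_on_def N_def e_def split: if_splits)
    moreover have "coef (blinfun_apply (symb x y) (ket (i, j + N n))) (i', j' + N n) =
        coef (blinfun_apply (\<pi> y) (ket k)) l + s * coef (blinfun_apply (\<pi> x) (ket k)) l" for n
      unfolding k symb_def
      by (simp add: blinfun.bilinear_simps coef_sgn_op sg pi_coefficient_translate assms del: if_split)
    ultimately show ?thesis
      by (rule compact_ops_matrix_coefficient[OF assms(3)])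
  qed
  \<comment> \<open>The signs 1 and -1 give y + x = 0 and y - x = 0 entrywise, which separates the
    components.\<close>
  have "coef (blinfun_apply (\<pi> x) (ket k)) l = 0 \<and> coef (blinfun_apply (\<pi> y) (ket k)) l = 0" for k l
    using *[of 1 k l] *[of "- 1" k l] by (auto simp: add_eq_0_iff)
  then show "x = 0" "y = 0"
    using pi_eq_zero by blast+
qed

lemma symb_add: "symb (x + x') (y + y') = symb x y + symb x' y'"
  by (simp add: symb_def pi blinfun_compose_simps)

lemma symb_scaleC: "symb (c *\<^sub>C x) (c *\<^sub>C y) = c *\<^sub>C symb x y"
  by (simp add: symb_def pi blinfun_compose_scaleC_right scaleC_add_right)

text \<open>Only entries with j = l survive, and their bounds are square summable, so
  \<open>compact_ops_dominated\<close> applies. The factor 2i + 2 covers both uses: 2 q^i from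
  commutators with the sign, 2i q^i from those with \<open>D\<close>.\<close>

lemma compact_ops_one_column:
  fixes T :: "hilb \<Rightarrow>\<^sub>L hilb"
  assumes "complex_linear T"
    "\<And>f i j. cmod (coef (blinfun_apply T f) (i, j)) \<le> (if j = l then (2 * of_nat i + 2) * q ^ i * norm f else 0)"
  shows "T \<in> compact_ops"
proof (rule compact_ops_dominated[OF assms(1)])
  let ?v = "\<lambda>i. ((2 * of_nat i + 2) * q ^ i)\<^sup>2"
  let ?w = "\<lambda>(i, j :: int). if j = l then ?v i else 0"
  have "summable ?v"
  proof (rule summable_comparison_test')
    \<comment> \<open>Half of the decay pays for the linear factor: (n + 1) s^n is at most the sum
      of the powers of s up to n, hence at most 1 / (1 - s), and another s^n is left over.\<close>
    define s where "s = sqrt q"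
    have s: "0 < s" "s < 1" "q = s * s"
      using q by (simp_all add: s_def)
    show "summable (\<lambda>n. (2 / (1 - s))\<^sup>2 * q ^ n)"
      using q by (intro summable_mult summable_geometric) simp
    fix n :: nat
    have "(1 + of_nat n) * s ^ n = (\<Sum>k\<le>n. s ^ n)"
      by simp
    also have "\<dots> \<le> (\<Sum>k\<le>n. s ^ k)"
      using s by (intro sum_mono power_decreasing) auto
    also have "\<dots> \<le> 1 / (1 - s)"
      using s by (simp add: sum_gp0 divide_right_mono)
    finally have "(1 + of_nat n) * s ^ n \<le> 1 / (1 - s)" .
    from mult_left_mono[OF this, of "2 * s ^ n"] s
    have "(2 * of_nat n + 2) * q ^ n \<le> 2 / (1 - s) * s ^ n"
      by (simp add: power_mult_distrib algebra_simps)
    from power_mono[OF this, of 2] q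
    have "((2 * of_nat n + 2) * q ^ n)\<^sup>2 \<le> (2 / (1 - s) * s ^ n)\<^sup>2"
      by simp
    also have "\<dots> = (2 / (1 - s))\<^sup>2 * q ^ n"
      by (simp only: power_mult_distrib s(3)) (simp add: power2_eq_square)
    finally show "norm (((2 * of_nat n + 2) * q ^ n)\<^sup>2) \<le> (2 / (1 - s))\<^sup>2 * q ^ n"
      by simp
  qed
  then have "?v summable_on UNIV"
    by (intro norm_summable_imp_summable_on) simp
  then have "?w summable_on (\<lambda>i. (i, l)) ` UNIV"
    by (subst summable_on_reindex) (auto simp: o_def inj_on_def)
  also have "?w summable_on (\<lambda>i. (i, l)) ` UNIV \<longleftrightarrow> ?w summable_on UNIV"
    by (rule summable_on_cong_neutral) auto
  finally show "?w summable_on UNIV" .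
  fix f :: hilb and k :: "nat \<times> int" assume f: "norm f \<le> 1"
  obtain i j where k: "k = (i, j)"
    by (cases k)
  have "(2 * of_nat i + 2) * q ^ i * norm f \<le> (2 * of_nat i + 2) * q ^ i * 1"
    using f q by (intro mult_left_mono) auto
  then have "(if j = l then (2 * of_nat i + 2) * q ^ i * norm f else 0) \<le>
      (if j = l then (2 * of_nat i + 2) * q ^ i else 0)"
    by (cases "j = l") (simp_all only: mult_1_right if_True if_False order_refl simp_thms)
  from order_trans[OF assms(2) this]
  have "cmod (coef (blinfun_apply T f) k) \<le> (if j = l then (2 * of_nat i + 2) * q ^ i else 0)"
    by (simp only: k)
  from power_mono[OF this norm_ge_zero, of 2] show "(cmod (coef (blinfun_apply T f) k))\<^sup>2 \<le> ?w k"
    by (simp add: k split: if_splits)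
qed

lemma compact_ops_commute_add:
  "(S o\<^sub>L T) - (T o\<^sub>L S) \<in> compact_ops \<Longrightarrow> (S o\<^sub>L T') - (T' o\<^sub>L S) \<in> compact_ops \<Longrightarrow>
    (S o\<^sub>L (T + T')) - ((T + T') o\<^sub>L S) \<in> compact_ops"
  using compact_ops_add by (fastforce simp: blinfun_compose_simps algebra_simps)

text \<open>Since \<alpha> and its adjoint fix j, they commute exactly with the sign. \<beta> and
  its adjoint move j by one, so the commutator lives next to the sign change, at j = -1 and j = 0
  respectively, with weight 2 q^i. Products follow from [S, x y] = [S, x] y + x [S, y].\<close>

lemma sgn_op_commute:
  assumes "x \<in> A" shows "(sgn_op o\<^sub>L \<pi> x) - (\<pi> x o\<^sub>L sgn_op) \<in> compact_ops"
  using assms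
proof (induction x rule: A_induct)
  case alpha
  have "(sgn_op o\<^sub>L \<pi> \<alpha>) - (\<pi> \<alpha> o\<^sub>L sgn_op) = 0"
    by (auto intro!: blinfun_eqI ell2_eqI simp: blinfun.bilinear_simps coef_sgn_op coef_alpha split_paired_all)
  then show ?case
    by simp
next
  case star_alpha
  have "(sgn_op o\<^sub>L \<pi> (star \<alpha>)) - (\<pi> (star \<alpha>) o\<^sub>L sgn_op) = 0"
    by (auto intro!: blinfun_eqI ell2_eqI simp: blinfun.bilinear_simps coef_sgn_op coef_star_alpha split_paired_all)
  then show ?case
    by simp
next
  case beta
  show ?case
  proof (rule compact_ops_one_column[where l = "- 1"])
    fix f i and j :: int
    have "coef (blinfun_apply ((sgn_op o\<^sub>L \<pi> \<beta>) - (\<pi> \<beta> o\<^sub>L sgn_op)) f) (i, j) =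
      (if j = - 1 then - 2 * of_real (q ^ i) * coef f (i, j + 1) else 0)"
      by (auto simp: blinfun.bilinear_simps coef_sgn_op coef_beta)
    moreover have "2 * q ^ i * cmod (coef f (i, j + 1)) \<le> (2 * of_nat i + 2) * q ^ i * norm f"
      using q by (intro mult_mono cmod_coef_le_norm) auto
    ultimately show "cmod (coef (blinfun_apply ((sgn_op o\<^sub>L \<pi> \<beta>) - (\<pi> \<beta> o\<^sub>L sgn_op)) f) (i, j)) \<le>
      (if j = - 1 then (2 * of_nat i + 2) * q ^ i * norm f else 0)"
      using q by (cases "j = - 1") (auto simp: norm_mult norm_power)
  qed (simp add: pi)
next
  case star_beta
  show ?case
  proof (rule compact_ops_one_column[where l = 0])
    fix f i and j :: int
    have "coef (blinfun_apply ((sgn_op o\<^sub>L \<pi> (star \<beta>)) - (\<pi> (star \<beta>) o\<^sub>L sgn_op)) f) (i, j) =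
      (if j = 0 then 2 * of_real (q ^ i) * coef f (i, j - 1) else 0)"
      by (auto simp: blinfun.bilinear_simps coef_sgn_op coef_star_beta)
    moreover have "2 * q ^ i * cmod (coef f (i, j - 1)) \<le> (2 * of_nat i + 2) * q ^ i * norm f"
      using q by (intro mult_mono cmod_coef_le_norm) auto
    ultimately show "cmod (coef (blinfun_apply ((sgn_op o\<^sub>L \<pi> (star \<beta>)) - (\<pi> (star \<beta>) o\<^sub>L sgn_op)) f) (i, j)) \<le>
      (if j = 0 then (2 * of_nat i + 2) * q ^ i * norm f else 0)"
      using q by (cases "j = 0") (auto simp: norm_mult norm_power)
  qed (simp add: pi)
next
  case (add x y)
  then show ?case
    by (simp add: pi compact_ops_commute_add)
next
  case (mult x y)
  have "(((sgn_op o\<^sub>L \<pi> x) - (\<pi> x o\<^sub>L sgn_op)) o\<^sub>L \<pi> y) + (\<pi> x o\<^sub>L ((sgn_op o\<^sub>L \<pi> y) - (\<pi> y o\<^sub>L sgn_op))) \<in> compact_ops"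
    using mult by (intro compact_ops_add compact_ops_compose_left compact_ops_compose_right pi)
  then show ?case
    by (simp add: pi blinfun_compose_simps blinfun_compose_assoc)
next
  case (scaleC x c)
  then show ?case
    using compact_ops_scaleC[of "(sgn_op o\<^sub>L \<pi> x) - (\<pi> x o\<^sub>L sgn_op)" c]
    by (simp add: pi blinfun_compose_scaleC_left blinfun_compose_scaleC_right scaleC_diff_right)
qed

text \<open>These differences are the source of the degrees of the generators; the extra 2i at the
  sign change between j = -1 and j = 0 is what \<open>column_op\<close> records.\<close>

lemma dirac_ev_diff:
  "dirac_ev (i, j) - dirac_ev (Suc i, j) = (if j \<ge> 0 then - 1 else 1)"
  "i > 0 \<Longrightarrow> dirac_ev (i, j) - dirac_ev (i - 1, j) = (if j \<ge> 0 then 1 else - 1)"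
  "dirac_ev (i, j) - dirac_ev (i, j + 1) = - 1 - (if j = - 1 then 2 * of_nat i else 0)"
  "dirac_ev (i, j) - dirac_ev (i, j - 1) = 1 + (if j = 0 then 2 * of_nat i else 0)"
  by (auto simp: of_nat_diff)

lemma commutator_alpha: "has_commutator (\<pi> \<alpha>) (symb (- \<alpha>) 0)"
proof (rule has_commutator_wshift[where t = "\<lambda>(i, j). (Suc i, j)"
      and m = "\<lambda>(i, j). of_real (sqrt (1 - q ^ (2 * Suc i)))"])
  fix f and k :: "nat \<times> int"
  obtain i j where k: "k = (i, j)"
    by (cases k)
  show "coef (blinfun_apply (symb (- \<alpha>) 0) f) k =
    of_real (dirac_ev k - dirac_ev (case k of (i, j) \<Rightarrow> (Suc i, j))) *
      ((case k of (i, j) \<Rightarrow> of_real (sqrt (1 - q ^ (2 * Suc i)))) * coef f (case k of (i, j) \<Rightarrow> (Suc i, j)))"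
    unfolding k prod.case dirac_ev_diff
    by (simp add: symb_def blinfun.bilinear_simps pi_uminus coef_sgn_op coef_alpha)
qed (auto simp: pi coef_alpha inj_on_def split_paired_all)

lemma commutator_star_alpha: "has_commutator (\<pi> (star \<alpha>)) (symb (star \<alpha>) 0)"
proof (rule has_commutator_wshift[where t = "\<lambda>(i, j). (i - 1, j)"
      and m = "\<lambda>(i, j). of_real (sqrt (1 - q ^ (2 * i)))"])
  fix f and k :: "nat \<times> int"
  obtain i j where k: "k = (i, j)"
    by (cases k)
  show "coef (blinfun_apply (symb (star \<alpha>) 0) f) k =
    of_real (dirac_ev k - dirac_ev (case k of (i, j) \<Rightarrow> (i - 1, j))) *
      ((case k of (i, j) \<Rightarrow> of_real (sqrt (1 - q ^ (2 * i)))) * coef f (case k of (i, j) \<Rightarrow> (i - 1, j)))"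
  proof (cases "i = 0")
    case False
    then have "dirac_ev (i, j) - dirac_ev (i - 1, j) = (if j \<ge> 0 then 1 else - 1)"
      by (intro dirac_ev_diff) simp
    then show ?thesis
      unfolding k prod.case
      by (simp add: symb_def blinfun.bilinear_simps coef_sgn_op coef_star_alpha del: dirac_ev.simps)
  qed (simp add: k symb_def blinfun.bilinear_simps coef_sgn_op coef_star_alpha)
next
  show "inj_on (\<lambda>(i, j). (i - 1, j)) {k. (case k of (i, j) \<Rightarrow> complex_of_real (sqrt (1 - q ^ (2 * i)))) \<noteq> 0}"
    by (rule inj_onI) (auto simp: split_paired_all gr0_conv_Suc, (metis mult_0_right power_0 diff_self not_gr_zero Suc_pred)+)
qed (auto simp: pi coef_star_alpha)

text \<open>Each of the first \<open>i\<close> powers of q is at least q^i, so i q^i is at most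
  their sum. This is the bound that \<open>column_op\<close> needs as a
  \<open>wcomp\<close>.\<close>

lemma one_column_bounded: "\<bar>2 * of_nat i * q ^ i\<bar> \<le> 2 / (1 - q)"
proof -
  have "of_nat i * q ^ i \<le> (\<Sum>k<i. q ^ k)"
    using q sum_mono[of "{..<i}" "\<lambda>_. q ^ i" "\<lambda>k. q ^ k"] by (simp add: power_decreasing)
  also have "\<dots> \<le> 1 / (1 - q)"
    using q by (simp add: sum_gp_strict divide_right_mono)
  finally show ?thesis
    using q by simp
qed

text \<open>The defect of the commutators at the sign change: for \<beta> it sits at l = -1, is fed
  from j + 1 and has sign s = -1; for the adjoint it sits at l = 0, is fed from j - 1 and has s =
  1.\<close>

definition column_op :: "int \<Rightarrow> int \<Rightarrow> real \<Rightarrow> hilb \<Rightarrow>\<^sub>L hilb"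
  where "column_op l d s =
    wcomp (\<lambda>(i, j). if j = l then of_real (s * (2 * of_nat i * q ^ i)) else 0) (\<lambda>(i, j). (i, j + d))"

lemma column_op:
  assumes "\<bar>s\<bar> = 1"
  shows "coef (blinfun_apply (column_op l d s) f) (i, j) =
      (if j = l then of_real (s * (2 * of_nat i * q ^ i)) * coef f (i, j + d) else 0)"
    and "column_op l d s \<in> compact_ops"
proof -
  have t: "inj (\<lambda>(i :: nat, j :: int). (i, j + d))"
    by (auto simp: inj_on_def)
  have m: "cmod (case k of (i, j) \<Rightarrow> if j = l then of_real (s * (2 * of_nat i * q ^ i)) else 0) \<le> 2 / (1 - q)" for k
    using one_column_bounded[of "fst k"] q assms by (auto simp: abs_mult norm_mult norm_power split: prod.split)
  show coef: "coef (blinfun_apply (column_op l d s) f) (i, j) =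
      (if j = l then of_real (s * (2 * of_nat i * q ^ i)) * coef f (i, j + d) else 0)" for f i j
    unfolding column_op_def coef_wcomp[OF t m] by simp
  show "column_op l d s \<in> compact_ops"
  proof (rule compact_ops_one_column[where l = l])
    show "complex_linear (column_op l d s)"
      unfolding column_op_def by (rule complex_linear_wcomp[OF t m])
    fix f i and j :: int
    have "2 * of_nat i * q ^ i * cmod (coef f (i, j + d)) \<le> (2 * of_nat i + 2) * q ^ i * norm f"
      using q by (intro mult_mono cmod_coef_le_norm) auto
    then show "cmod (coef (blinfun_apply (column_op l d s) f) (i, j)) \<le>
      (if j = l then (2 * of_nat i + 2) * q ^ i * norm f else 0)"
      using q assms by (auto simp: coef norm_mult norm_power abs_mult)
  qed
qed

lemma commutator_beta: "has_commutator (\<pi> \<beta>) (symb 0 (- \<beta>) + column_op (- 1) 1 (- 1))"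
proof (rule has_commutator_wshift[where t = "\<lambda>(i, j). (i, j + 1)" and m = "\<lambda>(i, j). of_real (q ^ i)"])
  fix f and k :: "nat \<times> int"
  obtain i j where k: "k = (i, j)"
    by (cases k)
  show "coef (blinfun_apply (symb 0 (- \<beta>) + column_op (- 1) 1 (- 1)) f) k =
    of_real (dirac_ev k - dirac_ev (case k of (i, j) \<Rightarrow> (i, j + 1))) *
      ((case k of (i, j) \<Rightarrow> of_real (q ^ i)) * coef f (case k of (i, j) \<Rightarrow> (i, j + 1)))"
    unfolding k prod.case dirac_ev_diff
    by (simp add: symb_def blinfun.bilinear_simps pi_uminus coef_beta column_op algebra_simps)
qed (auto simp: pi coef_beta inj_on_def split_paired_all column_op)

lemma commutator_star_beta: "has_commutator (\<pi> (star \<beta>)) (symb 0 (star \<beta>) + column_op 0 (- 1) 1)"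
proof (rule has_commutator_wshift[where t = "\<lambda>(i, j). (i, j - 1)" and m = "\<lambda>(i, j). of_real (q ^ i)"])
  fix f and k :: "nat \<times> int"
  obtain i j where k: "k = (i, j)"
    by (cases k)
  show "coef (blinfun_apply (symb 0 (star \<beta>) + column_op 0 (- 1) 1) f) k =
    of_real (dirac_ev k - dirac_ev (case k of (i, j) \<Rightarrow> (i, j - 1))) *
      ((case k of (i, j) \<Rightarrow> of_real (q ^ i)) * coef f (case k of (i, j) \<Rightarrow> (i, j - 1)))"
    unfolding k prod.case dirac_ev_diff
    by (simp add: symb_def blinfun.bilinear_simps coef_star_beta column_op algebra_simps)
qed (auto simp: pi coef_star_beta inj_on_def split_paired_all column_op)

section \<open>Symbols modulo compact operators\<close>

sublocale unital_subalgebra A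
  by unfold_locales auto

lemma symb_diff: "symb (x - x') (y - y') = symb x y - symb x' y'"
  by (simp add: symb_def pi_diff blinfun_compose_simps)

lemma symb_zero [simp]: "symb 0 0 = 0"
  by (simp add: symb_def)

text \<open>The pair (x, y) is the symbol of T. A relation is used so that existence and uniqueness
  (\<open>approx_unique\<close>) can be shown separately; membership in A is included because
  \<open>symb_compact\<close> speaks of such elements.\<close>

definition approx :: "hilb \<Rightarrow>\<^sub>L hilb \<Rightarrow> 'a \<Rightarrow> 'a \<Rightarrow> bool"
  where "approx T x y \<longleftrightarrow> x \<in> A \<and> y \<in> A \<and> T - symb x y \<in> compact_ops"

lemma approxD: "approx T x y \<Longrightarrow> x \<in> A" "approx T x y \<Longrightarrow> y \<in> A"
  "approx T x y \<Longrightarrow> T - symb x y \<in> compact_ops"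
  by (simp_all add: approx_def)

lemma approx_complex_linear: "approx T x y \<Longrightarrow> complex_linear T"
  using complex_linear_intros(3)[of "T - symb x y" "symb x y"] by (simp add: approx_def)

lemma approx_symb: "x \<in> A \<Longrightarrow> y \<in> A \<Longrightarrow> approx (symb x y) x y"
  by (simp add: approx_def)

lemma approx_pi: "y \<in> A \<Longrightarrow> approx (\<pi> y) 0 y"
  by (simp add: approx_def symb_def)

lemma approx_zero_iff: "approx T 0 0 \<longleftrightarrow> T \<in> compact_ops"
  by (simp add: approx_def)

lemma approx_zero [simp]: "approx 0 0 0"
  by (simp add: approx_zero_iff)

lemma approx_unique:
  assumes "approx T x y" "approx T x' y'" shows "x = x'" "y = y'"
proof -
  have *: "symb (x - x') (y - y') = (T - symb x' y') - (T - symb x y)"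
    by (simp add: symb_diff)
  have "symb (x - x') (y - y') \<in> compact_ops"
    unfolding * by (intro compact_ops_diff approxD(3) assms)
  then show "x = x'" "y = y'"
    using symb_compact[of "x - x'" "y - y'"] assms by (simp_all add: approx_def)
qed

lemma approx_add:
  assumes "approx T x y" "approx T' x' y'" shows "approx (T + T') (x + x') (y + y')"
proof -
  have *: "(T + T') - symb (x + x') (y + y') = (T - symb x y) + (T' - symb x' y')"
    by (simp add: symb_add)
  have "(T + T') - symb (x + x') (y + y') \<in> compact_ops"
    unfolding * by (intro compact_ops_add approxD(3) assms)
  then show ?thesis
    using assms by (simp add: approx_def)
qed

lemma approx_scaleC:
  assumes "approx T x y" shows "approx (c *\<^sub>C T) (c *\<^sub>C x) (c *\<^sub>C y)"
  using assms compact_ops_scaleC[of "T - symb x y" c]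
  by (simp add: approx_def symb_scaleC scaleC_diff_right)

lemma approx_uminus: "approx T x y \<Longrightarrow> approx (- T) (- x) (- y)"
  using approx_scaleC[of T x y "- 1"] by (simp add: scaleC_minus_one)

lemma approx_diff:
  "approx T x y \<Longrightarrow> approx T' x' y' \<Longrightarrow> approx (T - T') (x - x') (y - y')"
  using approx_add[of T x y "- T'" "- x'" "- y'"] approx_uminus[of T' x' y'] by simp

text \<open>Modulo compact operators \<open>sgn_op\<close> is a central involution.\<close>

lemma approx_compose:
  assumes "approx T x y" "approx T' x' y'"
  shows "approx (T o\<^sub>L T') (x * y' + y * x') (x * x' + y * y')"
proof -
  let ?S = "sgn_op" and ?P = "symb x y" and ?P' = "symb x' y'"
  let ?c = "\<lambda>x. (?S o\<^sub>L \<pi> x) - (\<pi> x o\<^sub>L ?S)"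
  have A: "x \<in> A" "y \<in> A" "x' \<in> A" "y' \<in> A"
    using assms by (simp_all add: approx_def)
  have "(T o\<^sub>L T') - (?P o\<^sub>L ?P') = ((T - ?P) o\<^sub>L T') + (?P o\<^sub>L (T' - ?P'))"
    by (simp add: blinfun_compose_simps)
  also have "\<dots> \<in> compact_ops"
    using assms approx_complex_linear[OF assms(2)]
    by (intro compact_ops_add compact_ops_compose_left compact_ops_compose_right) (simp_all add: approx_def)
  finally have 1: "(T o\<^sub>L T') - (?P o\<^sub>L ?P') \<in> compact_ops" .
  \<comment> \<open>After expansion and cancellation of the square of \<open>?S\<close>, only
    commutators of \<open>?S\<close> with \<pi>(x) and \<pi>(y) remain.\<close>
  have "symb (x * y' + y * x') (x * x' + y * y') - (?P o\<^sub>L ?P') =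
      (?S o\<^sub>L (?c x o\<^sub>L \<pi> x')) + (?c y o\<^sub>L \<pi> x')"
    by (simp add: symb_def pi blinfun_compose_simps blinfun_compose_assoc sgn_op_square)
  also have "\<dots> \<in> compact_ops"
    by (intro compact_ops_add compact_ops_compose_left compact_ops_compose_right sgn_op_commute A pi
        complex_linear_sgn_op)
  finally have "(T o\<^sub>L T') - (?P o\<^sub>L ?P') - (symb (x * y' + y * x') (x * x' + y * y') - (?P o\<^sub>L ?P')) \<in> compact_ops"
    by (rule compact_ops_diff[OF 1])
  then show ?thesis
    using A by (simp add: approx_def)
qed

section \<open>Two-sided ideals of A and the ideal of \<beta>\<close>

definition two_sided :: "'a set \<Rightarrow> bool"
  where "two_sided J \<longleftrightarrow> J \<subseteq> A \<and> 0 \<in> J \<and> (\<forall>x\<in>J. \<forall>y\<in>J. x + y \<in> J) \<and>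
    (\<forall>a\<in>A. \<forall>x\<in>J. a * x \<in> J \<and> x * a \<in> J)"

lemma two_sidedD:
  assumes "two_sided J"
  shows "x \<in> J \<Longrightarrow> x \<in> A" "0 \<in> J" "x \<in> J \<Longrightarrow> y \<in> J \<Longrightarrow> x + y \<in> J"
    "a \<in> A \<Longrightarrow> x \<in> J \<Longrightarrow> a * x \<in> J" "a \<in> A \<Longrightarrow> x \<in> J \<Longrightarrow> x * a \<in> J"
  using assms by (auto simp: two_sided_def)

lemma two_sided_scaleR: "two_sided J \<Longrightarrow> x \<in> J \<Longrightarrow> r *\<^sub>R x \<in> J"
  using two_sidedD(4)[of J "r *\<^sub>R 1" x] by simp

lemma two_sided_diff: "two_sided J \<Longrightarrow> x \<in> J \<Longrightarrow> y \<in> J \<Longrightarrow> x - y \<in> J"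
  using two_sidedD(3)[of J x "- 1 *\<^sub>R y"] two_sided_scaleR[of J y "- 1"] by simp

abbreviation R where "R \<equiv> suq2_poly \<alpha> \<beta>"
abbreviation B where "B \<equiv> beta_ideal \<alpha> \<beta>"

lemma R_simps [simp]: "carrier R = A" "x \<otimes>\<^bsub>R\<^esub> y = x * y" "x \<oplus>\<^bsub>R\<^esub> y = x + y" "\<one>\<^bsub>R\<^esub> = 1" "\<zero>\<^bsub>R\<^esub> = 0"
  by (simp_all add: suq2_poly_def A_def)

lemma ring_R: "ring R"
proof (rule ringI)
  show "abelian_group R"
  proof (rule abelian_groupI)
    fix x assume "x \<in> carrier R"
    then show "\<exists>y\<in>carrier R. y \<oplus>\<^bsub>R\<^esub> x = \<zero>\<^bsub>R\<^esub>"
      by (intro bexI[of _ "- x"]) auto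
  qed (auto simp: algebra_simps)
  show "Group.monoid R"
    by (rule Group.monoidI) (auto simp: algebra_simps)
qed (auto simp: algebra_simps)

lemma two_sided_B: "two_sided B" and beta_B: "\<beta> \<in> B" "star \<beta> \<in> B"
proof -
  have sub: "{\<beta>, star \<beta>} \<subseteq> carrier R"
    by simp
  have "{\<beta>, star \<beta>} \<subseteq> B"
    unfolding beta_ideal_def by (rule ring.genideal_self[OF ring_R sub])
  then show "\<beta> \<in> B" "star \<beta> \<in> B"
    by auto
  interpret B: ideal B R
    unfolding beta_ideal_def by (rule ring.genideal_ideal[OF ring_R sub])
  show "two_sided B"
    unfolding two_sided_def
  proof (intro conjI ballI)
    show "B \<subseteq> A"
      using B.a_subset by (simp only: R_simps)
    show "0 \<in> B"
      using additive_subgroup.zero_closed[OF B.is_additive_subgroup] by (simp only: R_simps)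
    show "x + y \<in> B" if "x \<in> B" "y \<in> B" for x y
      using additive_subgroup.a_closed[OF B.is_additive_subgroup that] by (simp only: R_simps)
    show "a * x \<in> B" "x * a \<in> B" if "a \<in> A" "x \<in> B" for a x
      using B.I_l_closed[of x a] B.I_r_closed[of x a] that by (simp_all only: R_simps)
  qed
qed

lemma B_minimal:
  assumes J: "two_sided J" "\<beta> \<in> J" "star \<beta> \<in> J" shows "B \<subseteq> J"
proof -
  interpret R: ring R
    by (rule ring_R)
  have inv: "\<ominus>\<^bsub>R\<^esub> x = - x" if "x \<in> A" for x
    by (rule R.minus_equality) (use that in simp_all)
  have "subgroup J (add_monoid R)"
  proof (rule group.subgroupI[OF R.a_group])
    fix x assume x: "x \<in> J"
    then show "inv\<^bsub>add_monoid R\<^esub> x \<in> J"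
      using inv[of x] two_sidedD(1)[OF J(1) x] two_sided_scaleR[OF J(1) x, of "- 1"] by (simp add: a_inv_def)
  qed (use J two_sidedD[OF J(1)] in auto)
  then have "ideal J R"
    by (intro idealI ring_R) (use two_sidedD[OF J(1)] in auto)
  then show ?thesis
    unfolding beta_ideal_def by (rule R.genideal_minimal) (use J in simp)
qed

lemma approx_beta: "approx (symb 0 (- \<beta>) + column_op (- 1) 1 (- 1)) 0 (- \<beta>)"
  using approx_add[OF approx_symb[of 0 "- \<beta>"], of "column_op (- 1) 1 (- 1)" 0 0]
  by (simp add: approx_zero_iff column_op(2))

lemma approx_star_beta: "approx (symb 0 (star \<beta>) + column_op 0 (- 1) 1) 0 (star \<beta>)"
  using approx_add[OF approx_symb[of 0 "star \<beta>"], of "column_op 0 (- 1) 1" 0 0]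
  by (simp add: approx_zero_iff column_op(2))

text \<open>The first component of the symbol of \<open>[D, \<pi>(a)]\<close> is a derivation vanishing on \<open>\<beta>\<close>, the second
  one vanishes on \<open>\<alpha>\<close> and hence takes values in the ideal of \<open>\<beta>\<close>.\<close>

lemma commutator_exists:
  assumes "a \<in> A"
  shows "\<exists>C x y. has_commutator (\<pi> a) C \<and> y \<in> B \<and> approx C x y"
  using assms
proof (induction a rule: A_induct)
  case alpha
  then show ?case
    using commutator_alpha approx_symb[of "- \<alpha>" 0] two_sidedD(2)[OF two_sided_B] by auto
next
  case star_alpha
  then show ?case
    using commutator_star_alpha approx_symb[of "star \<alpha>" 0] two_sidedD(2)[OF two_sided_B] by auto
next
  case beta
  then show ?case
    using commutator_beta approx_beta two_sided_scaleR[OF two_sided_B beta_B(1), of "- 1"] by auto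
next
  case star_beta
  then show ?case
    using commutator_star_beta approx_star_beta beta_B by auto
next
  case (add a b)
  obtain C x y where *: "has_commutator (\<pi> a) C" "y \<in> B" "approx C x y"
    using add(3) by blast
  obtain C' x' y' where k: "has_commutator (\<pi> b) C'" "y' \<in> B" "approx C' x' y'"
    using add(4) by blast
  show ?case
    unfolding pi(3)
    using has_commutator_add[OF *(1) k(1)] two_sidedD(3)[OF two_sided_B *(2) k(2)] approx_add[OF *(3) k(3)]
    by blast
next
  case (mult a b)
  obtain C x y where *: "has_commutator (\<pi> a) C" "y \<in> B" "approx C x y"
    using mult(3) by blast
  obtain C' x' y' where k: "has_commutator (\<pi> b) C'" "y' \<in> B" "approx C' x' y'"
    using mult(4) by blast
  \<comment> \<open>As \<open>\<pi> a\<close> has symbol (0, a), multiplication by it acts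
    componentwise, so the second component stays in the ideal.\<close>
  have "approx ((\<pi> a o\<^sub>L C') + (C o\<^sub>L \<pi> b)) (a * x' + x * b) (a * y' + y * b)"
    using approx_add[OF approx_compose[OF approx_pi[OF mult(1)] k(3)] approx_compose[OF *(3) approx_pi[OF mult(2)]]]
    by simp
  moreover have "a * y' + y * b \<in> B"
    by (intro two_sidedD(3-5)[OF two_sided_B] mult *(2) k(2))
  ultimately show ?case
    unfolding pi(4) using has_commutator_compose[OF *(1) k(1)] by blast
next
  case (scaleC a c)
  then obtain C x y where *: "has_commutator (\<pi> a) C" "y \<in> B" "approx C x y"
    by blast
  have "c *\<^sub>C y \<in> B"
    using two_sidedD(4)[OF two_sided_B, of "c *\<^sub>C 1" y] *(2) by (simp add: scaleC_mult_left)
  then show ?case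
    unfolding pi(5) using has_commutator_scaleC[OF *(1)] approx_scaleC[OF *(3)] by blast
qed

abbreviation dc :: "'a \<Rightarrow> hilb \<Rightarrow>\<^sub>L hilb" where "dc a \<equiv> dirac_commutator (\<pi> a)"

lemma dc: "a \<in> A \<Longrightarrow> has_commutator (\<pi> a) (dc a)"
  and dc_approx: "a \<in> A \<Longrightarrow> \<exists>x y. y \<in> B \<and> approx (dc a) x y"
  using commutator_exists[of a] dirac_commutator_eq by blast+

lemma dc_add: "a \<in> A \<Longrightarrow> b \<in> A \<Longrightarrow> dc (a + b) = dc a + dc b"
  unfolding pi by (intro dirac_commutator_eq has_commutator_add dc)

lemma dc_scaleC: "a \<in> A \<Longrightarrow> dc (c *\<^sub>C a) = c *\<^sub>C dc a"
  unfolding pi by (intro dirac_commutator_eq has_commutator_scaleC dc)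

lemma dc_mult: "a \<in> A \<Longrightarrow> b \<in> A \<Longrightarrow> dc (a * b) = (\<pi> a o\<^sub>L dc b) + (dc a o\<^sub>L \<pi> b)"
  unfolding pi by (intro dirac_commutator_eq has_commutator_compose dc)

section \<open>Evaluation of the free algebra and symbols of forms\<close>

lemma op_eval_add: "op_eval \<pi> (p + p') = op_eval \<pi> p + op_eval \<pi> p'"
  unfolding op_eval_def by (rule keys_sum_add) (auto simp: scaleC_add_left)

lemma op_eval_single: "op_eval \<pi> (Poly_Mapping.single w c) = c *\<^sub>C word_op \<pi> w"
  by (simp add: op_eval_def)

lemma op_eval_zero [simp]: "op_eval \<pi> 0 = 0"
  by (simp add: op_eval_def)

lemma op_eval_uminus: "op_eval \<pi> (- p) = - op_eval \<pi> p"
  using op_eval_add[of p "- p"] by (simp add: add_eq_0_iff)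

lemma op_eval_diff: "op_eval \<pi> (p - p') = op_eval \<pi> p - op_eval \<pi> p'"
  using op_eval_add[of p "- p'"] by (simp add: op_eval_uminus)

lemma word_op_simps [simp]:
  "word_op \<pi> 0 = id_blinfun" "word_op \<pi> (Word []) = id_blinfun"
  "word_op \<pi> (Word (l # w)) = letter_op \<pi> l o\<^sub>L word_op \<pi> (Word w)"
  by (simp_all add: word_op_def)

lemma word_op_append: "word_op \<pi> (Word (v @ w)) = word_op \<pi> (Word v) o\<^sub>L word_op \<pi> (Word w)"
  by (induction v) (simp_all add: blinfun_compose_assoc)

lemma word_op_approx:
  "set w \<subseteq> Elt ` A \<union> Dif ` A \<Longrightarrow> \<exists>x y. approx (word_op \<pi> (Word w)) x y"
proof (induction w)
  case Nil
  show ?case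
    using approx_pi[of 1] by (auto simp: pi)
next
  case (Cons l w)
  have "\<exists>x y. approx (letter_op \<pi> l) x y"
  proof (cases l)
    case (Elt a)
    then show ?thesis
      using Cons(2) approx_pi[of a] by auto
  next
    case (Dif a)
    then show ?thesis
      using Cons(2) dc_approx[of a] by auto
  qed
  then obtain x y where l: "approx (letter_op \<pi> l) x y"
    by blast
  obtain x' y' where w: "approx (word_op \<pi> (Word w)) x' y'"
    using Cons by auto
  show ?case
    using approx_compose[OF l w] by auto
qed

lemma op_eval_approx: "p \<in> F \<Longrightarrow> \<exists>x y. approx (op_eval \<pi> p) x y"
proof (induction p rule: F_induct)
  case zero
  show ?case
    using approx_zero unfolding op_eval_zero by blast
next
  case (add p q)
  then obtain x y x' y' where "approx (op_eval \<pi> p) x y" "approx (op_eval \<pi> q) x' y'"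
    by blast
  from approx_add[OF this] show ?case
    unfolding op_eval_add by blast
next
  case (single w c)
  then obtain x y where "approx (word_op \<pi> (Word w)) x y"
    using word_op_approx by blast
  from approx_scaleC[OF this] show ?case
    unfolding op_eval_single by blast
qed

lemma op_eval_mult:
  assumes "p \<in> F" "r \<in> F" shows "op_eval \<pi> (p * r) = op_eval \<pi> p o\<^sub>L op_eval \<pi> r"
  using assms(1)
proof (induction p rule: F_induct)
  case (single v c)
  \<comment> \<open>The scalar of the right factor is pulled through this operator; its complex
    linearity comes from having a symbol.\<close>
  have *: "complex_linear (word_op \<pi> (Word v))"
    using word_op_approx[OF single] by (elim exE) (rule approx_complex_linear)
  show ?case
    using assms(2)
  proof (induction r rule: F_induct)
    case (single w d)
    then show ?case
      by (simp add: op_eval_single mult_single Word_plus word_op_append blinfun_compose_scaleC_left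
          blinfun_compose_scaleC_right[OF *] scaleC_scaleC)
  qed (simp_all add: distrib_left op_eval_add blinfun_compose_simps)
qed (simp_all add: distrib_right op_eval_add blinfun_compose_simps)

lemma op_eval_simps [simp]:
  "op_eval \<pi> 1 = id_blinfun" "op_eval \<pi> (elt a) = \<pi> a" "op_eval \<pi> (dif a) = dc a"
  "op_eval \<pi> (const c) = c *\<^sub>C id_blinfun"
  by (simp_all add: elt_def dif_def const_def op_eval_single flip: single_one)

text \<open>The relations become exact operator identities, not only identities modulo compact
  operators, because commuting with \<open>D\<close> is a linear derivation on \<pi>(A). Hence
  symbols depend only on classes.\<close>

lemma op_eval_I: "p \<in> I \<Longrightarrow> op_eval \<pi> p = 0"
proof -
  have "I \<subseteq> {p \<in> F. op_eval \<pi> p = 0}"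
  proof (rule I_minimal)
    show "omega_relations A \<subseteq> {p \<in> F. op_eval \<pi> p = 0}"
    proof
      fix r assume r: "r \<in> omega_relations A"
      consider "r = elt 1 - 1"
        | a b where "a \<in> A" "b \<in> A" "r = elt (a + b) - (elt a + elt b)"
        | a c where "a \<in> A" "r = elt (c *\<^sub>C a) - const c * elt a"
        | a b where "a \<in> A" "b \<in> A" "r = elt (a * b) - elt a * elt b"
        | a b where "a \<in> A" "b \<in> A" "r = dif (a + b) - (dif a + dif b)"
        | a c where "a \<in> A" "r = dif (c *\<^sub>C a) - const c * dif a"
        | a b where "a \<in> A" "b \<in> A" "r = dif (a * b) - (elt a * dif b + dif a * elt b)"
        using r unfolding omega_relations_def by blast
      then have "op_eval \<pi> r = 0"
        by cases (simp_all add: op_eval_add op_eval_diff op_eval_mult dc_add dc_scaleC dc_mult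
            blinfun_compose_scaleC_left, simp_all add: pi)
      then show "r \<in> {p \<in> F. op_eval \<pi> p = 0}"
        using r relations_subset by auto
    qed
  qed (auto simp: op_eval_add op_eval_mult)
  then show "p \<in> I \<Longrightarrow> op_eval \<pi> p = 0"
    by auto
qed

lemma op_eval_cong: "p - p' \<in> I \<Longrightarrow> op_eval \<pi> p = op_eval \<pi> p'"
  using op_eval_I[of "p - p'"] by (simp add: op_eval_diff)

abbreviation has_symbol :: "'a free_alg \<Rightarrow> 'a \<Rightarrow> 'a \<Rightarrow> bool" where "has_symbol p \<equiv> approx (op_eval \<pi> p)"

lemma symbol_mult: "p \<in> F \<Longrightarrow> p' \<in> F \<Longrightarrow> has_symbol p x y \<Longrightarrow> has_symbol p' x' y' \<Longrightarrow>
    has_symbol (p * p') (x * y' + y * x') (x * x' + y * y')"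
  by (simp add: op_eval_mult approx_compose)

lemma symbol_add: "has_symbol p x y \<Longrightarrow> has_symbol p' x' y' \<Longrightarrow> has_symbol (p + p') (x + x') (y + y')"
  and symbol_diff: "has_symbol p x y \<Longrightarrow> has_symbol p' x' y' \<Longrightarrow> has_symbol (p - p') (x - x') (y - y')"
  and symbol_uminus: "has_symbol p x y \<Longrightarrow> has_symbol (- p) (- x) (- y)"
  by (simp_all add: op_eval_add op_eval_diff op_eval_uminus approx_add approx_diff approx_uminus)

lemma symbol_elt: "a \<in> A \<Longrightarrow> has_symbol (elt a) 0 a"
  by (simp add: approx_pi)

text \<open>Commutators have second component in the ideal, and forms of degree 1 only multiply and
  add them. \<open>H_1_surj\<close> shows that there is no further constraint.\<close>

lemma symbol_H_1: "p \<in> H 1 \<Longrightarrow> \<exists>x y. y \<in> B \<and> has_symbol p x y"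
proof (induction p rule: H_induct)
  case zero
  then show ?case
    using approx_zero two_sidedD(2)[OF two_sided_B] unfolding op_eval_zero by blast
next
  case (add p p')
  obtain x y where p: "y \<in> B" "has_symbol p x y"
    using add(3) by blast
  obtain x' y' where p': "y' \<in> B" "has_symbol p' x' y'"
    using add(4) by blast
  show ?case
    using symbol_add[OF p(2) p'(2)] two_sidedD(3)[OF two_sided_B p(1) p'(1)] by blast
next
  case (uminus p)
  then obtain x y where "y \<in> B" "has_symbol p x y"
    by blast
  then have "has_symbol (- p) (- x) (- y)" "- y \<in> B"
    using symbol_uminus two_sided_scaleR[OF two_sided_B, of y "- 1"] by simp_all
  then show ?case
    by blast
next
  case (form a as)
  then obtain b where as: "as = [b]" "b \<in> A"
    by (auto simp: length_Suc_conv)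
  obtain x y where b: "y \<in> B" "has_symbol (dif b) x y"
    using dc_approx[OF as(2)] by auto
  have "has_symbol (elt a * dif b) (0 * y + a * x) (0 * x + a * y)" "0 * x + a * y \<in> B"
    using form as b symbol_mult[OF _ _ symbol_elt b(2), of a] two_sidedD(4)[OF two_sided_B, of a y] by simp_all
  then show ?case
    by (auto simp: as)
next
  case (cong p p')
  then show ?case
    using op_eval_cong[of p' p] by simp
qed

section \<open>Sets of attained symbols\<close>

definition bimod :: "('a \<times> 'a) set \<Rightarrow> bool"
  where "bimod N \<longleftrightarrow> (0, 0) \<in> N \<and> (\<forall>x y. (x, y) \<in> N \<longrightarrow> x \<in> A \<and> y \<in> A) \<and>
    (\<forall>x y x' y'. (x, y) \<in> N \<longrightarrow> (x', y') \<in> N \<longrightarrow> (x + x', y + y') \<in> N) \<and>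
    (\<forall>a x y. a \<in> A \<longrightarrow> (x, y) \<in> N \<longrightarrow> (a * x, a * y) \<in> N \<and> (x * a, y * a) \<in> N)"

text \<open>The two slices turn each component into a question about generators of an ideal of A;
  \<open>bimod_sum\<close> recombines the answers.\<close>

lemma bimod_ideals:
  assumes "bimod N" shows "two_sided {x. (x, 0) \<in> N}" "two_sided {y. (0, y) \<in> N}"
proof -
  have *: "(0, 0) \<in> N" "\<And>x y. (x, y) \<in> N \<Longrightarrow> x \<in> A \<and> y \<in> A"
    "\<And>x y x' y'. (x, y) \<in> N \<Longrightarrow> (x', y') \<in> N \<Longrightarrow> (x + x', y + y') \<in> N"
    "\<And>a x y. a \<in> A \<Longrightarrow> (x, y) \<in> N \<Longrightarrow> (a * x, a * y) \<in> N \<and> (x * a, y * a) \<in> N"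
    using assms unfolding bimod_def by blast+
  show "two_sided {x. (x, 0) \<in> N}"
    unfolding two_sided_def using * *(3)[of _ 0 _ 0] *(4)[of _ _ 0] by auto
  show "two_sided {y. (0, y) \<in> N}"
    unfolding two_sided_def using * *(3)[of 0 _ 0] *(4)[of _ 0] by auto
qed

lemma bimod_sum:
  assumes "bimod N" "(x, 0) \<in> N" "(0, y) \<in> N" shows "(x, y) \<in> N"
proof -
  have "(x + 0, 0 + y) \<in> N"
    using assms unfolding bimod_def by blast
  then show ?thesis
    by simp
qed

lemma two_sided_one: "two_sided J \<Longrightarrow> 1 \<in> J \<Longrightarrow> a \<in> A \<Longrightarrow> a \<in> J"
  using two_sidedD(4)[of J a 1] by simp

text \<open>\<open>(m, n)\<close> is the degree of \<open>b\<close>, its pair of eigenvalues for \<open>\<partial>\<^sub>1, \<partial>\<^sub>2\<close>.\<close>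

definition homogeneous :: "'a \<Rightarrow> real \<Rightarrow> real \<Rightarrow> bool"
  where "homogeneous b m n \<longleftrightarrow> b \<in> A \<and> approx (dc b) (m *\<^sub>R b) (n *\<^sub>R b)"

lemma homogeneous_gens: "homogeneous \<alpha> (- 1) 0" "homogeneous (star \<alpha>) 1 0" "homogeneous \<beta> 0 (- 1)" "homogeneous (star \<beta>) 0 1"
proof -
  show "homogeneous \<alpha> (- 1) 0" "homogeneous (star \<alpha>) 1 0"
    using dirac_commutator_eq[OF commutator_alpha] dirac_commutator_eq[OF commutator_star_alpha]
    by (simp_all add: homogeneous_def approx_symb)
  show "homogeneous \<beta> 0 (- 1)" "homogeneous (star \<beta>) 0 1"
    using dirac_commutator_eq[OF commutator_beta] dirac_commutator_eq[OF commutator_star_beta]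
    by (simp_all add: homogeneous_def approx_beta approx_star_beta)
qed

lemma homogeneous_scaleR: "homogeneous b m n \<Longrightarrow> homogeneous (r *\<^sub>R b) m n"
  using dc_scaleC[of b "of_real r"] approx_scaleC[of "dc b" "m *\<^sub>R b" "n *\<^sub>R b" "of_real r"]
  by (simp add: homogeneous_def scaleC_of_real mult.commute)

text \<open>Both products are written through \<open>\<beta> * star \<beta>\<close>, so that q^2
  times the first minus the second is the scalar q^2 - 1.\<close>

lemma rel_squares:
  "star \<alpha> * \<alpha> = 1 - \<beta> * star \<beta>" "\<alpha> * star \<alpha> = 1 - q\<^sup>2 *\<^sub>R (\<beta> * star \<beta>)"
  using rel(1,2) by (simp_all add: rel(5) eq_diff_eq)

text \<open>The differential of a generator has only one nonzero component, so it enters one slice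
  of the attained symbols: \<alpha> and its adjoint generate A in the first, \<beta> and its adjoint
  generate the \<beta>-ideal in the second.\<close>

lemma H_1_surj:
  assumes "x \<in> A" "y \<in> B" shows "\<exists>p\<in>H 1. has_symbol p x y"
proof -
  define N where "N = {(x, y). \<exists>p\<in>H 1. has_symbol p x y}"
  have N: "bimod N"
    unfolding bimod_def
  proof (intro conjI allI impI)
    show "(0, 0) \<in> N"
      using H_zero by (auto simp: N_def approx_zero_iff intro!: bexI[of _ 0])
    fix x y assume "(x, y) \<in> N"
    then obtain p where p: "p \<in> H 1" "has_symbol p x y"
      by (auto simp: N_def)
    then show "x \<in> A" "y \<in> A"
      by (simp_all add: approx_def)
    show "(x + x', y + y') \<in> N" if N': "(x', y') \<in> N" for x' y'
    proof -
      obtain p' where p': "p' \<in> H 1" "has_symbol p' x' y'"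
        using N' by (auto simp: N_def)
      show ?thesis
        using symbol_add[OF p(2) p'(2)] H_add[OF p(1) p'(1)] unfolding N_def by blast
    qed
    fix a assume a: "a \<in> A"
    have "has_symbol (elt a * p) (a * x) (a * y)" "has_symbol (p * elt a) (x * a) (y * a)"
      using symbol_mult[OF _ _ symbol_elt[OF a] p(2)] symbol_mult[OF _ _ p(2) symbol_elt[OF a]] a H_F[OF p(1)] by simp_all
    moreover have "elt a * p \<in> H 1" "p * elt a \<in> H 1"
      using H_elt[OF a p(1)] H_mult[OF p(1) H_elt_0[OF a]] by simp_all
    ultimately show "(a * x, a * y) \<in> N" "(x * a, y * a) \<in> N"
      unfolding N_def by blast+
  qed
  have dif: "(m *\<^sub>R b, n *\<^sub>R b) \<in> N" if "homogeneous b m n" for b m n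
    using that H_dif_1[of b] by (auto simp: N_def homogeneous_def intro!: bexI[of _ "dif b"])
  let ?X = "{x. (x, 0) \<in> N}" and ?Y = "{y. (0, y) \<in> N}"
  note X = bimod_ideals(1)[OF N] and Y = bimod_ideals(2)[OF N]
  have "- \<alpha> \<in> ?X" "star \<alpha> \<in> ?X"
    using dif[OF homogeneous_gens(1)] dif[OF homogeneous_gens(2)] by simp_all
  \<comment> \<open>The terms in \<open>\<beta> * star \<beta>\<close> cancel and leave a nonzero
    scalar.\<close>
  then have "q\<^sup>2 *\<^sub>R (star \<alpha> * \<alpha>) - \<alpha> * star \<alpha> \<in> ?X"
    using two_sided_scaleR[OF X, of "star \<alpha> * \<alpha>" "q\<^sup>2"] two_sidedD(4)[OF X, of \<alpha> "star \<alpha>"]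
      two_sidedD(5)[OF X, of \<alpha> "star \<alpha>"] two_sided_diff[OF X] by simp
  then have "(q\<^sup>2 - 1) *\<^sub>R 1 \<in> ?X"
    by (simp only: rel_squares scaleR_diff_right scaleR_left_diff_distrib scaleR_one) simp
  from two_sided_scaleR[OF X this, of "inverse (q\<^sup>2 - 1)"] have "1 \<in> ?X"
    using q by (simp add: power2_eq_1_iff)
  then have "x \<in> ?X"
    using assms(1) two_sided_one[OF X] by blast
  moreover have "- \<beta> \<in> ?Y" "star \<beta> \<in> ?Y"
    using dif[OF homogeneous_gens(3)] dif[OF homogeneous_gens(4)] by simp_all
  then have "B \<subseteq> ?Y"
    using two_sided_scaleR[OF Y, of "- \<beta>" "- 1"] by (intro B_minimal Y) simp_all
  ultimately have "(x, y) \<in> N"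
    using assms(2) bimod_sum[OF N] by blast
  then show ?thesis
    by (simp add: N_def)
qed

text \<open>The symbols of \<open>\<delta>J\<^sub>1\<close>.\<close>

definition J1_symbols :: "('a \<times> 'a) set"
  where "J1_symbols = {(x, y). \<exists>e\<in>H 1. has_symbol e 0 0 \<and> has_symbol (free_diff e) x y}"

text \<open>In \<delta>(a e) = (\<delta>a) e + a \<delta>e the first term has symbol zero because
  \<open>e\<close> has, so the symbol of \<delta>e is simply multiplied by \<open>a\<close>;
  similarly on the right.\<close>

lemma bimod_J1_symbols: "bimod J1_symbols"
  unfolding bimod_def
proof (intro conjI allI impI)
  show "(0, 0) \<in> J1_symbols"
    using H_zero by (auto simp: J1_symbols_def approx_zero_iff intro!: bexI[of _ 0])
  fix x y assume "(x, y) \<in> J1_symbols"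
  then obtain e where e: "e \<in> H 1" "has_symbol e 0 0" "has_symbol (free_diff e) x y"
    by (auto simp: J1_symbols_def)
  then show "x \<in> A" "y \<in> A"
    by (simp_all add: approx_def)
  show "(x + x', y + y') \<in> J1_symbols" if J1_symbols: "(x', y') \<in> J1_symbols" for x' y'
  proof -
    obtain e' where e': "e' \<in> H 1" "has_symbol e' 0 0" "has_symbol (free_diff e') x' y'"
      using J1_symbols by (auto simp: J1_symbols_def)
    have "has_symbol (e + e') 0 0" "has_symbol (free_diff (e + e')) (x + x') (y + y')"
      using symbol_add[OF e(2) e'(2)] symbol_add[OF e(3) e'(3)] by (simp_all add: free_diff_add)
    then show ?thesis
      using H_add[OF e(1) e'(1)] by (auto simp: J1_symbols_def)
  qed
  fix a assume a: "a \<in> A"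
  obtain u v where dif: "has_symbol (dif a) u v"
    using op_eval_approx[of "dif a"] a by auto
  note eF = H_F[OF e(1)]
  have "has_symbol (elt a * e) 0 0" "has_symbol (dif a * e + elt a * free_diff e) (a * x) (a * y)"
    using symbol_mult[OF _ _ symbol_elt[OF a] e(2)]
      symbol_add[OF symbol_mult[OF _ _ dif e(2)] symbol_mult[OF _ _ symbol_elt[OF a] e(3)]] a eF by simp_all
  then show "(a * x, a * y) \<in> J1_symbols"
    using H_elt[OF a e(1)] by (auto simp: J1_symbols_def free_diff_mult intro!: bexI[of _ "elt a * e"])
  \<comment> \<open>Degree 1 is odd, so parity is negation modulo \<open>I\<close>, and the term
    \<open>grading e * dif a\<close> also has symbol zero.\<close>
  have "op_eval \<pi> (grading e) = op_eval \<pi> (- e)"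
    using H_1_grading[OF e(1)] by (intro op_eval_cong) simp
  then have "has_symbol (grading e) 0 0"
    using symbol_uminus[OF e(2)] by simp
  then have "has_symbol (free_diff e * elt a + grading e * dif a) (x * a) (y * a)" "has_symbol (e * elt a) 0 0"
    using symbol_mult[OF _ _ e(2) symbol_elt[OF a]]
      symbol_add[OF symbol_mult[OF _ _ e(3) symbol_elt[OF a]] symbol_mult[OF _ _ _ dif, of "grading e" 0 0]] a eF by simp_all
  then show "(x * a, y * a) \<in> J1_symbols"
    using H_mult[OF e(1) H_elt_0[OF a]] by (auto simp: J1_symbols_def free_diff_mult intro!: bexI[of _ "e * elt a"])
qed

text \<open>Junk forms come from the commutation relations \<open>b c = c' b\<close> of homogeneous elements: the form
  \<open>\<delta>b c - c' \<delta>b\<close> has symbol zero, while its differential \<open>- \<delta>b \<delta>c - \<delta>c' \<delta>b\<close> has not.\<close>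

lemma J1_symbols_commutation:
  assumes b: "homogeneous b m n" and c: "homogeneous c m' n'" and c': "homogeneous c' m' n'" and comm: "b * c = c' * b"
  shows "((- 2 * (m * n' + n * m')) *\<^sub>R (b * c), (- 2 * (m * m' + n * n')) *\<^sub>R (b * c)) \<in> J1_symbols"
proof -
  let ?e = "dif b * elt c - elt c' * dif b"
  have A: "b \<in> A" "c \<in> A" "c' \<in> A"
    and d: "has_symbol (dif b) (m *\<^sub>R b) (n *\<^sub>R b)" "has_symbol (dif c) (m' *\<^sub>R c) (n' *\<^sub>R c)" "has_symbol (dif c') (m' *\<^sub>R c') (n' *\<^sub>R c')"
    using b c c' by (simp_all add: homogeneous_def)
  have "has_symbol ?e ((m *\<^sub>R b) * c - c' * (m *\<^sub>R b)) ((n *\<^sub>R b) * c - c' * (n *\<^sub>R b))"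
    using symbol_diff[OF symbol_mult[OF _ _ d(1) symbol_elt[OF A(2)]] symbol_mult[OF _ _ symbol_elt[OF A(3)] d(1)]] A by simp
  then have "has_symbol ?e 0 0"
    by (simp add: comm)
  \<comment> \<open>The graded rule gives \<delta>((\<delta>b) c) = - \<delta>b \<delta>c. Because
    of this sign the two terms do not cancel: as b c = c' b, their symbols are the same multiple of
    b c, which produces the factor -2.\<close>
  moreover have "free_diff ?e = - (dif b * dif c) - dif c' * dif b"
    by (simp add: free_diff_diff free_diff_mult)
  moreover have "has_symbol (- (dif b * dif c) - dif c' * dif b)
    ((- 2 * (m * n' + n * m')) *\<^sub>R (b * c)) ((- 2 * (m * m' + n * n')) *\<^sub>R (b * c))"
  proof -
    have prod: "(r *\<^sub>R u) * (s *\<^sub>R v) = (r * s) *\<^sub>R (u * v)" for r s and u v :: 'a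
      by (simp add: mult.commute)
    have comb: "- (r *\<^sub>R u + s *\<^sub>R u) - (t *\<^sub>R u + v *\<^sub>R u) = (- (r + s) - (t + v)) *\<^sub>R u"
      for r s t v and u :: 'a
      by (simp add: scaleR_left_distrib scaleR_left_diff_distrib)
    have coeff: "- (m * n' + n * m') - (m' * n + n' * m) = - 2 * (m * n' + n * m')"
      "- (m * m' + n * n') - (m' * m + n' * n) = - 2 * (m * m' + n * n')"
      by (simp_all add: algebra_simps)
    have F: "dif b \<in> F" "dif c \<in> F" "dif c' \<in> F"
      using A by simp_all
    show ?thesis
      using symbol_diff[OF symbol_uminus[OF symbol_mult[OF F(1,2) d(1,2)]] symbol_mult[OF F(3,1) d(3,1)]]
      unfolding prod comm[symmetric] comb coeff .
  qed
  moreover have "?e \<in> H 1"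
    using H_mult[OF H_dif_1[OF A(1)] H_elt_0[OF A(2)]] H_elt[OF A(3) H_dif_1[OF A(1)]]
    by (intro H_diff) simp_all
  ultimately show ?thesis
    by (auto simp: J1_symbols_def intro!: bexI[of _ ?e])
qed

text \<open>The degrees decide which component is reached: m n' + n m' is nonzero when an
  \<alpha>-type generator meets a \<beta>-type one, m m' + n n' when both have the same type. So
  mixed products land in the first slice, and products such as \<open>\<alpha> * \<alpha>\<close>
  and \<open>\<beta> * star \<beta>\<close> in the second.\<close>

lemma J1_symbols_surj:
  assumes "x \<in> B" "y \<in> A" shows "(x, y) \<in> J1_symbols"
proof -
  let ?X = "{x. (x, 0) \<in> J1_symbols}" and ?Y = "{y. (0, y) \<in> J1_symbols}"
  note X = bimod_ideals(1)[OF bimod_J1_symbols] and Y = bimod_ideals(2)[OF bimod_J1_symbols]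
  note X_half = two_sided_scaleR[OF X, where r = "1/2"] two_sided_scaleR[OF X, where r = "- 1/2"]
  note Y_half = two_sided_scaleR[OF Y, where r = "1/2"] two_sided_scaleR[OF Y, where r = "- 1/2"]
  have q0: "q \<noteq> 0" and q2: "q\<^sup>2 - 1 \<noteq> 0"
    using q by (simp_all add: power2_eq_1_iff)
  \<comment> \<open>Here c' is \<open>q *\<^sub>R \<beta>\<close>, a scalar multiple having the same
    degree; for \<open>star \<alpha>\<close> the scalar is \<open>inverse q\<close>.\<close>
  have "\<alpha> * \<beta> \<in> ?X"
    using J1_symbols_commutation[OF homogeneous_gens(1,3) homogeneous_scaleR[OF homogeneous_gens(3), of q]] X_half(2)[of "- 2 *\<^sub>R (\<alpha> * \<beta>)"]
    by (simp add: rel)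
  have "\<alpha> * star \<beta> \<in> ?X"
    using J1_symbols_commutation[OF homogeneous_gens(1,4) homogeneous_scaleR[OF homogeneous_gens(4), of q]] X_half(1)[of "2 *\<^sub>R (\<alpha> * star \<beta>)"]
    by (simp add: rel)
  have "star \<alpha> * \<beta> \<in> ?X"
    using J1_symbols_commutation[OF homogeneous_gens(2,3) homogeneous_scaleR[OF homogeneous_gens(3), of "inverse q"]] X_half(1)[of "2 *\<^sub>R (star \<alpha> * \<beta>)"] q0
    by (simp add: rel_star)
  have "star \<alpha> * star \<beta> \<in> ?X"
    using J1_symbols_commutation[OF homogeneous_gens(2,4) homogeneous_scaleR[OF homogeneous_gens(4), of "inverse q"]] X_half(2)[of "- 2 *\<^sub>R (star \<alpha> * star \<beta>)"] q0
    by (simp add: rel_star)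
  \<comment> \<open>The scalar q^2 - 1 appears again, now multiplied by \<open>c\<close>, and
    removes \<alpha> and its adjoint on the left.\<close>
  have gen: "c \<in> ?X" if c: "\<alpha> * c \<in> ?X" "star \<alpha> * c \<in> ?X" for c
  proof -
    have "q\<^sup>2 *\<^sub>R (star \<alpha> * (\<alpha> * c)) - \<alpha> * (star \<alpha> * c) \<in> ?X"
      by (intro two_sided_diff[OF X] two_sided_scaleR[OF X] two_sidedD(4)[OF X] c A_gens)
    moreover have "q\<^sup>2 *\<^sub>R (star \<alpha> * (\<alpha> * c)) - \<alpha> * (star \<alpha> * c) =
        (q\<^sup>2 *\<^sub>R (star \<alpha> * \<alpha>) - \<alpha> * star \<alpha>) * c"
      by (simp add: left_diff_distrib mult.assoc)
    moreover have "\<dots> = (q\<^sup>2 - 1) *\<^sub>R c"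
      unfolding rel_squares by (simp add: scaleR_diff_right scaleR_left_diff_distrib left_diff_distrib)
    ultimately have "(q\<^sup>2 - 1) *\<^sub>R c \<in> ?X"
      by (simp only:)
    from two_sided_scaleR[OF X this, of "inverse (q\<^sup>2 - 1)"] show ?thesis
      using q2 by simp
  qed
  have "\<beta> \<in> ?X" "star \<beta> \<in> ?X"
    using \<open>\<alpha> * \<beta> \<in> ?X\<close> \<open>star \<alpha> * \<beta> \<in> ?X\<close> \<open>\<alpha> * star \<beta> \<in> ?X\<close> \<open>star \<alpha> * star \<beta> \<in> ?X\<close>
    using gen[of \<beta>] gen[of "star \<beta>"] by blast+
  then have "x \<in> ?X"
    using B_minimal[OF X] assms(1) by blast
  \<comment> \<open>Squares are used because \<alpha> does not commute with its adjoint up to a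
    scalar, whereas \<beta> commutes with its own.\<close>
  have "\<alpha> * \<alpha> \<in> ?Y"
    using J1_symbols_commutation[OF homogeneous_gens(1,1,1)] Y_half(2)[of "- 2 *\<^sub>R (\<alpha> * \<alpha>)"] by simp
  have "star \<alpha> * star \<alpha> \<in> ?Y"
    using J1_symbols_commutation[OF homogeneous_gens(2,2,2)] Y_half(2)[of "- 2 *\<^sub>R (star \<alpha> * star \<alpha>)"] by simp
  have bb: "\<beta> * star \<beta> \<in> ?Y"
    using J1_symbols_commutation[OF homogeneous_gens(3,4,4)] Y_half(1)[of "2 *\<^sub>R (\<beta> * star \<beta>)"] by (simp add: rel(5))
  \<comment> \<open>The unit is inserted between \<alpha> and its adjoint and expanded a second
    time, so that every term contains \<open>\<alpha> * \<alpha>\<close> or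
    \<open>\<beta> * star \<beta>\<close>.\<close>
  have "\<alpha> * (\<alpha> * star \<alpha> + q\<^sup>2 *\<^sub>R (\<beta> * star \<beta>)) * star \<alpha> + q\<^sup>2 *\<^sub>R (\<beta> * star \<beta>) = 1"
    unfolding rel(2) by (simp add: rel(2))
  moreover have "\<alpha> * (\<alpha> * star \<alpha> + q\<^sup>2 *\<^sub>R (\<beta> * star \<beta>)) * star \<alpha> + q\<^sup>2 *\<^sub>R (\<beta> * star \<beta>) =
      \<alpha> * \<alpha> * (star \<alpha> * star \<alpha>) + q\<^sup>2 *\<^sub>R (\<alpha> * (\<beta> * star \<beta>) * star \<alpha>) + q\<^sup>2 *\<^sub>R (\<beta> * star \<beta>)"
    by (simp add: algebra_simps)
  moreover have "\<dots> \<in> ?Y"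
    by (intro two_sidedD(3-5)[OF Y] two_sided_scaleR[OF Y] bb A_gens A_mult \<open>\<alpha> * \<alpha> \<in> ?Y\<close>)
  ultimately have "1 \<in> ?Y"
    by simp
  then have "y \<in> ?Y"
    using assms(2) two_sided_one[OF Y] by blast
  then show ?thesis
    using bimod_sum[OF bimod_J1_symbols] \<open>x \<in> ?X\<close> by blast
qed

text \<open>Only the leading part a \<delta>b \<delta>c matters: subtracting a suitable \<delta>e
  with e in J_1 kills its symbol, and the remaining differentials, being closed, can be multiplied
  onto both terms.\<close>

lemma H_decomposition:
  assumes "p \<in> H (2 + n)"
  shows "\<exists>j\<in>H (2 + n). \<exists>e\<in>H (1 + n). has_symbol j 0 0 \<and> has_symbol e 0 0 \<and> p - (j + free_diff e) \<in> I"
  using assms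
proof (induction p rule: H_induct)
  case zero
  show ?case
    using H_zero I_closed(1) approx_zero_iff by (intro bexI[of _ 0]) auto
next
  case (add p p')
  then obtain j e j' e' where *: "j \<in> H (2 + n)" "e \<in> H (1 + n)" "has_symbol j 0 0" "has_symbol e 0 0" "p - (j + free_diff e) \<in> I"
    "j' \<in> H (2 + n)" "e' \<in> H (1 + n)" "has_symbol j' 0 0" "has_symbol e' 0 0" "p' - (j' + free_diff e') \<in> I"
    by blast
  have "p + p' - (j + j' + free_diff (e + e')) \<in> I"
    using I_closed(2)[OF *(5,10)] by (simp add: free_diff_add algebra_simps)
  moreover have "has_symbol (j + j') 0 0" "has_symbol (e + e') 0 0"
    using symbol_add[OF *(3,8)] symbol_add[OF *(4,9)] by simp_all
  ultimately show ?case
    using H_add[OF *(1,6)] H_add[OF *(2,7)] by blast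
next
  case (uminus p)
  then obtain j e where *: "j \<in> H (2 + n)" "e \<in> H (1 + n)" "has_symbol j 0 0" "has_symbol e 0 0" "p - (j + free_diff e) \<in> I"
    by blast
  have "- p - (- j + free_diff (- e)) \<in> I"
    using I_uminus[OF *(5)] by (simp add: free_diff_uminus algebra_simps)
  moreover have "has_symbol (- j) 0 0" "has_symbol (- e) 0 0"
    using symbol_uminus[OF *(3)] symbol_uminus[OF *(4)] by simp_all
  ultimately show ?case
    using H_uminus[OF *(1)] H_uminus[OF *(2)] by blast
next
  case (form a as)
  then obtain b c cs where as: "as = b # c # cs" "b \<in> A" "c \<in> A" "set cs \<subseteq> A" "length cs = n"
    by (cases as rule: remdups_adj.cases) auto
  let ?w = "elt a * (dif b * dif c)"
  obtain x y x' y' where "y \<in> B" "has_symbol (dif b) x y" "y' \<in> B" "has_symbol (dif c) x' y'"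
    using dc_approx[OF as(2)] dc_approx[OF as(3)] by auto
  then have symbol_w: "has_symbol ?w (a * (x * y' + y * x')) (a * (x * x' + y * y'))" and "x \<in> A" "x' \<in> A"
    using symbol_mult[OF _ _ symbol_elt[OF form(1)] symbol_mult[of "dif b" "dif c" x y x' y']] form as
    by (auto simp: approx_def)
  \<comment> \<open>Each summand contains y or y' from the ideal, so the symbol lies in the range
    covered by \<open>J1_symbols_surj\<close>.\<close>
  then have "a * (x * y' + y * x') \<in> B" "a * (x * x' + y * y') \<in> A"
    using \<open>y \<in> B\<close> \<open>y' \<in> B\<close> form(1) two_sidedD[OF two_sided_B] symbol_w by (simp_all add: approx_def)
  then obtain e where e: "e \<in> H 1" "has_symbol e 0 0" "has_symbol (free_diff e) (a * (x * y' + y * x')) (a * (x * x' + y * y'))"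
    using J1_symbols_surj unfolding J1_symbols_def by blast
  define j where "j = ?w - free_diff e"
  have w: "?w \<in> H 2"
    using H_form[of a "[b, c]"] form as by (simp add: numeral_2_eq_2)
  then have j: "j \<in> H 2" "has_symbol j 0 0"
    using H_free_diff[OF e(1)] symbol_diff[OF symbol_w e(3)] by (simp_all add: j_def H_diff numeral_2_eq_2)
  have cs: "difs cs \<in> H n" "difs cs \<in> F"
    using H_one_difs[of cs] as by auto
  obtain u v where uv: "has_symbol (difs cs) u v"
    using op_eval_approx cs by blast
  have "free_diff (difs cs) = 0" for cs
    by (induction cs) (simp_all add: free_diff_mult)
  then have "elt a * difs as = j * difs cs + free_diff (e * difs cs)"
    by (simp add: as j_def free_diff_mult algebra_simps)
  moreover have "has_symbol (j * difs cs) 0 0" "has_symbol (e * difs cs) 0 0"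
    using symbol_mult[OF H_F[OF j(1)] cs(2) j(2) uv] symbol_mult[OF H_F[OF e(1)] cs(2) e(2) uv] by simp_all
  ultimately show ?case
    using H_mult[OF j(1) cs(1)] H_mult[OF e(1) cs(1)] I_closed(1) by (metis diff_self)
next
  case (cong p p')
  then obtain j e where *: "j \<in> H (2 + n)" "e \<in> H (1 + n)" "has_symbol j 0 0" "has_symbol e 0 0" "p - (j + free_diff e) \<in> I"
    by blast
  have "p' - (j + free_diff e) \<in> I"
    using I_closed(2)[OF *(5), of "p' - p"] cong(3,4) by (simp add: algebra_simps)
  with * show ?case
    by blast
qed

section \<open>The bimodules of differential forms\<close>

lemma psi_cl: "p \<in> F \<Longrightarrow> psi \<pi> (cl p) = calkin_map (op_eval \<pi> p)"
  unfolding psi_def by (rule the_elem_cl) (simp add: op_eval_add op_eval_I)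

lemma junk_conv: "junk A \<pi> n = cl ` {p \<in> H n. has_symbol p 0 0}"
proof -
  have "psi \<pi> (cl p) = \<zero>\<^bsub>calkin\<^esub> \<longleftrightarrow> has_symbol p 0 0" if "p \<in> H n" for p
    by (simp only: psi_cl[OF H_F[OF that]] calkin_map_eq_zero approx_zero_iff)
  then show ?thesis
    unfolding junk_def omega_n_conv by blast
qed

lemma carrier_omega_bimodule: "carrier (omega_bimodule A n) = omega_n A n"
  by (simp add: omega_bimodule_def)

text \<open>By \<open>H_decomposition\<close> the denominator is all of \<open>omega_n\<close>, so
  there is a single coset and a constant map is the isomorphism.\<close>

lemma omega_d_zero:
  assumes "n \<ge> 2"
  shows "bimodule_isomorphic R (omega_d A \<pi> n) (ideal_bimodule R {\<zero>\<^bsub>R\<^esub>})"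
proof -
  obtain m where m: "n = 2 + m"
    using assms le_Suc_ex by blast
  let ?W = "junk A \<pi> n <+>\<^bsub>omega A\<^esub> omega_diff A ` junk A \<pi> (n - 1)"
  have W: "?W = omega_n A n"
  proof (intro equalityI subsetI)
    fix X assume "X \<in> ?W"
    then obtain j e where "j \<in> H n" "e \<in> H (n - 1)" "X = cl j \<oplus>\<^bsub>omega A\<^esub> cl (free_diff e)"
      by (auto simp: set_add_def' junk_conv omega_diff)
    then show "X \<in> omega_n A n"
      using H_free_diff[of e "n - 1"] H_add[of j n "free_diff e"] H_F m by (auto simp: omega_n_conv omega_add)
  next
    fix X assume "X \<in> omega_n A n"
    then obtain p where p: "p \<in> H n" "X = cl p"
      by (auto simp: omega_n_conv)
    then obtain j e where *: "j \<in> H n" "e \<in> H (n - 1)" "has_symbol j 0 0" "has_symbol e 0 0" "p - (j + free_diff e) \<in> I"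
      using H_decomposition[of p m] m by auto
    then have "X = cl j \<oplus>\<^bsub>omega A\<^esub> cl (free_diff e)"
      using p H_F by (simp add: omega_add cl_eq_iff)
    then show "X \<in> ?W"
      using * by (auto simp: set_add_def' junk_conv omega_diff[symmetric])
  qed
  have coset: "omega_n A n +>\<^bsub>omega_bimodule A n\<^esub> X = omega_n A n" if X: "X \<in> omega_n A n" for X
  proof -
    obtain p where p: "p \<in> H n" "X = cl p"
      using X by (auto simp: omega_n_conv)
    have "cl p' \<oplus>\<^bsub>omega A\<^esub> X \<in> omega_n A n" if "p' \<in> H n" for p'
      using that p H_F H_add[of p' n p] by (auto simp: omega_add omega_n_conv)
    moreover have "\<exists>Y\<in>omega_n A n. cl p' = Y \<oplus>\<^bsub>omega A\<^esub> X" if "p' \<in> H n" for p'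
      using that p H_F H_diff[of p' n p] by (intro bexI[of _ "cl (p' - p)"]) (auto simp: omega_add omega_n_conv)
    ultimately show ?thesis
      by (auto simp: a_r_coset_def' omega_bimodule_def omega_n_conv)
  qed
  have "carrier (omega_d A \<pi> n) = {omega_n A n}"
    unfolding omega_d_def W quotient_bimodule_def A_RCOSETS_def' carrier_omega_bimodule
    using coset omega_n_conv[of n] H_zero[of n] by auto
  then have "bimodule_iso R (omega_d A \<pi> n) (ideal_bimodule R {\<zero>\<^bsub>R\<^esub>}) (\<lambda>_. 0)"
    by (auto simp: bimodule_iso_def ideal_bimodule_def bij_betw_def)
  then show ?thesis
    by (auto simp: bimodule_isomorphic_def)
qed

text \<open>For z in \<open>A \<times> B\<close> these are the cosets of
  \<open>junk A \<pi> 1\<close>, indexed by symbols (\<open>junk_coset\<close>); the isomorphism in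
  degree 1 is the inverse of this indexing.\<close>

definition fiber :: "'a \<times> 'a \<Rightarrow> 'a free_alg set set"
  where "fiber z = {cl p |p. p \<in> H 1 \<and> has_symbol p (fst z) (snd z)}"

lemma fiber_sy: "p \<in> H 1 \<Longrightarrow> cl p \<in> fiber z \<longleftrightarrow> has_symbol p (fst z) (snd z)"
proof
  assume "cl p \<in> fiber z"
  then obtain p' where "p - p' \<in> I" "has_symbol p' (fst z) (snd z)"
    by (auto simp: fiber_def cl_eq_iff)
  then show "has_symbol p (fst z) (snd z)"
    using op_eval_cong[of p p'] by simp
qed (auto simp: fiber_def)

text \<open>The symbol (0, a) of \<open>elt a\<close> vanishes only for a = 0, so representatives of
  degree-0 junk lie in \<open>I\<close> and their differentials vanish in
  \<open>omega A\<close>.\<close>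

lemma junk_zero: "junk A \<pi> 1 <+>\<^bsub>omega A\<^esub> omega_diff A ` junk A \<pi> 0 = junk A \<pi> 1"
proof -
  have "omega_diff A X = cl 0" if X: "X \<in> junk A \<pi> 0" for X
  proof -
    obtain p where p: "p \<in> H 0" "has_symbol p 0 0" "X = cl p"
      using X by (auto simp: junk_conv)
    then obtain a where a: "a \<in> A" "p - elt a \<in> I"
      using H_0 by blast
    have "has_symbol (elt a) 0 0"
      using p(2) op_eval_cong[OF a(2)] by simp
    then have "a = 0"
      using approx_unique(2)[OF symbol_elt[OF a(1)]] by blast
    have "elt (0 :: 'a) \<in> I"
      using I_relation(3)[OF one_mem, of 0] by (simp add: const_def)
    then have "p \<in> I"
      using I_closed(2)[OF a(2), of "elt 0"] \<open>a = 0\<close> by simp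
    then show ?thesis
      using I_free_diff[of p] by (simp add: p omega_diff cl_eq_iff)
  qed
  moreover have "cl 0 \<in> junk A \<pi> 0"
    using H_zero by (auto simp: junk_conv approx_zero_iff)
  ultimately have "omega_diff A ` junk A \<pi> 0 = {cl 0}"
    by (auto simp: image_iff)
  then show ?thesis
    by (auto simp: set_add_def' junk_conv omega_add H_F)
qed

lemma junk_coset:
  assumes "p \<in> H 1" "has_symbol p (fst z) (snd z)"
  shows "junk A \<pi> 1 +>\<^bsub>omega_bimodule A 1\<^esub> cl p = fiber z"
proof (intro equalityI subsetI)
  fix X assume "X \<in> junk A \<pi> 1 +>\<^bsub>omega_bimodule A 1\<^esub> cl p"
  then obtain j where "j \<in> H 1" "has_symbol j 0 0" "X = cl (j + p)"
    using assms by (auto simp: a_r_coset_def' omega_bimodule_def junk_conv omega_add H_F)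
  then show "X \<in> fiber z"
    using assms symbol_add[of j 0 0 p] H_add by (auto simp: fiber_def)
next
  fix X assume "X \<in> fiber z"
  then obtain p' where p': "p' \<in> H 1" "has_symbol p' (fst z) (snd z)" "X = cl p'"
    by (auto simp: fiber_def)
  then have "cl (p' - p) \<in> junk A \<pi> 1" "X = cl (p' - p) \<oplus>\<^bsub>omega A\<^esub> cl p"
    using assms symbol_diff[OF p'(2) assms(2)] H_diff[of p' 1 p] by (auto simp: junk_conv omega_add H_F)
  then show "X \<in> junk A \<pi> 1 +>\<^bsub>omega_bimodule A 1\<^esub> cl p"
    by (auto simp: a_r_coset_def' omega_bimodule_def)
qed

lemma omega_d_one:
  "bimodule_isomorphic R (omega_d A \<pi> 1)
    (direct_sum_bimodule (ideal_bimodule R A) (ideal_bimodule R B))"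
proof -
  let ?M = "omega_d A \<pi> 1" and ?N = "direct_sum_bimodule (ideal_bimodule R A) (ideal_bimodule R B)"
  have M: "?M = quotient_bimodule (omega_bimodule A 1) (junk A \<pi> 1)"
    using junk_zero by (simp add: omega_d_def)
  have N: "carrier ?N = A \<times> B" "\<And>z z'. z \<oplus>\<^bsub>?N\<^esub> z' = (fst z + fst z', snd z + snd z')"
    "\<And>a z. a \<odot>\<^bsub>?N\<^esub> z = (a * fst z, a * snd z)" "\<And>a z. rsmult ?N z a = (fst z * a, snd z * a)"
    by (auto simp: direct_sum_bimodule_def ideal_bimodule_def split: prod.split)
  have ex: "\<exists>p\<in>H 1. has_symbol p (fst z) (snd z)" if "z \<in> A \<times> B" for z
    using H_1_surj that by auto
  have carrier: "carrier ?M = fiber ` (A \<times> B)"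
  proof (intro equalityI subsetI)
    fix X assume "X \<in> carrier ?M"
    then obtain p where p: "p \<in> H 1" "X = junk A \<pi> 1 +>\<^bsub>omega_bimodule A 1\<^esub> cl p"
      unfolding M by (auto simp: quotient_bimodule_def A_RCOSETS_def' carrier_omega_bimodule omega_n_conv)
    obtain x y where "y \<in> B" "has_symbol p x y"
      using symbol_H_1[OF p(1)] by blast
    with p show "X \<in> fiber ` (A \<times> B)"
      using junk_coset[OF p(1), of "(x, y)"] approxD(1) by auto
  next
    fix X assume "X \<in> fiber ` (A \<times> B)"
    then obtain z p where "p \<in> H 1" "has_symbol p (fst z) (snd z)" "X = fiber z"
      using ex by blast
    then have "X = junk A \<pi> 1 +>\<^bsub>omega_bimodule A 1\<^esub> cl p" "cl p \<in> carrier (omega_bimodule A 1)"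
      using junk_coset by (auto simp: omega_bimodule_def omega_n_conv)
    then show "X \<in> carrier ?M"
      unfolding M by (auto simp: quotient_bimodule_def A_RCOSETS_def')
  qed
  have inj: "inj_on fiber (A \<times> B)"
  proof (rule inj_onI)
    fix z z' assume z: "z \<in> A \<times> B" "fiber z = fiber z'"
    obtain p where p: "p \<in> H 1" "has_symbol p (fst z) (snd z)"
      using ex[OF z(1)] by blast
    then have "has_symbol p (fst z') (snd z')"
      using z(2) fiber_sy by blast
    with p(2) show "z = z'"
      using approx_unique by (auto intro: prod_eqI)
  qed
  have bij: "bij_betw fiber (A \<times> B) (carrier ?M)"
    using inj carrier by (simp add: bij_betw_def)
  have add: "fiber z \<oplus>\<^bsub>?M\<^esub> fiber z' = fiber (z \<oplus>\<^bsub>?N\<^esub> z')" if z: "z \<in> A \<times> B" "z' \<in> A \<times> B" for z z'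
  proof (intro equalityI subsetI)
    fix X assume "X \<in> fiber z \<oplus>\<^bsub>?M\<^esub> fiber z'"
    then obtain p p' where "p \<in> H 1" "has_symbol p (fst z) (snd z)" "p' \<in> H 1" "has_symbol p' (fst z') (snd z')"
      "X = cl p \<oplus>\<^bsub>omega A\<^esub> cl p'"
      unfolding M by (auto simp: quotient_bimodule_def omega_bimodule_def set_add_def' fiber_def)
    then show "X \<in> fiber (z \<oplus>\<^bsub>?N\<^esub> z')"
      using symbol_add H_add by (auto simp: N omega_add H_F fiber_def)
  next
    \<comment> \<open>A form whose symbol is a sum is split by subtracting any form with symbol
      z'.\<close>
    fix X assume "X \<in> fiber (z \<oplus>\<^bsub>?N\<^esub> z')"
    then obtain p where p: "p \<in> H 1" "has_symbol p (fst z + fst z') (snd z + snd z')" "X = cl p"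
      by (auto simp: N fiber_def)
    obtain p' where p': "p' \<in> H 1" "has_symbol p' (fst z') (snd z')"
      using ex[OF z(2)] by blast
    have "cl (p - p') \<in> fiber z" "cl p' \<in> fiber z'" "X = cl (p - p') \<oplus>\<^bsub>omega A\<^esub> cl p'"
      using p p' symbol_diff[OF p(2) p'(2)] H_diff[of p 1 p'] by (auto simp: fiber_def omega_add H_F)
    then show "X \<in> fiber z \<oplus>\<^bsub>?M\<^esub> fiber z'"
      unfolding M by (auto simp: quotient_bimodule_def omega_bimodule_def set_add_def')
  qed
  have left: "a \<odot>\<^bsub>?M\<^esub> fiber z = fiber (a \<odot>\<^bsub>?N\<^esub> z)"
    and right: "rsmult ?M (fiber z) a = fiber (rsmult ?N z a)" if a: "a \<in> A" and z: "z \<in> A \<times> B" for a z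
  proof -
    \<comment> \<open>\<open>quotient_bimodule\<close> acts on a coset by a union over its members.
      Each member gives the same coset, and there is at least one member.\<close>
    have l: "junk A \<pi> 1 +>\<^bsub>omega_bimodule A 1\<^esub> (omega_incl A a \<otimes>\<^bsub>omega A\<^esub> X) = fiber (a * fst z, a * snd z)"
      and r: "junk A \<pi> 1 +>\<^bsub>omega_bimodule A 1\<^esub> (X \<otimes>\<^bsub>omega A\<^esub> omega_incl A a) = fiber (fst z * a, snd z * a)"
      if X: "X \<in> fiber z" for X
    proof -
      obtain p where p: "p \<in> H 1" "has_symbol p (fst z) (snd z)" "X = cl p"
        using X by (auto simp: fiber_def)
      note pF = H_F[OF p(1)]
      have "has_symbol (elt a * p) (a * fst z) (a * snd z)" "has_symbol (p * elt a) (fst z * a) (snd z * a)"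
        using symbol_mult[OF _ pF symbol_elt[OF a] p(2)] symbol_mult[OF pF _ p(2) symbol_elt[OF a]] a by simp_all
      moreover have "elt a * p \<in> H 1" "p * elt a \<in> H 1"
        using H_elt[OF a p(1)] H_mult[OF p(1) H_elt_0[OF a]] by simp_all
      ultimately have "junk A \<pi> 1 +>\<^bsub>omega_bimodule A 1\<^esub> cl (elt a * p) = fiber (a * fst z, a * snd z)"
        "junk A \<pi> 1 +>\<^bsub>omega_bimodule A 1\<^esub> cl (p * elt a) = fiber (fst z * a, snd z * a)"
        by (intro junk_coset; simp)+
      then show "junk A \<pi> 1 +>\<^bsub>omega_bimodule A 1\<^esub> (omega_incl A a \<otimes>\<^bsub>omega A\<^esub> X) = fiber (a * fst z, a * snd z)"
        "junk A \<pi> 1 +>\<^bsub>omega_bimodule A 1\<^esub> (X \<otimes>\<^bsub>omega A\<^esub> omega_incl A a) = fiber (fst z * a, snd z * a)"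
        using a pF by (simp_all add: p(3) omega_incl_def omega_mult)
    qed
    have "fiber z \<noteq> {}"
      using ex[OF z] by (auto simp: fiber_def)
    moreover have "a \<odot>\<^bsub>?M\<^esub> fiber z = (\<Union>X\<in>fiber z. junk A \<pi> 1 +>\<^bsub>omega_bimodule A 1\<^esub> (omega_incl A a \<otimes>\<^bsub>omega A\<^esub> X))"
      "rsmult ?M (fiber z) a = (\<Union>X\<in>fiber z. junk A \<pi> 1 +>\<^bsub>omega_bimodule A 1\<^esub> (X \<otimes>\<^bsub>omega A\<^esub> omega_incl A a))"
      unfolding M by (simp_all add: quotient_bimodule_def omega_bimodule_def)
    ultimately show "a \<odot>\<^bsub>?M\<^esub> fiber z = fiber (a \<odot>\<^bsub>?N\<^esub> z)" "rsmult ?M (fiber z) a = fiber (rsmult ?N z a)"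
      using l r by (auto simp: N)
  qed
  define \<phi> where "\<phi> = inv_into (A \<times> B) fiber"
  have \<phi>: "\<phi> (fiber z) = z" if "z \<in> A \<times> B" for z
    unfolding \<phi>_def using inj that by (rule inv_into_f_f)
  have N_closed: "z \<oplus>\<^bsub>?N\<^esub> z' \<in> A \<times> B" "a \<in> A \<Longrightarrow> a \<odot>\<^bsub>?N\<^esub> z \<in> A \<times> B" "a \<in> A \<Longrightarrow> rsmult ?N z a \<in> A \<times> B"
    if "z \<in> A \<times> B" "z' \<in> A \<times> B" for z z' a
    using that two_sidedD[OF two_sided_B] by (auto simp: N)
  have "bimodule_iso R ?M ?N \<phi>"
    unfolding bimodule_iso_def
  proof (intro conjI ballI)
    show "bij_betw \<phi> (carrier ?M) (carrier ?N)"
      unfolding \<phi>_def N(1) by (rule bij_betw_inv_into[OF bij])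
  next
    fix X Y assume "X \<in> carrier ?M" "Y \<in> carrier ?M"
    then obtain z z' where z: "z \<in> A \<times> B" "X = fiber z" "z' \<in> A \<times> B" "Y = fiber z'"
      unfolding carrier by blast
    show "\<phi> (X \<oplus>\<^bsub>?M\<^esub> Y) = \<phi> X \<oplus>\<^bsub>?N\<^esub> \<phi> Y"
      unfolding z(2,4) add[OF z(1,3)] \<phi>[OF z(1)] \<phi>[OF z(3)] by (rule \<phi>[OF N_closed(1)[OF z(1,3)]])
  next
    fix a X assume "a \<in> carrier R" "X \<in> carrier ?M"
    then obtain z where z: "a \<in> A" "z \<in> A \<times> B" "X = fiber z"
      unfolding carrier R_simps by blast
    show "\<phi> (a \<odot>\<^bsub>?M\<^esub> X) = a \<odot>\<^bsub>?N\<^esub> \<phi> X"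
      unfolding z(3) left[OF z(1,2)] \<phi>[OF z(2)] by (rule \<phi>[OF N_closed(2)[OF z(2,2,1)]])
    show "\<phi> (rsmult ?M X a) = rsmult ?N (\<phi> X) a"
      unfolding z(3) right[OF z(1,2)] \<phi>[OF z(2)] by (rule \<phi>[OF N_closed(3)[OF z(2,2,1)]])
  qed
  then show ?thesis
    by (auto simp: bimodule_isomorphic_def)
qed

end

theorem theorem3p4:
  fixes q :: real
    and \<alpha> \<beta> :: "'a::cstar_algebra"
    and \<pi> :: "'a \<Rightarrow> hilb \<Rightarrow>\<^sub>L hilb"
  assumes "0 < q" and "q < 1"
    and "universal_suq2 q \<alpha> \<beta>"
    and "suq2_rep q \<alpha> \<beta> \<pi>" and "inj \<pi>"
  shows "bimodule_isomorphic (suq2_poly \<alpha> \<beta>)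
      (omega_d (carrier (suq2_poly \<alpha> \<beta>)) \<pi> 1)
      (direct_sum_bimodule
        (ideal_bimodule (suq2_poly \<alpha> \<beta>) (carrier (suq2_poly \<alpha> \<beta>)))
        (ideal_bimodule (suq2_poly \<alpha> \<beta>) (beta_ideal \<alpha> \<beta>))) \<and>
    (\<forall>n\<ge>2. bimodule_isomorphic (suq2_poly \<alpha> \<beta>)
      (omega_d (carrier (suq2_poly \<alpha> \<beta>)) \<pi> n)
      (ideal_bimodule (suq2_poly \<alpha> \<beta>) {\<zero>\<^bsub>suq2_poly \<alpha> \<beta>\<^esub>}))"
proof -
  interpret suq2 q \<alpha> \<beta> \<pi>
    using assms by unfold_locales (simp_all add: universal_suq2_def)
  show ?thesis
    using omega_d_one omega_d_zero by (simp only: R_simps(1)) blast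
qed

end
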